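(* Let $A,B,S,T$ be finite sets and $\Gamma=A\times B\times S\times T$. For any $P\in C_q(\Gamma)$ we have $\xi_*^{\mathrm{q}}(P)=A_{qc}(P)$.
   Context: Correlations. A correlation is $P=(P(a,b|s,t))\in\mathbb{R}^\Gamma$ with nonnegative entries and $\sum_{a,b}P(a,b|s,t)=1$ for all $(s,t)\in S\times T$. A POVM on a Hilbert space is a finite family of positive semidefinite bounded operators summing to the identity. For $d\in\mathbb{N}$, $C_q^d(\Gamma)$ is the set of correlations $P(a,b|s,t)=\psi^*(E_s^a\otimes F_t^b)\psi$ with $\psi\in\mathbb{C}^d\otimes\mathbb{C}^d$ a unit vector and $\{E_s^a\}_{a}$, $\{F_t^b\}_{b}$ POVMs of $d\times d$ matrices for all $s\in S,t\in T$; $C_q(\Gamma)=\bigcup_{d\in\mathbb{N}}C_q^d(\Gamma)$. For $d\in\mathbb{N}\cup\{\infty\}$, $C_{qc}^d(\Gamma)$ is the set of correlations $P(a,b|s,t)=\psi^*(X_s^aY_t^b)\psi$ with $\{X_s^a\}_a$, $\{Y_t^b\}_b$ POVMs on a separable Hilbert space $H$ with $\dim H=d$, $X_s^aY_t^b=Y_t^bX_s^a$ for all $(a,b,s,t)\in\Gamma$, and $\psi\in H$ a unit vector. $D_{qc}(P)=\min\{d\in\mathbb{N}\cup\{\infty\}:P\in C_{qc}^d(\Gamma)\}$, and $$A_{qc}(P)=\inf\Big\{\sum_{i=1}^I\lambda_iD_{qc}(P_i): I\in\mathbb{N},\ \lambda\in\mathbb{R}_+^I,\ \sum_{i=1}^I\lambda_i=1,\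 P=\sum_{i=1}^I\lambda_iP_i,\ P_i\in C_q(\Gamma)\Big\}.$$ Noncommutative polynomials. Let $\mathbf{x}=\{x_s^a:(a,s)\in A\times S\}$, $\mathbf{y}=\{y_t^b:(b,t)\in B\times T\}$, and let $z$ be one more symbol. $\langle\mathbf{x},\mathbf{y},z\rangle$ is the set of all words in these symbols, and $\mathbb{R}\langle\mathbf{x},\mathbf{y},z\rangle$ is the real $*$-algebra of noncommutative polynomials (linear combinations of words), with involution $*$ reversing words and fixing each symbol. A linear functional $L:\mathbb{R}\langle\mathbf{x},\mathbf{y},z\rangle\to\mathbb{R}$ is symmetric if $L(w)=L(w^* )$ for all words $w$, and tracial if $L(ww')=L(w'w)$ for all words $w,w'$. Its moment matrix $M(L)$ is indexed by words, with entries $M(L)_{w,w'}=L(w^*w')$. Let $$\mathcal{G}=\{x_s^a:s\in S,a\in A\}\cup\{y_t^b:t\in T,b\in B\}\cup\{z\},$$ $$\mathcal{H}=\{z-z^2\}\cup\Big\{1-\sum_{a\in A}x_s^a:s\in S\Big\}\cup\Big\{1-\sum_{b\in B}y_t^b:t\in T\Big\}\cup\{x_s^ay_t^b-y_t^bx_s^a:(a,b,s,t)\in\Gamma\},$$ $$\mathcal{R}_\infty=\{zuzvz-zvzuz:u,v\in\langle\mathbf{x},\mathbf{y},z\rangle\}.$$ Let $\mathcal{M}(\mathcal{G})$ be the convex cone generated by all $p^*gp$ with $p\in\mathbb{R}\langle\mathbf{x},\mathbf{y},z\rangle$, $g\in\mathcal{G}\cup\{1\}$, and let $\mathcal{I}(\mathcal{H}\cup\mathcal{R}_\infty)=\{ph:p\in\mathbb{R}\langle\mathbf{x},\mathbf{y},z\rangle,\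 h\in\mathcal{H}\cup\mathcal{R}_\infty\}$. Then $\xi_*^{\mathrm{q}}(P)$ is the minimum of $L(1)$ over all tracial symmetric linear functionals $L$ on $\mathbb{R}\langle\mathbf{x},\mathbf{y},z\rangle$ such that $L(z)=1$, $L(x_s^ay_t^bz)=P(a,b|s,t)$ for all $(a,b,s,t)\in\Gamma$, $L\ge0$ on $\mathcal{M}(\mathcal{G})$, $L=0$ on $\mathcal{I}(\mathcal{H}\cup\mathcal{R}_\infty)$, and $\operatorname{rank}(M(L))<\infty$. *)

theory Defs
  imports
    "HOL-Library.Poly_Mapping"
    "HOL-Library.Extended_Real"
    "HOL-Library.Nonpos_Ints"
    "Jordan_Normal_Form.Conjugate"
    "Jordan_Normal_Form.Matrix"
begin

text \<open>
  Throughout, \<open>A\<close>, \<open>B\<close> are the sets of answers and \<open>S\<close>, \<open>T\<close> the sets of questions of the two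
  parties. A vector indexed by \<open>A \<times> B \<times> S \<times> T\<close> is represented by a curried function
  \<open>P a b s t\<close>, whose values outside \<open>A \<times> B \<times> S \<times> T\<close> are never inspected.
\<close>

section \<open>Correlations\<close>

definition correlation ::
  "'a set \<Rightarrow> 'b set \<Rightarrow> 's set \<Rightarrow> 't set \<Rightarrow> ('a \<Rightarrow> 'b \<Rightarrow> 's \<Rightarrow> 't \<Rightarrow> real) \<Rightarrow> bool" where
  "correlation A B S T P \<longleftrightarrow>
     (\<forall>a\<in>A. \<forall>b\<in>B. \<forall>s\<in>S. \<forall>t\<in>T. 0 \<le> P a b s t) \<and>
     (\<forall>s\<in>S. \<forall>t\<in>T. (\<Sum>a\<in>A. \<Sum>b\<in>B. P a b s t) = 1)"

subsection \<open>Tensor product model\<close>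

definition psd_mat :: "nat \<Rightarrow> complex mat \<Rightarrow> bool" where
  "psd_mat d M \<longleftrightarrow> M \<in> carrier_mat d d \<and> (\<forall>v\<in>carrier_vec d. (M *\<^sub>v v) \<bullet>c v \<in> \<real>\<^sub>\<ge>\<^sub>0)"

definition povm_mat :: "nat \<Rightarrow> 'a set \<Rightarrow> ('a \<Rightarrow> complex mat) \<Rightarrow> bool" where
  "povm_mat d A E \<longleftrightarrow>
     (\<forall>a\<in>A. psd_mat d (E a)) \<and> mat d d (\<lambda>ij. \<Sum>a\<in>A. E a $$ ij) = 1\<^sub>m d"

text \<open>The basis vector \<open>e\<^sub>i \<otimes> e\<^sub>j\<close> of \<open>\<complex>\<^sup>d \<otimes> \<complex>\<^sup>d\<close> is identified with \<open>e\<^bsub>i * d + j\<^esub>\<close>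
  of \<open>\<complex>\<^bsup>d * d\<^esup>\<close>.\<close>

definition kronecker :: "complex mat \<Rightarrow> complex mat \<Rightarrow> complex mat" where
  "kronecker M N =
     mat (dim_row M * dim_row N) (dim_col M * dim_col N)
       (\<lambda>(i, j). M $$ (i div dim_row N, j div dim_col N) * N $$ (i mod dim_row N, j mod dim_col N))"

text \<open>As \<open>u \<bullet>c v\<close> is conjugate-linear in \<open>v\<close>, the number \<open>\<psi>\<^sup>* M \<psi>\<close> is \<open>(M *\<^sub>v \<psi>) \<bullet>c \<psi>\<close>.\<close>

definition C_q_dim ::
  "'a set \<Rightarrow> 'b set \<Rightarrow> 's set \<Rightarrow> 't set \<Rightarrow> nat \<Rightarrow> ('a \<Rightarrow> 'b \<Rightarrow> 's \<Rightarrow> 't \<Rightarrow> real) set" where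
  "C_q_dim A B S T d = {P. correlation A B S T P \<and>
     (\<exists>\<psi> E F. \<psi> \<in> carrier_vec (d * d) \<and> \<psi> \<bullet>c \<psi> = 1 \<and>
        (\<forall>s\<in>S. povm_mat d A (E s)) \<and> (\<forall>t\<in>T. povm_mat d B (F t)) \<and>
        (\<forall>a\<in>A. \<forall>b\<in>B. \<forall>s\<in>S. \<forall>t\<in>T.
           complex_of_real (P a b s t) = (kronecker (E s a) (F t b) *\<^sub>v \<psi>) \<bullet>c \<psi>))}"

definition C_q ::
  "'a set \<Rightarrow> 'b set \<Rightarrow> 's set \<Rightarrow> 't set \<Rightarrow> ('a \<Rightarrow> 'b \<Rightarrow> 's \<Rightarrow> 't \<Rightarrow> real) set" where
  "C_q A B S T = (\<Union>d. C_q_dim A B S T d)"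

subsection \<open>Commuting operator model\<close>

text \<open>
  A separable complex Hilbert space of dimension \<open>d \<in> \<nat> \<union> {\<infinity>}\<close> is unitarily equivalent to
  the space of square-summable sequences supported on \<open>{i. i < d}\<close>, which serves as the
  Hilbert space of dimension \<open>d\<close>; for finite \<open>d\<close> it is \<open>\<complex>\<^sup>d\<close>. Operators are functions of which
  only the values on this space matter.
\<close>

definition ell2 :: "enat \<Rightarrow> (nat \<Rightarrow> complex) set" where
  "ell2 d = {v. (\<forall>i. \<not> enat i < d \<longrightarrow> v i = 0) \<and> summable (\<lambda>i. (cmod (v i))\<^sup>2)}"

definition ell2_inner :: "(nat \<Rightarrow> complex) \<Rightarrow> (nat \<Rightarrow> complex) \<Rightarrow> complex" where
  "ell2_inner u v = suminf (\<lambda>i. cnj (u i) * v i)"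

definition ell2_norm :: "(nat \<Rightarrow> complex) \<Rightarrow> real" where
  "ell2_norm v = sqrt (suminf (\<lambda>i. (cmod (v i))\<^sup>2))"

definition bounded_op :: "enat \<Rightarrow> ((nat \<Rightarrow> complex) \<Rightarrow> (nat \<Rightarrow> complex)) \<Rightarrow> bool" where
  "bounded_op d X \<longleftrightarrow>
     (\<forall>v\<in>ell2 d. X v \<in> ell2 d) \<and>
     (\<forall>u\<in>ell2 d. \<forall>v\<in>ell2 d. X (\<lambda>i. u i + v i) = (\<lambda>i. X u i + X v i)) \<and>
     (\<forall>c. \<forall>v\<in>ell2 d. X (\<lambda>i. c * v i) = (\<lambda>i. c * X v i)) \<and>
     (\<exists>K. \<forall>v\<in>ell2 d. ell2_norm (X v) \<le> K * ell2_norm v)"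

definition psd_op :: "enat \<Rightarrow> ((nat \<Rightarrow> complex) \<Rightarrow> (nat \<Rightarrow> complex)) \<Rightarrow> bool" where
  "psd_op d X \<longleftrightarrow> bounded_op d X \<and> (\<forall>v\<in>ell2 d. ell2_inner v (X v) \<in> \<real>\<^sub>\<ge>\<^sub>0)"

definition povm_op :: "enat \<Rightarrow> 'a set \<Rightarrow> ('a \<Rightarrow> (nat \<Rightarrow> complex) \<Rightarrow> (nat \<Rightarrow> complex)) \<Rightarrow> bool" where
  "povm_op d A X \<longleftrightarrow>
     (\<forall>a\<in>A. psd_op d (X a)) \<and> (\<forall>v\<in>ell2 d. (\<lambda>i. \<Sum>a\<in>A. X a v i) = v)"

definition C_qc_dim ::
  "'a set \<Rightarrow> 'b set \<Rightarrow> 's set \<Rightarrow> 't set \<Rightarrow> enat \<Rightarrow> ('a \<Rightarrow> 'b \<Rightarrow> 's \<Rightarrow> 't \<Rightarrow> real) set" where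
  "C_qc_dim A B S T d = {P. correlation A B S T P \<and>
     (\<exists>\<psi> X Y. \<psi> \<in> ell2 d \<and> ell2_norm \<psi> = 1 \<and>
        (\<forall>s\<in>S. povm_op d A (X s)) \<and> (\<forall>t\<in>T. povm_op d B (Y t)) \<and>
        (\<forall>a\<in>A. \<forall>b\<in>B. \<forall>s\<in>S. \<forall>t\<in>T. \<forall>v\<in>ell2 d. X s a (Y t b v) = Y t b (X s a v)) \<and>
        (\<forall>a\<in>A. \<forall>b\<in>B. \<forall>s\<in>S. \<forall>t\<in>T.
           complex_of_real (P a b s t) = ell2_inner \<psi> (X s a (Y t b \<psi>))))}"

text \<open>On \<open>enat\<close>, the infimum of a nonempty set is its minimum.\<close>

definition D_qc ::
  "'a set \<Rightarrow> 'b set \<Rightarrow> 's set \<Rightarrow> 't set \<Rightarrow> ('a \<Rightarrow> 'b \<Rightarrow> 's \<Rightarrow> 't \<Rightarrow> real) \<Rightarrow> enat" where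
  "D_qc A B S T P = Inf {d. P \<in> C_qc_dim A B S T d}"

definition A_qc ::
  "'a set \<Rightarrow> 'b set \<Rightarrow> 's set \<Rightarrow> 't set \<Rightarrow> ('a \<Rightarrow> 'b \<Rightarrow> 's \<Rightarrow> 't \<Rightarrow> real) \<Rightarrow> ereal" where
  "A_qc A B S T P = Inf {\<Sum>i<I. ereal (l i) * ereal_of_enat (D_qc A B S T (Q i)) | I l Q.
     (\<forall>i<I. 0 \<le> l i) \<and> (\<Sum>i<I. l i) = 1 \<and>
     (\<forall>a\<in>A. \<forall>b\<in>B. \<forall>s\<in>S. \<forall>t\<in>T. P a b s t = (\<Sum>i<(I::nat). l i * Q i a b s t)) \<and>
     (\<forall>i<I. Q i \<in> C_q A B S T)}"

section \<open>Noncommutative polynomials\<close>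

datatype ('a, 'b, 's, 't) symb = SymX 'a 's | SymY 'b 't | SymZ

text \<open>
  Words are lists. With concatenation as addition they form a monoid, so that finitely
  supported real-valued functions on words form, with the convolution product of
  \<open>poly_mapping\<close>, the algebra of noncommutative polynomials.
\<close>

instantiation list :: (type) monoid_add
begin

definition zero_list :: "'a list" where "zero_list = []"

definition plus_list :: "'a list \<Rightarrow> 'a list \<Rightarrow> 'a list" where "plus_list = (@)"

instance
  by standard (simp_all add: zero_list_def plus_list_def)

end

type_synonym ('a, 'b, 's, 't) ncpoly = "('a, 'b, 's, 't) symb list \<Rightarrow>\<^sub>0 real"

definition nc_words ::
  "'a set \<Rightarrow> 'b set \<Rightarrow> 's set \<Rightarrow> 't set \<Rightarrow> ('a, 'b, 's, 't) symb list set" where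
  "nc_words A B S T =
     lists ({SymX a s | a s. a \<in> A \<and> s \<in> S} \<union> {SymY b t | b t. b \<in> B \<and> t \<in> T} \<union> {SymZ})"

definition ncpolys ::
  "'a set \<Rightarrow> 'b set \<Rightarrow> 's set \<Rightarrow> 't set \<Rightarrow> ('a, 'b, 's, 't) ncpoly set" where
  "ncpolys A B S T = {p. Poly_Mapping.keys p \<subseteq> nc_words A B S T}"

definition mon :: "('a, 'b, 's, 't) symb list \<Rightarrow> ('a, 'b, 's, 't) ncpoly" where
  "mon w = Poly_Mapping.single w 1"

definition scale :: "real \<Rightarrow> ('a, 'b, 's, 't) ncpoly \<Rightarrow> ('a, 'b, 's, 't) ncpoly" where
  "scale c p = Poly_Mapping.map ((*) c) p"

text \<open>The coefficient of \<open>star p\<close> at \<open>w\<close> is the coefficient of \<open>p\<close> at \<open>rev w\<close>.\<close>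

definition star :: "('a, 'b, 's, 't) ncpoly \<Rightarrow> ('a, 'b, 's, 't) ncpoly" where
  "star p = Poly_Mapping.map_key rev p"

abbreviation varx :: "'a \<Rightarrow> 's \<Rightarrow> ('a, 'b, 's, 't) ncpoly" where
  "varx a s \<equiv> mon [SymX a s]"

abbreviation vary :: "'b \<Rightarrow> 't \<Rightarrow> ('a, 'b, 's, 't) ncpoly" where
  "vary b t \<equiv> mon [SymY b t]"

abbreviation varz :: "('a, 'b, 's, 't) ncpoly" where
  "varz \<equiv> mon [SymZ]"

definition G_set ::
  "'a set \<Rightarrow> 'b set \<Rightarrow> 's set \<Rightarrow> 't set \<Rightarrow> ('a, 'b, 's, 't) ncpoly set" where
  "G_set A B S T =
     {varx a s | a s. a \<in> A \<and> s \<in> S} \<union> {vary b t | b t. b \<in> B \<and> t \<in> T} \<union> {varz}"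

definition H_set ::
  "'a set \<Rightarrow> 'b set \<Rightarrow> 's set \<Rightarrow> 't set \<Rightarrow> ('a, 'b, 's, 't) ncpoly set" where
  "H_set A B S T =
     {varz - varz * varz} \<union>
     {1 - (\<Sum>a\<in>A. varx a s) | s. s \<in> S} \<union>
     {1 - (\<Sum>b\<in>B. vary b t) | t. t \<in> T} \<union>
     {varx a s * vary b t - vary b t * varx a s | a b s t. a \<in> A \<and> b \<in> B \<and> s \<in> S \<and> t \<in> T}"

definition R_inf ::
  "'a set \<Rightarrow> 'b set \<Rightarrow> 's set \<Rightarrow> 't set \<Rightarrow> ('a, 'b, 's, 't) ncpoly set" where
  "R_inf A B S T =
     {varz * mon u * varz * mon v * varz - varz * mon v * varz * mon u * varz | u v.
        u \<in> nc_words A B S T \<and> v \<in> nc_words A B S T}"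

inductive_set quad_cone ::
  "'a set \<Rightarrow> 'b set \<Rightarrow> 's set \<Rightarrow> 't set \<Rightarrow> ('a, 'b, 's, 't) ncpoly set \<Rightarrow> ('a, 'b, 's, 't) ncpoly set"
  for A :: "'a set" and B :: "'b set" and S :: "'s set" and T :: "'t set"
    and \<G> :: "('a, 'b, 's, 't) ncpoly set"
where
  gen: "p \<in> ncpolys A B S T \<Longrightarrow> g \<in> \<G> \<union> {1} \<Longrightarrow> star p * g * p \<in> quad_cone A B S T \<G>"
| add: "p \<in> quad_cone A B S T \<G> \<Longrightarrow> q \<in> quad_cone A B S T \<G> \<Longrightarrow> p + q \<in> quad_cone A B S T \<G>"
| scale: "p \<in> quad_cone A B S T \<G> \<Longrightarrow> 0 \<le> c \<Longrightarrow> scale c p \<in> quad_cone A B S T \<G>"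

definition left_multiples ::
  "'a set \<Rightarrow> 'b set \<Rightarrow> 's set \<Rightarrow> 't set \<Rightarrow> ('a, 'b, 's, 't) ncpoly set \<Rightarrow> ('a, 'b, 's, 't) ncpoly set"
where
  "left_multiples A B S T \<H> = {p * h | p h. p \<in> ncpolys A B S T \<and> h \<in> \<H>}"

section \<open>Linear functionals\<close>

text \<open>Functionals are functions of which only the values on \<open>ncpolys A B S T\<close> matter.\<close>

definition linear_functional ::
  "'a set \<Rightarrow> 'b set \<Rightarrow> 's set \<Rightarrow> 't set \<Rightarrow> (('a, 'b, 's, 't) ncpoly \<Rightarrow> real) \<Rightarrow> bool" where
  "linear_functional A B S T L \<longleftrightarrow>
     (\<forall>p\<in>ncpolys A B S T. \<forall>q\<in>ncpolys A B S T. L (p + q) = L p + L q) \<and>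
     (\<forall>c. \<forall>p\<in>ncpolys A B S T. L (scale c p) = c * L p)"

definition symmetric_functional ::
  "'a set \<Rightarrow> 'b set \<Rightarrow> 's set \<Rightarrow> 't set \<Rightarrow> (('a, 'b, 's, 't) ncpoly \<Rightarrow> real) \<Rightarrow> bool" where
  "symmetric_functional A B S T L \<longleftrightarrow> (\<forall>w\<in>nc_words A B S T. L (mon w) = L (star (mon w)))"

definition tracial_functional ::
  "'a set \<Rightarrow> 'b set \<Rightarrow> 's set \<Rightarrow> 't set \<Rightarrow> (('a, 'b, 's, 't) ncpoly \<Rightarrow> real) \<Rightarrow> bool" where
  "tracial_functional A B S T L \<longleftrightarrow>
     (\<forall>w\<in>nc_words A B S T. \<forall>w'\<in>nc_words A B S T. L (mon w * mon w') = L (mon w' * mon w))"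

definition moment_matrix ::
  "(('a, 'b, 's, 't) ncpoly \<Rightarrow> real) \<Rightarrow> ('a, 'b, 's, 't) symb list \<Rightarrow> ('a, 'b, 's, 't) symb list \<Rightarrow> real"
where
  "moment_matrix L w w' = L (star (mon w) * mon w')"

text \<open>Rank of a possibly infinite matrix with rows and columns indexed by \<open>W\<close>:
  the supremum of the sizes of finite linearly independent families of columns.\<close>

definition matrix_rank :: "'w set \<Rightarrow> ('w \<Rightarrow> 'w \<Rightarrow> real) \<Rightarrow> enat" where
  "matrix_rank W M = Sup {enat (card V) | V. finite V \<and> V \<subseteq> W \<and>
     (\<forall>c. (\<forall>u\<in>W. (\<Sum>v\<in>V. c v * M u v) = 0) \<longrightarrow> (\<forall>v\<in>V. c v = 0))}"

definition xi_feasible ::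
  "'a set \<Rightarrow> 'b set \<Rightarrow> 's set \<Rightarrow> 't set \<Rightarrow> ('a \<Rightarrow> 'b \<Rightarrow> 's \<Rightarrow> 't \<Rightarrow> real) \<Rightarrow>
     (('a, 'b, 's, 't) ncpoly \<Rightarrow> real) \<Rightarrow> bool" where
  "xi_feasible A B S T P L \<longleftrightarrow>
     linear_functional A B S T L \<and>
     symmetric_functional A B S T L \<and>
     tracial_functional A B S T L \<and>
     L varz = 1 \<and>
     (\<forall>a\<in>A. \<forall>b\<in>B. \<forall>s\<in>S. \<forall>t\<in>T. L (varx a s * vary b t * varz) = P a b s t) \<and>
     (\<forall>p\<in>quad_cone A B S T (G_set A B S T). 0 \<le> L p) \<and>
     (\<forall>p\<in>left_multiples A B S T (H_set A B S T \<union> R_inf A B S T). L p = 0) \<and>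
     matrix_rank (nc_words A B S T) (moment_matrix L) < \<infinity>"

text \<open>\<open>xi_star_q\<close> is a minimum, not merely an infimum: \<open>LEAST\<close> yields a specified value only if
  an optimal feasible \<open>L\<close> exists.\<close>

definition xi_star_q ::
  "'a set \<Rightarrow> 'b set \<Rightarrow> 's set \<Rightarrow> 't set \<Rightarrow> ('a \<Rightarrow> 'b \<Rightarrow> 's \<Rightarrow> 't \<Rightarrow> real) \<Rightarrow> ereal" where
  "xi_star_q A B S T P = (LEAST v. \<exists>L. xi_feasible A B S T P L \<and> v = ereal (L 1))"

end

(*
  Upper bound.  A decomposition P = sum_i l_i P_i into correlations of dimension D_i, with states
  psi_i, gives the functional L(p) = sum_i l_i Re Tr p(X_i, Y_i, psi_i psi_i^* ), whose value at 1 is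
  the cost sum_i l_i D_i.  The infimum defining A_qc is attained: by Caratheodory boundedly many
  terms suffice, and along a minimising sequence the terms of unbounded dimension have weights
  tending to 0, so that they drop out of the limit.

  Lower bound.  The GNS construction turns a feasible L into a finite-dimensional *-algebra of
  matrices with a trace tau, in which z is a projection and the corner z A z is commutative.  Split z
  into minimal projections e.  Each left ideal A e is a Hilbert space with an orthonormal basis
  b_1, ..., b_m (m = m_e), on which the POVMs act by multiplication; the vector e gives a correlation
  P_e, and P = sum_e tau(e) P_e.  The projections b_k b_k^* for all e and k are orthogonal and
  have trace tau(e), whence sum_e tau(e) m_e <= tau(1) = L(1).

  Since terms of a decomposition have to be in C_q, one also needs that commuting models of finite
  dimension are tensor product models: the state x (x) y -> psi^* x y psi has a density matrix
  by Riesz, and a square root of it gives a purification.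
*)
theory Submission
  imports Defs "HOL-Computational_Algebra.Fundamental_Theorem_Algebra"
begin

text \<open>The lower bound rests on one identity: if e and f are projections in the commutative
  corner, then e x f = (z x z) e f. Hence e A f = 0 for different minimal e and f, and e A e
  consists of multiples of e. The second fact turns A e into a Hilbert space whose inner product
  \<open>adj b * a\<close> takes values in the multiples of e; the first makes the projections of
  different e orthogonal. That all have trace tau(e) is traciality applied to
  \<open>b * adj b\<close> and \<open>adj b * b\<close>. Finite rank of the moment matrix keeps
  everything finite-dimensional, so that spectral theory reduces to the existence of an eigenvalue.

  Only the commuting dimension is charged for. The passage to a tensor product model may therefore
  enlarge the space freely, here from d to d^3 for each party. Besides placing the P_e in C_q, it
  places the limits of a minimising sequence there. The infimum has to be attained because the other
  side is a minimum, so the upper bound needs a feasible functional of exactly the value A_qc. In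
  the compactness argument the dimension enters through its reciprocal, which stays bounded.\<close>

section \<open>Finitely supported complex matrices\<close>

text \<open>One type contains the matrices of every size: the \<open>n \<times> n\<close> matrices are its corner
  \<open>{M. dimle n M}\<close>, with unit \<open>idm n\<close>. Vectors are matrices whose only nonzero
  column is column 0.\<close>

typedef fmat = "{f :: nat \<Rightarrow> nat \<Rightarrow> complex. \<exists>n. \<forall>i j. f i j \<noteq> 0 \<longrightarrow> i < n \<and> j < n}"
  morphisms ent Abs_fmat
  by (rule exI[of _ "\<lambda>i j. 0"]) simp

setup_lifting type_definition_fmat

lemma fmat_eqI: "(\<And>i j. ent M i j = ent N i j) \<Longrightarrow> M = N"
  by (simp add: ent_inject[symmetric] fun_eq_iff)

definition dimle :: "nat \<Rightarrow> fmat \<Rightarrow> bool" where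
  "dimle n M \<longleftrightarrow> (\<forall>i j. ent M i j \<noteq> 0 \<longrightarrow> i < n \<and> j < n)"

lemma dimle_ex: "\<exists>n. dimle n M"
  using ent[of M] by (auto simp: dimle_def)

lemma dimle_mono: "dimle n M \<Longrightarrow> n \<le> m \<Longrightarrow> dimle m M"
  by (auto simp: dimle_def intro: less_le_trans)

lemma dimle_ex2: "\<exists>n. dimle n M \<and> dimle n N"
proof -
  obtain a b where "dimle a M" "dimle b N" using dimle_ex by blast
  then show ?thesis by (intro exI[of _ "max a b"]) (auto elim: dimle_mono)
qed

lemma dimle_zero_row: "dimle n M \<Longrightarrow> n \<le> i \<Longrightarrow> ent M i j = 0"
  unfolding dimle_def by (meson not_le)

lemma dimle_zero_col: "dimle n M \<Longrightarrow> n \<le> j \<Longrightarrow> ent M i j = 0"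
  unfolding dimle_def by (meson not_le)

instantiation fmat :: ring
begin

lift_definition zero_fmat :: fmat is "\<lambda>i j. 0" by simp

lift_definition plus_fmat :: "fmat \<Rightarrow> fmat \<Rightarrow> fmat" is "\<lambda>f g i j. f i j + g i j"
proof -
  fix f g :: "nat \<Rightarrow> nat \<Rightarrow> complex"
  assume "\<exists>n. \<forall>i j. f i j \<noteq> 0 \<longrightarrow> i < n \<and> j < n" "\<exists>n. \<forall>i j. g i j \<noteq> 0 \<longrightarrow> i < n \<and> j < n"
  then obtain a b where "\<forall>i j. f i j \<noteq> 0 \<longrightarrow> i < a \<and> j < a" "\<forall>i j. g i j \<noteq> 0 \<longrightarrow> i < b \<and> j < b"
    by blast
  then show "\<exists>n. \<forall>i j. f i j + g i j \<noteq> 0 \<longrightarrow> i < n \<and> j < n"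
    by (intro exI[of _ "a + b"]) (metis add.right_neutral trans_less_add1 trans_less_add2)
qed

lift_definition uminus_fmat :: "fmat \<Rightarrow> fmat" is "\<lambda>f i j. - f i j" by simp

definition minus_fmat :: "fmat \<Rightarrow> fmat \<Rightarrow> fmat" where "minus_fmat M N = M + - N"

text \<open>Summing over the support of row i gives a finite sum without choosing a size;
  \<open>ent_times\<close> replaces it by a sum over any long enough initial segment.\<close>

lift_definition times_fmat :: "fmat \<Rightarrow> fmat \<Rightarrow> fmat" is
  "\<lambda>f g i j. \<Sum>k | f i k \<noteq> 0. f i k * g k j"
proof -
  fix f g :: "nat \<Rightarrow> nat \<Rightarrow> complex"
  assume "\<exists>n. \<forall>i j. f i j \<noteq> 0 \<longrightarrow> i < n \<and> j < n" "\<exists>n. \<forall>i j. g i j \<noteq> 0 \<longrightarrow> i < n \<and> j < n"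
  then obtain a b where ab: "\<forall>i j. f i j \<noteq> 0 \<longrightarrow> i < a \<and> j < a" "\<forall>i j. g i j \<noteq> 0 \<longrightarrow> i < b \<and> j < b"
    by blast
  show "\<exists>n. \<forall>i j. (\<Sum>k | f i k \<noteq> 0. f i k * g k j) \<noteq> 0 \<longrightarrow> i < n \<and> j < n"
  proof (intro exI[of _ "a + b"] allI impI)
    fix i j assume "(\<Sum>k | f i k \<noteq> 0. f i k * g k j) \<noteq> 0"
    then obtain k where "f i k * g k j \<noteq> 0" by (meson sum.not_neutral_contains_not_neutral)
    then have "i < a" "j < b" using ab by auto
    then show "i < a + b \<and> j < a + b" by simp
  qed
qed

lemma ent_zero [simp]: "ent 0 i j = 0" by transfer simp
lemma ent_plus [simp]: "ent (M + N) i j = ent M i j + ent N i j" by transfer simp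
lemma ent_uminus [simp]: "ent (- M) i j = - ent M i j" by transfer simp
lemma ent_minus [simp]: "ent (M - N) i j = ent M i j - ent N i j" by (simp add: minus_fmat_def)

text \<open>A bound on the left factor suffices: its vanishing columns annihilate the remaining rows
  of the right factor, whatever these are.\<close>

lemma ent_times:
  assumes "\<And>k. n \<le> k \<Longrightarrow> ent M i k = 0"
  shows "ent (M * N) i j = (\<Sum>k<n. ent M i k * ent N k j)"
proof -
  have "ent (M * N) i j = (\<Sum>k | ent M i k \<noteq> 0. ent M i k * ent N k j)" by transfer simp
  also have "\<dots> = (\<Sum>k<n. ent M i k * ent N k j)"
    by (rule sum.mono_neutral_left) (use assms not_less in auto)
  finally show ?thesis .
qed

lemma ent_times_dimle: "dimle n M \<Longrightarrow> ent (M * N) i j = (\<Sum>k<n. ent M i k * ent N k j)"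
  by (rule ent_times) (rule dimle_zero_col)

lemma dimle_times:
  assumes M: "dimle n M" and N: "dimle n N"
  shows "dimle n (M * N)"
  unfolding dimle_def
proof (intro allI impI)
  fix i j
  assume "ent (M * N) i j \<noteq> 0"
  then have "(\<Sum>k<n. ent M i k * ent N k j) \<noteq> 0" by (simp add: ent_times_dimle[OF M])
  then obtain k where "ent M i k * ent N k j \<noteq> 0" by (meson sum.not_neutral_contains_not_neutral)
  then show "i < n \<and> j < n" using M N unfolding dimle_def by (metis mult_eq_0_iff)
qed

instance
proof
  fix M N K :: fmat
  show "M * N * K = M * (N * K)"
  proof (rule fmat_eqI)
    fix i j
    obtain n where n: "dimle n M" "dimle n N" using dimle_ex2 by blast
    then have "dimle n (M * N)" by (rule dimle_times)
    then have "ent (M * N * K) i j = (\<Sum>k<n. (\<Sum>l<n. ent M i l * ent N l k) * ent K k j)"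
      using n by (simp add: ent_times_dimle)
    also have "\<dots> = (\<Sum>l<n. ent M i l * (\<Sum>k<n. ent N l k * ent K k j))"
      unfolding sum_distrib_right sum_distrib_left mult.assoc by (rule sum.swap)
    also have "\<dots> = ent (M * (N * K)) i j" using n by (simp add: ent_times_dimle)
    finally show "ent (M * N * K) i j = ent (M * (N * K)) i j" .
  qed
  show "(M + N) * K = M * K + N * K"
  proof (rule fmat_eqI)
    fix i j
    obtain n where n: "dimle n M" "dimle n N" using dimle_ex2 by blast
    then have "dimle n (M + N)" by (auto simp: dimle_def) (metis add.right_neutral)+
    then show "ent ((M + N) * K) i j = ent (M * K + N * K) i j"
      using n by (simp add: ent_times_dimle distrib_right sum.distrib)
  qed
  show "M * (N + K) = M * N + M * K"
  proof (rule fmat_eqI)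
    fix i j
    obtain n where n: "dimle n M" using dimle_ex by blast
    then show "ent (M * (N + K)) i j = ent (M * N + M * K) i j"
      by (simp add: ent_times_dimle distrib_left sum.distrib)
  qed
qed (auto intro!: fmat_eqI simp: minus_fmat_def)

end

lemma ent_sum [simp]: "ent (\<Sum>x\<in>F. f x) i j = (\<Sum>x\<in>F. ent (f x) i j)"
  by (induction F rule: infinite_finite_induct) auto

section \<open>Scalar multiples, adjoints and units\<close>

lift_definition scC :: "complex \<Rightarrow> fmat \<Rightarrow> fmat" (infixr "*\<^sub>C" 75) is "\<lambda>c f i j. c * f i j"
proof -
  fix c and f :: "nat \<Rightarrow> nat \<Rightarrow> complex"
  assume "\<exists>n. \<forall>i j. f i j \<noteq> 0 \<longrightarrow> i < n \<and> j < n"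
  then obtain n where "\<forall>i j. f i j \<noteq> 0 \<longrightarrow> i < n \<and> j < n" ..
  then show "\<exists>n. \<forall>i j. c * f i j \<noteq> 0 \<longrightarrow> i < n \<and> j < n"
    by (intro exI[of _ n]) (metis mult_zero_right)
qed

lemma ent_scC [simp]: "ent (c *\<^sub>C M) i j = c * ent M i j" by transfer simp

interpretation fmat: vector_space scC
  by standard (rule fmat_eqI, simp add: distrib_left distrib_right mult.assoc)+

lemma scC_mult_left [simp]: "(c *\<^sub>C M) * N = c *\<^sub>C (M * N)"
proof (rule fmat_eqI)
  fix i j
  obtain n where "dimle n M" using dimle_ex by blast
  moreover from this have "dimle n (c *\<^sub>C M)" by (auto simp: dimle_def)
  ultimately show "ent ((c *\<^sub>C M) * N) i j = ent (c *\<^sub>C (M * N)) i j"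
    by (simp add: ent_times_dimle sum_distrib_left mult.assoc)
qed

lemma scC_mult_right [simp]: "M * (c *\<^sub>C N) = c *\<^sub>C (M * N)"
proof (rule fmat_eqI)
  fix i j
  obtain n where "dimle n M" using dimle_ex by blast
  then show "ent (M * (c *\<^sub>C N)) i j = ent (c *\<^sub>C (M * N)) i j"
    by (simp add: ent_times_dimle sum_distrib_left mult.left_commute)
qed

lift_definition adj :: "fmat \<Rightarrow> fmat" is "\<lambda>f i j. cnj (f j i)" by auto

lemma ent_adj [simp]: "ent (adj M) i j = cnj (ent M j i)" by transfer simp

lemma adj_adj [simp]: "adj (adj M) = M" by (rule fmat_eqI) simp
lemma adj_0 [simp]: "adj 0 = 0" by (rule fmat_eqI) simp
lemma adj_add [simp]: "adj (M + N) = adj M + adj N" by (rule fmat_eqI) simp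
lemma adj_diff [simp]: "adj (M - N) = adj M - adj N" by (rule fmat_eqI) simp
lemma adj_scC [simp]: "adj (c *\<^sub>C M) = cnj c *\<^sub>C adj M" by (rule fmat_eqI) simp
lemma adj_sum [simp]: "adj (\<Sum>x\<in>F. f x) = (\<Sum>x\<in>F. adj (f x))" by (rule fmat_eqI) simp

lemma dimle_adj [simp]: "dimle n (adj M) = dimle n M" by (auto simp: dimle_def)

lemma adj_mult [simp]: "adj (M * N) = adj N * adj M"
proof (rule fmat_eqI)
  fix i j
  obtain n where n: "dimle n M" "dimle n N" using dimle_ex2 by blast
  then show "ent (adj (M * N)) i j = ent (adj N * adj M) i j"
    by (simp add: ent_times_dimle mult.commute)
qed

lemma dimle_0 [simp]: "dimle n 0" by (simp add: dimle_def)
lemma dimle_add: "dimle n M \<Longrightarrow> dimle n N \<Longrightarrow> dimle n (M + N)"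
  by (auto simp: dimle_def) (metis add.right_neutral)+
lemma dimle_scC: "dimle n M \<Longrightarrow> dimle n (c *\<^sub>C M)" by (auto simp: dimle_def)
lemma dimle_sum: "(\<And>x. x \<in> F \<Longrightarrow> dimle n (f x)) \<Longrightarrow> dimle n (\<Sum>x\<in>F. f x)"
  by (induction F rule: infinite_finite_induct) (auto intro: dimle_add)

lift_definition mk :: "nat \<Rightarrow> (nat \<Rightarrow> nat \<Rightarrow> complex) \<Rightarrow> fmat" is
  "\<lambda>n f i j. if i < n \<and> j < n then f i j else 0"
  by (metis (mono_tags, lifting))

lemma ent_mk [simp]: "ent (mk n f) i j = (if i < n \<and> j < n then f i j else 0)" by transfer simp

lemma dimle_mk [simp]: "dimle n (mk n f)" by (auto simp: dimle_def)

definition idm :: "nat \<Rightarrow> fmat" where "idm n = mk n (\<lambda>i j. if i = j then 1 else 0)"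

lemma ent_idm: "ent (idm n) i j = (if i = j \<and> i < n then 1 else 0)" by (simp add: idm_def)

lemma dimle_idm [simp]: "dimle n (idm n)" by (simp add: idm_def)

lemma adj_idm [simp]: "adj (idm n) = idm n" by (rule fmat_eqI) (auto simp: ent_idm)

lemma ent_idm_times: "ent (idm n * M) i j = (if i < n then ent M i j else 0)"
proof -
  have "ent (idm n * M) i j = (\<Sum>k<n. ent (idm n) i k * ent M k j)"
    by (simp add: ent_times_dimle)
  also have "\<dots> = (\<Sum>k<n. if k = i then (if i < n then ent M i j else 0) else 0)"
    by (rule sum.cong) (auto simp: ent_idm)
  also have "\<dots> = (if i < n then ent M i j else 0)" by simp
  finally show ?thesis .
qed

lemma ent_times_idm: "ent (M * idm n) i j = (if j < n then ent M i j else 0)"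
proof -
  have "ent (M * idm n) i j = cnj (ent (idm n * adj M) j i)"
    by (metis adj_adj adj_idm adj_mult ent_adj)
  then show ?thesis by (simp add: ent_idm_times)
qed

lemma idm_times: "dimle n M \<Longrightarrow> idm n * M = M"
  by (rule fmat_eqI) (auto simp: ent_idm_times dimle_def)

lemma times_idm: "dimle n M \<Longrightarrow> M * idm n = M"
  by (rule fmat_eqI) (auto simp: ent_times_idm dimle_def)

lemma idm_idm [simp]: "idm n * idm n = idm n" by (simp add: idm_times)

section \<open>Trace and Hilbert-Schmidt norm\<close>

definition Tr :: "fmat \<Rightarrow> complex" where "Tr M = (\<Sum>i | ent M i i \<noteq> 0. ent M i i)"

lemma Tr_dimle: "dimle n M \<Longrightarrow> Tr M = (\<Sum>i<n. ent M i i)"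
  unfolding Tr_def by (rule sum.mono_neutral_left) (auto simp: dimle_def)

lemma Tr_add [simp]: "Tr (M + N) = Tr M + Tr N"
proof -
  obtain n where n: "dimle n M" "dimle n N" using dimle_ex2 by blast
  then show ?thesis by (simp add: Tr_dimle[OF dimle_add[OF n]] Tr_dimle[of n] sum.distrib)
qed

lemma Tr_scC [simp]: "Tr (c *\<^sub>C M) = c * Tr M"
proof -
  obtain n where n: "dimle n M" using dimle_ex by blast
  then show ?thesis by (simp add: Tr_dimle[OF dimle_scC[OF n]] Tr_dimle[of n] sum_distrib_left)
qed

lemma Tr_0 [simp]: "Tr 0 = 0" by (simp add: Tr_def)
lemma Tr_uminus [simp]: "Tr (- M) = - Tr M" using Tr_add[of M "- M"] by (simp add: add_eq_0_iff)
lemma Tr_diff [simp]: "Tr (M - N) = Tr M - Tr N"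
  by (metis Tr_add Tr_uminus add_uminus_conv_diff)
lemma Tr_sum [simp]: "Tr (\<Sum>x\<in>F. f x) = (\<Sum>x\<in>F. Tr (f x))"
  by (induction F rule: infinite_finite_induct) auto

lemma Tr_adj [simp]: "Tr (adj M) = cnj (Tr M)"
  by (simp add: Tr_def)

lemma Tr_commute: "Tr (M * N) = Tr (N * M)"
proof -
  obtain n where n: "dimle n M" "dimle n N" using dimle_ex2 by blast
  have "Tr (M * N) = (\<Sum>i<n. \<Sum>k<n. ent M i k * ent N k i)"
    using n by (simp add: Tr_dimle[OF dimle_times] ent_times_dimle)
  also have "\<dots> = (\<Sum>k<n. \<Sum>i<n. ent N k i * ent M i k)"
    by (subst sum.swap) (simp add: mult.commute)
  also have "\<dots> = Tr (N * M)" using n by (simp add: Tr_dimle[OF dimle_times] ent_times_dimle)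
  finally show ?thesis .
qed

text \<open>This is the squared Hilbert-Schmidt norm. It stands in for a norm below: a matrix is
  shown to vanish by showing that \<open>Tr (adj M * M)\<close> does.\<close>

lemma Tr_adj_self:
  assumes "dimle n M"
  shows "Tr (adj M * M) = complex_of_real (\<Sum>i<n. \<Sum>k<n. (cmod (ent M k i))\<^sup>2)"
proof -
  have "Tr (adj M * M) = (\<Sum>i<n. \<Sum>k<n. cnj (ent M k i) * ent M k i)"
    using assms by (subst Tr_dimle[of n]) (auto simp: ent_times_dimle dimle_times)
  then show ?thesis by (simp add: complex_norm_square mult.commute del: of_real_power)
qed

lemma Tr_adj_self_nonneg: "0 \<le> Tr (adj M * M)"
proof -
  obtain n where n: "dimle n M" using dimle_ex by blast
  show ?thesis unfolding Tr_adj_self[OF n] less_eq_complex_def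
    by (auto intro!: sum_nonneg simp del: of_real_sum)
qed

lemma Tr_adj_self_eq_0: "Tr (adj M * M) = 0 \<longleftrightarrow> M = 0"
proof
  assume *: "Tr (adj M * M) = 0"
  obtain n where n: "dimle n M" using dimle_ex by blast
  have "(\<Sum>i<n. \<Sum>k<n. (cmod (ent M k i))\<^sup>2) = 0"
    using * unfolding Tr_adj_self[OF n] of_real_eq_0_iff .
  then have "\<forall>i<n. \<forall>k<n. ent M k i = 0"
    by (auto simp: sum_nonneg_eq_0_iff sum_nonneg)
  then show "M = 0" using n by (intro fmat_eqI) (metis dimle_def ent_zero)
qed simp

lemma adj_self_eq_0 [simp]: "adj M * M = 0 \<longleftrightarrow> M = 0"
  using Tr_adj_self_eq_0[of M] by auto

lemma Tr_adj_self_pos: "M \<noteq> 0 \<Longrightarrow> 0 < Tr (adj M * M)"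
  using Tr_adj_self_nonneg[of M] Tr_adj_self_eq_0[of M] by (metis order_le_less)

lemma complex_nonneg_real: "0 \<le> (z::complex) \<Longrightarrow> z = complex_of_real (Re z)"
  by (simp add: less_eq_complex_def complex_eq_iff)

section \<open>Positive semidefinite matrices\<close>

text \<open>The test element is an arbitrary matrix, not just a column: the trace adds up the
  quadratic form over its columns. Positivity can thus be tested against elements of an
  algebra.\<close>

definition psd :: "fmat \<Rightarrow> bool" where "psd M \<longleftrightarrow> (\<forall>v. 0 \<le> Tr (adj v * M * v))"

lemma psd_adj_self: "psd (adj M * M)"
  unfolding psd_def
proof
  fix v
  show "0 \<le> Tr (adj v * (adj M * M) * v)"
    using Tr_adj_self_nonneg[of "M * v"] by (simp add: mult.assoc)
qed

lemma psd_adj_eq: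
  assumes "psd M" shows "adj M = M"
proof -
  define K where "K = M - adj M"
  have q: "Tr (adj v * K * v) = 0" for v
  proof -
    have "cnj (Tr (adj v * M * v)) = Tr (adj v * adj M * v)"
      by (metis Tr_adj adj_adj adj_mult mult.assoc)
    moreover have "cnj (Tr (adj v * M * v)) = Tr (adj v * M * v)"
      using assms complex_nonneg_real unfolding psd_def by (metis complex_cnj_complex_of_real)
    ultimately show ?thesis by (simp add: K_def algebra_simps)
  qed
  \<comment> \<open>Polarisation with v + w and \<i> v + w: a sesquilinear form whose quadratic form
    vanishes is zero.\<close>
  have b: "Tr (adj w * K * v) = 0" for v w
  proof -
    have 1: "Tr (adj w * K * v) + Tr (adj v * K * w) = 0"
      using q[of "v + w"] q[of v] q[of w] by (simp add: algebra_simps)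
    have "\<i> * Tr (adj w * K * v) - \<i> * Tr (adj v * K * w) = 0"
      using q[of "\<i> *\<^sub>C v + w"] q[of "\<i> *\<^sub>C v"] q[of w] by (simp add: algebra_simps)
    then have "Tr (adj w * K * v) = Tr (adj v * K * w)" by simp
    with 1 show ?thesis by simp
  qed
  obtain n where n: "dimle n K" using dimle_ex by blast
  have "Tr (adj K * K) = 0"
    using b[of K "idm n"] n by (simp add: times_idm mult.assoc)
  then have "K = 0" by (simp only: Tr_adj_self_eq_0)
  then show ?thesis by (simp add: K_def)
qed

lemma psd_iff_sum:
  assumes "dimle n M"
  shows "psd M \<longleftrightarrow> (\<forall>v. 0 \<le> (\<Sum>i<n. \<Sum>j<n. cnj (v i) * ent M i j * v j))"
proof -
  have *: "Tr (adj w * M * w) = (\<Sum>k<m. \<Sum>i<n. \<Sum>j<n. cnj (ent w i k) * ent M i j * ent w j k)"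
    if "dimle m w" "n \<le> m" for m w
  proof -
    have M: "dimle m M" using assms that dimle_mono by blast
    have e: "ent (M * w) i k = (\<Sum>j<n. ent M i j * ent w j k)" for i k
      by (rule ent_times_dimle[OF assms])
    have "Tr (adj w * M * w) = (\<Sum>k<m. \<Sum>i<m. cnj (ent w i k) * ent (M * w) i k)"
      unfolding mult.assoc
      using that M by (subst Tr_dimle[of m]) (auto simp: ent_times_dimle[of m "adj w"] dimle_times)
    also have "\<dots> = (\<Sum>k<m. \<Sum>i<n. cnj (ent w i k) * ent (M * w) i k)"
      by (intro sum.cong refl sum.mono_neutral_right)
        (use \<open>n \<le> m\<close> in \<open>auto simp: e dimle_zero_row[OF assms]\<close>)
    finally show ?thesis by (simp add: e sum_distrib_left mult.assoc)
  qed
  show ?thesis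
  proof
    assume M: "psd M"
    show "\<forall>v. 0 \<le> (\<Sum>i<n. \<Sum>j<n. cnj (v i) * ent M i j * v j)"
    proof
      fix v
      \<comment> \<open>Size \<open>Suc n\<close> puts column 0, which carries v, among the summed
        columns even for n = 0.\<close>
      define w where "w = mk (Suc n) (\<lambda>i j. if j = 0 then v i else 0)"
      have "Tr (adj w * M * w)
          = (\<Sum>k<Suc n. \<Sum>i<n. \<Sum>j<n. cnj (ent w i k) * ent M i j * ent w j k)"
        by (rule *) (auto simp: w_def)
      also have "\<dots> = (\<Sum>k<Suc n. if k = 0 then (\<Sum>i<n. \<Sum>j<n. cnj (v i) * ent M i j * v j) else 0)"
        by (rule sum.cong) (auto simp: w_def)
      also have "\<dots> = (\<Sum>i<n. \<Sum>j<n. cnj (v i) * ent M i j * v j)"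
        by (subst sum.delta) auto
      finally show "0 \<le> (\<Sum>i<n. \<Sum>j<n. cnj (v i) * ent M i j * v j)"
        using M by (metis psd_def)
    qed
  next
    assume r: "\<forall>v. 0 \<le> (\<Sum>i<n. \<Sum>j<n. cnj (v i) * ent M i j * v j)"
    show "psd M" unfolding psd_def
    proof
      fix w
      obtain m where "dimle m w" using dimle_ex by blast
      then have "dimle (max m n) w" by (auto elim: dimle_mono)
      from *[OF this] show "0 \<le> Tr (adj w * M * w)" by (auto intro!: sum_nonneg r[rule_format])
    qed
  qed
qed

section \<open>Finite-dimensional star-algebras\<close>

text \<open>Gaussian elimination: if equation k has a pivot w, solving it for the coefficient of w
  leaves one equation and one unknown less. All dimension counts below come from this
  statement.\<close>

lemma linear_dependence:
  fixes g :: "'k \<Rightarrow> 'v \<Rightarrow> 'f::field"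
  assumes "finite K" "finite V" "card K < card V"
  shows "\<exists>c. (\<exists>v\<in>V. c v \<noteq> 0) \<and> (\<forall>k\<in>K. (\<Sum>v\<in>V. c v * g k v) = 0)"
  using assms
proof (induction K arbitrary: V g rule: finite_induct)
  case empty
  then have "V \<noteq> {}" by auto
  then show ?case by (intro exI[of _ "\<lambda>_. 1"]) auto
next
  case (insert k K)
  show ?case
  proof (cases "\<forall>v\<in>V. g k v = 0")
    case True
    obtain c where "\<exists>v\<in>V. c v \<noteq> 0" "\<forall>k\<in>K. (\<Sum>v\<in>V. c v * g k v) = 0"
      using insert.IH[OF insert.prems(1), of g] insert.prems(2) insert.hyps by auto
    then show ?thesis using True by (intro exI[of _ c]) simp
  next
    case False
    then obtain w where w: "w \<in> V" "g k w \<noteq> 0" by blast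
    define V' where "V' = V - {w}"
    have V': "finite V'" "card K < card V'" "V = insert w V'" "w \<notin> V'"
      using insert.prems insert.hyps w by (auto simp: V'_def)
    obtain c where c: "\<exists>v\<in>V'. c v \<noteq> 0"
      "\<forall>l\<in>K. (\<Sum>v\<in>V'. c v * (g l v - g l w * g k v / g k w)) = 0"
      using insert.IH[OF V'(1,2), of "\<lambda>l v. g l v - g l w * g k v / g k w"] by blast
    define a where "a = - (\<Sum>v\<in>V'. c v * g k v) / g k w"
    have s: "(\<Sum>v\<in>V. (c(w := a)) v * g l v) = a * g l w + (\<Sum>v\<in>V'. c v * g l v)" for l
    proof -
      have "(\<Sum>v\<in>V'. (c(w := a)) v * g l v) = (\<Sum>v\<in>V'. c v * g l v)"
        by (rule sum.cong) (use V'(4) in auto)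
      then show ?thesis using V' by simp
    qed
    have "(\<Sum>v\<in>V. (c(w := a)) v * g l v) = 0" if "l \<in> insert k K" for l
    proof (cases "l = k")
      case True
      then show ?thesis using w by (simp only: s) (simp add: a_def)
    next
      case False
      then have "0 = (\<Sum>v\<in>V'. c v * (g l v - g l w * g k v / g k w))" using that c(2) by simp
      also have "\<dots> = (\<Sum>v\<in>V'. c v * g l v) - (\<Sum>v\<in>V'. c v * g k v) * (g l w / g k w)"
        unfolding sum_distrib_right sum_subtractf[symmetric]
        by (rule sum.cong) (auto simp: field_simps)
      finally show ?thesis by (simp only: s) (simp add: a_def)
    qed
    moreover have "\<exists>v\<in>V. (c(w := a)) v \<noteq> 0" using c(1) V' by auto
    ultimately show ?thesis by blast
  qed
qed

lemma fmat_dependence: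
  assumes "finite V" "n * n < card V" "\<And>v. v \<in> V \<Longrightarrow> dimle n (f v)"
  shows "\<exists>c. (\<exists>v\<in>V. c v \<noteq> 0) \<and> (\<Sum>v\<in>V. c v *\<^sub>C f v) = 0"
proof -
  obtain c where c: "\<exists>v\<in>V. c v \<noteq> 0"
    "\<forall>k\<in>{..<n} \<times> {..<n}. (\<Sum>v\<in>V. c v * ent (f v) (fst k) (snd k)) = 0"
    using linear_dependence[of "{..<n} \<times> {..<n}" V "\<lambda>k v. ent (f v) (fst k) (snd k)"] assms
    by (auto simp: card_cartesian_product)
  have "(\<Sum>v\<in>V. c v *\<^sub>C f v) = 0"
  proof (rule fmat_eqI)
    fix i j
    show "ent (\<Sum>v\<in>V. c v *\<^sub>C f v) i j = ent 0 i j"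
    proof (cases "i < n \<and> j < n")
      case True
      then show ?thesis using c(2) by simp
    next
      case False
      then have "ent (f v) i j = 0" if "v \<in> V" for v
        using assms(3)[OF that] unfolding dimle_def by blast
      then show ?thesis by simp
    qed
  qed
  with c(1) show ?thesis by blast
qed

text \<open>Multiplying a dependence from the left by \<open>adj (f w)\<close> isolates its
  coefficient at w, so such a family is independent. The bound is what makes the maximality
  arguments below possible.\<close>

lemma orthogonal_family_card:
  assumes "finite V" "\<And>v. v \<in> V \<Longrightarrow> dimle n (f v) \<and> f v \<noteq> 0"
    and orth: "\<And>v w. v \<in> V \<Longrightarrow> w \<in> V \<Longrightarrow> v \<noteq> w \<Longrightarrow> adj (f v) * f w = 0"
  shows "card V \<le> n * n"
proof (rule ccontr)
  assume "\<not> card V \<le> n * n"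
  then obtain c w where w: "w \<in> V" "c w \<noteq> 0" and 0: "(\<Sum>v\<in>V. c v *\<^sub>C f v) = 0"
    using fmat_dependence[of V n f] assms by (metis not_le)
  have "0 = adj (f w) * (\<Sum>v\<in>V. c v *\<^sub>C f v)" using 0 by simp
  also have "\<dots> = (\<Sum>v\<in>V. c v *\<^sub>C (adj (f w) * f v))" by (simp add: sum_distrib_left)
  also have "\<dots> = (\<Sum>v\<in>V. if v = w then c w *\<^sub>C (adj (f w) * f w) else 0)"
    by (rule sum.cong) (use orth w in auto)
  also have "\<dots> = c w *\<^sub>C (adj (f w) * f w)" using w assms(1) by simp
  finally have "adj (f w) * f w = 0" using w by simp
  then show False using assms(2)[OF w(1)] by simp
qed

text \<open>No unit is required: the corner to which this is applied has the projection z as its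
  unit, not \<open>idm n\<close>.\<close>

locale star_alg =
  fixes n :: nat and B :: "fmat set"
  assumes dim: "x \<in> B \<Longrightarrow> dimle n x"
    and zero: "0 \<in> B"
    and add: "x \<in> B \<Longrightarrow> y \<in> B \<Longrightarrow> x + y \<in> B"
    and scale: "x \<in> B \<Longrightarrow> c *\<^sub>C x \<in> B"
    and mult: "x \<in> B \<Longrightarrow> y \<in> B \<Longrightarrow> x * y \<in> B"
    and adj: "x \<in> B \<Longrightarrow> adj x \<in> B"
begin

lemma uminus: "x \<in> B \<Longrightarrow> - x \<in> B"
  using scale[of x "-1"] by simp

lemma diff: "x \<in> B \<Longrightarrow> y \<in> B \<Longrightarrow> x - y \<in> B"
  unfolding diff_conv_add_uminus by (intro add uminus)

lemma sum: "(\<And>i. i \<in> I \<Longrightarrow> f i \<in> B) \<Longrightarrow> sum f I \<in> B"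
  by (induction I rule: infinite_finite_induct) (auto intro: add zero)

end

text \<open>Horner evaluation of q at h, with e as the unit that multiplies the constant term. This
  is the polynomial calculus inside a corner with unit e.\<close>

definition ev :: "fmat \<Rightarrow> fmat \<Rightarrow> complex poly \<Rightarrow> fmat" where
  "ev e h q = fold_coeffs (\<lambda>a r. a *\<^sub>C e + h * r) q 0"

lemma ev_0 [simp]: "ev e h 0 = 0" by (simp add: ev_def)

lemma ev_pCons [simp]: "ev e h (pCons a q) = a *\<^sub>C e + h * ev e h q"
  by (cases "a = 0 \<and> q = 0") (auto simp: ev_def)

lemma ev_add: "ev e h (p + q) = ev e h p + ev e h q"
  by (induction p q rule: poly_induct2) (simp_all add: fmat.scale_left_distrib distrib_left)

lemma ev_smult: "ev e h (smult a q) = a *\<^sub>C ev e h q"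
  by (induction q) (simp_all add: fmat.scale_right_distrib)

lemma ev_sum: "ev e h (\<Sum>i\<in>I. f i) = (\<Sum>i\<in>I. ev e h (f i))"
  by (induction I rule: infinite_finite_induct) (auto simp: ev_add)

lemma ev_mem:
  assumes "star_alg n B" "e \<in> B" "h \<in> B"
  shows "ev e h q \<in> B"
proof -
  interpret star_alg n B by fact
  show ?thesis by (induction q) (auto intro: add scale mult assms zero)
qed

lemma ev_unit:
  assumes "e * e = e" "e * h = h"
  shows "e * ev e h q = ev e h q"
  using assms by (induction q) (simp_all add: distrib_left mult.assoc[symmetric])

lemma ev_mult:
  assumes "e * e = e" "e * h = h" "h * e = h"
  shows "ev e h (p * q) = ev e h p * ev e h q"
  using assms by (induction p)
    (simp_all add: ev_add ev_smult distrib_right distrib_left ev_unit mult.assoc)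

lemma ev_adj:
  assumes "adj e = e" "adj h = h" "h * e = e * h"
  shows "adj (ev e h q) = ev e h (map_poly cnj q)"
proof (induction q)
  case (pCons a q)
  have comm: "ev e h q * h = h * ev e h q" for q
    using assms(3) by (induction q) (simp_all add: distrib_left distrib_right mult.assoc)
  show ?case using pCons assms by (simp add: map_poly_pCons comm)
qed simp

text \<open>Expanding \<open>adj d * d\<close> for d = f - \<open>adj f * f\<close> makes all terms
  cancel, so f equals the hermitian matrix \<open>adj f * f\<close>.\<close>

lemma normal_idempotent_hermitian:
  assumes "f * f = f" "adj f * f = f * adj f"
  shows "adj f = f"
proof -
  define d where "d = f - adj f * f"
  have a: "adj f * adj f = adj f" using assms(1) by (metis adj_mult)
  have "adj f * f * adj f * f = adj f * f"
    by (metis a assms mult.assoc)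
  then have "adj d * d = 0"
    using assms a by (simp add: d_def algebra_simps) (metis a assms(1) mult.assoc diff_self)
  then have "f = adj f * f" by (simp only: adj_self_eq_0) (simp add: d_def)
  then show ?thesis by (metis adj_adj adj_mult)
qed

text \<open>Normality lets the square of the hermitian matrix \<open>adj g * g\<close> be regrouped
  so that it contains g * g. A hermitian matrix with square zero vanishes, and then so does
  g.\<close>

lemma normal_square_zero:
  assumes "g * g = 0" "adj g * g = g * adj g"
  shows "g = 0"
proof -
  have "adj (adj g * g) * (adj g * g) = adj g * (g * adj g) * g" by (simp add: mult.assoc)
  also have "\<dots> = adj g * adj g * (g * g)" by (simp add: assms(2)[symmetric] mult.assoc)
  finally show ?thesis using assms(1) by (metis adj_self_eq_0 mult_zero_right)
qed

section \<open>Minimal projections of commutative star-algebras\<close>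

context star_alg
begin

text \<open>A root of the minimal polynomial of \<open>h\<close> yields an eigenprojection of \<open>h\<close>, as commutativity
  makes \<open>h\<close> normal.\<close>

lemma split_projection:
  assumes comm: "\<And>x y. x \<in> B \<Longrightarrow> y \<in> B \<Longrightarrow> x * y = y * x"
    and e: "e \<in> B" "e * e = e" "e \<noteq> 0" and x: "x \<in> B" and ns: "\<And>c. x * e \<noteq> c *\<^sub>C e"
  shows "\<exists>f\<in>B. f * f = f \<and> adj f = f \<and> f * e = f \<and> f \<noteq> 0 \<and> f \<noteq> e"
proof -
  define h where "h = x * e"
  have h: "h \<in> B" "h * e = h" using e x mult by (auto simp: h_def mult.assoc)
  moreover from this have "e * h = h" using comm[OF e(1)] by simp
  ultimately have h: "h \<in> B" "e * h = h" "h * e = h" by blast+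
  have B: "ev e h q \<in> B" for q using ev_mem[OF star_alg_axioms e(1) h(1)] .
  \<comment> \<open>The powers of h with exponents from 0 to n * n are n * n + 1 matrices of size n,
    hence dependent.\<close>
  have "\<exists>q. q \<noteq> 0 \<and> ev e h q = 0"
  proof -
    obtain c k where k: "k \<in> {..n * n}" "c k \<noteq> 0"
      and s: "(\<Sum>i\<in>{..n * n}. c i *\<^sub>C ev e h (monom 1 i)) = 0"
      using fmat_dependence[of "{..n * n}" n "\<lambda>i. ev e h (monom 1 i)"] dim[OF B] by auto
    define q where "q = (\<Sum>i\<in>{..n * n}. smult (c i) (monom 1 i))"
    have "coeff q k = (\<Sum>i\<in>{..n * n}. if i = k then c i else 0)"
      unfolding q_def coeff_sum by (rule sum.cong) auto
    also have "\<dots> = c k" using k(1) by simp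
    finally have "q \<noteq> 0" using k by auto
    moreover have "ev e h q = 0" using s by (simp add: q_def ev_sum ev_smult[symmetric])
    ultimately show ?thesis by blast
  qed
  then obtain q where q: "q \<noteq> 0" "ev e h q = 0"
    and qmin: "\<And>p. p \<noteq> 0 \<Longrightarrow> ev e h p = 0 \<Longrightarrow> degree q \<le> degree p"
    using ex_has_least_nat[of "\<lambda>q. q \<noteq> 0 \<and> ev e h q = 0" _ degree] by blast
  have "degree q \<noteq> 0"
  proof
    assume "degree q = 0"
    then obtain a where "q = [:a:]" using degree_eq_zeroE by blast
    then show False using q e by auto
  qed
  then obtain l where "poly q l = 0"
    using fundamental_theorem_of_algebra[of q] by (auto simp: constant_degree)
  then obtain r where r: "q = [:- l, 1:] * r" using poly_eq_0_iff_dvd by (metis dvdE)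
  then have r0: "r \<noteq> 0" using q by auto
  \<comment> \<open>As q = (X - l) r has the least degree among the annihilating polynomials, g =
    r(h) is nonzero, while (h - l) g = 0.\<close>
  define g where "g = ev e h r"
  have "degree q = Suc (degree r)" using r0 unfolding r by (subst degree_mult_eq) auto
  then have g0: "g \<noteq> 0" using qmin[OF r0] by (auto simp: g_def)
  have gB: "g \<in> B" by (simp add: g_def B)
  have eg: "e * g = g" unfolding g_def by (rule ev_unit) (use e h in auto)
  have "0 = h * g - l *\<^sub>C g"
    using q(2) unfolding r ev_mult[OF e(2) h(2,3)] g_def[symmetric]
    by (simp add: distrib_right left_diff_distrib h eg)
  then have hg: "h * g = l *\<^sub>C g" by simp
  \<comment> \<open>A polynomial p in h acts on g as the scalar p(l). For p = r this reads g * g =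
    r(l) g, so g is idempotent up to a factor.\<close>
  have evg: "ev e h p * g = poly p l *\<^sub>C g" for p
  proof (induction p)
    case (pCons a p)
    have "ev e h p * (h * g) = h * (ev e h p * g)"
      using comm[OF B h(1)] by (metis mult.assoc)
    then show ?case using pCons
      by (simp add: distrib_right eg fmat.scale_left_distrib mult.assoc hg mult.commute)
  qed simp
  define m where "m = poly r l"
  have gg: "g * g = m *\<^sub>C g" using evg[of r] by (simp add: g_def m_def)
  \<comment> \<open>Otherwise g would be a nonzero normal element with square zero.\<close>
  have m0: "m \<noteq> 0"
    using normal_square_zero[of g] g0 gg comm[OF adj[OF gB] gB] by auto
  define f where "f = (1 / m) *\<^sub>C g"
  have fB: "f \<in> B" by (simp add: f_def scale gB)
  have ff: "f * f = f" using gg m0 by (simp add: f_def)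
  have "adj f = f" by (rule normal_idempotent_hermitian[OF ff comm[OF adj[OF fB] fB]])
  moreover have "f * e = f" using comm[OF fB e(1)] eg by (simp add: f_def)
  moreover have "f \<noteq> 0" using g0 m0 by (simp add: f_def)
  moreover have "f \<noteq> e"
  proof
    assume "f = e"
    then have "h * e = l *\<^sub>C e" using hg by (auto simp: f_def mult.commute)
    then show False using ns[of l] h by (simp add: h_def[symmetric])
  qed
  ultimately show ?thesis using fB ff by blast
qed

text \<open>Take a decomposition of z into orthogonal projections with as many summands as possible.
  If some x * e were not a multiple of e, \<open>split_projection\<close> would give a projection f
  strictly between 0 and e, and replacing e by f and e - f would lengthen the decomposition.\<close>

theorem commutative_projections:
  assumes commutes: "\<forall>x\<in>B. \<forall>y\<in>B. x * y = y * x"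
    and unit: "z \<in> B" "\<forall>x\<in>B. z * x = x"
  shows "\<exists>F. finite F \<and> F \<subseteq> B \<and> (\<forall>e\<in>F. e \<noteq> 0 \<and> adj e = e \<and> e * e = e) \<and>
    (\<forall>e\<in>F. \<forall>f\<in>F. e \<noteq> f \<longrightarrow> e * f = 0) \<and> \<Sum>F = z \<and>
    (\<forall>e\<in>F. \<forall>x\<in>B. \<exists>c. x * e = c *\<^sub>C e)"
proof -
  note comm = commutes[rule_format] and z = unit(1) unit(2)[rule_format]
  define Q where "Q F \<longleftrightarrow> finite F \<and> F \<subseteq> B \<and> (\<forall>e\<in>F. e \<noteq> 0 \<and> adj e = e \<and> e * e = e)
    \<and> (\<forall>e\<in>F. \<forall>f\<in>F. e \<noteq> f \<longrightarrow> e * f = 0) \<and> \<Sum>F = z" for F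
  have za: "adj z = z"
  proof -
    have "z * adj z = adj z" by (rule z(2)[OF adj[OF z(1)]])
    then show ?thesis by (metis adj_adj adj_mult)
  qed
  \<comment> \<open>Members have to be nonzero, so for z = 0 the search starts from the empty
    family.\<close>
  have Q0: "Q (if z = 0 then {} else {z})" using z za by (auto simp: Q_def)
  have Qb: "card F < Suc (n * n)" if "Q F" for F
    using orthogonal_family_card[of F n "\<lambda>x. x"] that dim by (auto simp: Q_def less_Suc_eq_le subset_iff)
  obtain F where F: "Q F" and Fmax: "\<And>G. Q G \<Longrightarrow> card G \<le> card F"
    using ex_has_greatest_nat[of Q _ card, OF Q0] Qb by blast
  have Fd: "finite F" "F \<subseteq> B" "\<And>e. e \<in> F \<Longrightarrow> e \<noteq> 0 \<and> adj e = e \<and> e * e = e"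
    "\<And>e f. e \<in> F \<Longrightarrow> f \<in> F \<Longrightarrow> e \<noteq> f \<Longrightarrow> e * f = 0" "\<Sum>F = z"
    using F by (auto simp: Q_def)
  have "\<exists>c. x * e = c *\<^sub>C e" if eF: "e \<in> F" and x: "x \<in> B" for e x
  proof (rule ccontr)
    assume "\<nexists>c. x * e = c *\<^sub>C e"
    then obtain f where f: "f \<in> B" "f * f = f" "adj f = f" "f * e = f" "f \<noteq> 0" "f \<noteq> e"
      using split_projection[OF comm, of e x] Fd eF x by blast
    have eB: "e \<in> B" and ee: "e * e = e" and ae: "adj e = e" using Fd eF by auto
    have ef: "e * f = f" using comm[OF eB f(1)] f by simp
    have o: "f * g = 0 \<and> g * f = 0 \<and> (e - f) * g = 0 \<and> g * (e - f) = 0"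
      if "g \<in> F - {e}" for g
    proof -
      have "f * g = 0" using Fd(4)[of e g] that eF f(4) by (metis DiffD1 DiffD2 insertI1 mult.assoc mult_zero_right)
      moreover have "g * f = 0" using Fd(4)[of g e] that eF ef by (metis DiffD1 DiffD2 insertI1 mult.assoc mult_zero_left)
      ultimately show ?thesis using Fd(4)[of e g] Fd(4)[of g e] that eF by (auto simp: algebra_simps)
    qed
    define G where "G = insert f (insert (e - f) (F - {e}))"
    have n1: "f \<notin> F - {e}" using o[of f] f by auto
    have n2: "e - f \<notin> F - {e}"
    proof
      assume "e - f \<in> F - {e}"
      then have "(e - f) * (e - f) = 0" using o by blast
      then show False using f ef ee by (simp add: algebra_simps)
    qed
    have n3: "f \<noteq> e - f"
    proof
      assume "f = e - f"
      then have "f * f = f * (e - f)" by simp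
      then show False using f by (simp add: algebra_simps)
    qed
    have "card G = Suc (card F)"
      unfolding G_def using n1 n2 n3 Fd(1) eF card_Suc_Diff1[of F e] by (simp del: card_Diff_insert)
    moreover have "Q G" unfolding Q_def
    proof (intro conjI)
      show "finite G" by (simp add: G_def Fd)
      show "G \<subseteq> B" using Fd f eB by (auto simp: G_def intro: diff)
      show "\<forall>e\<in>G. e \<noteq> 0 \<and> adj e = e \<and> e * e = e"
        using Fd(3) f ee ae ef by (auto simp: G_def algebra_simps)
      have "f * (e - f) = 0" "(e - f) * f = 0" using f ef by (auto simp: algebra_simps)
      then show "\<forall>e\<in>G. \<forall>f\<in>G. e \<noteq> f \<longrightarrow> e * f = 0"
        using o Fd(4) unfolding G_def by blast
      have "\<Sum>G = f + ((e - f) + \<Sum>(F - {e}))"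
        unfolding G_def using n1 n2 n3 Fd(1) by simp
      also have "\<dots> = z" using Fd(1,5) eF by (simp add: sum.remove[of F e])
      finally show "\<Sum>G = z" .
    qed
    ultimately show False using Fmax[of G] by simp
  qed
  with F show ?thesis unfolding Q_def by (intro exI[of _ F]) simp
qed

end

section \<open>Riesz representation and square roots\<close>

context star_alg
begin

text \<open>A maximal orthonormal set for the inner product \<open>Tr (adj x * y)\<close> is finite
  by dimension and spans the algebra, because a nonzero residual could be normalised and added. The
  representing element is the sum of its members x weighted by the conjugates of \<phi> x.\<close>

lemma Riesz:
  assumes "\<And>x y. x \<in> B \<Longrightarrow> y \<in> B \<Longrightarrow> \<phi> (x + y) = \<phi> x + \<phi> y"
    and "\<And>c x. x \<in> B \<Longrightarrow> \<phi> (c *\<^sub>C x) = c * \<phi> x"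
  obtains r where "r \<in> B" "\<And>x. x \<in> B \<Longrightarrow> \<phi> x = Tr (adj r * x)"
proof -
  define Q where "Q G \<longleftrightarrow> finite G \<and> G \<subseteq> B \<and>
    (\<forall>x\<in>G. \<forall>y\<in>G. Tr (adj x * y) = (if x = y then 1 else 0))" for G
  have Qb: "card G < Suc (n * n)" if "Q G" for G
  proof (rule ccontr)
    assume "\<not> card G < Suc (n * n)"
    then have "\<exists>c. (\<exists>v\<in>G. c v \<noteq> 0) \<and> (\<Sum>v\<in>G. c v *\<^sub>C v) = 0"
      using that dim by (intro fmat_dependence[of G n]) (auto simp: Q_def)
    then obtain c w where w: "w \<in> G" "c w \<noteq> 0" and 0: "(\<Sum>v\<in>G. c v *\<^sub>C v) = 0"
      by blast
    have "0 = Tr (adj w * (\<Sum>v\<in>G. c v *\<^sub>C v))" using 0 by simp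
    also have "\<dots> = (\<Sum>v\<in>G. c v * Tr (adj w * v))" by (simp add: sum_distrib_left)
    also have "\<dots> = (\<Sum>v\<in>G. if v = w then c w else 0)"
      by (rule sum.cong) (use that w in \<open>auto simp: Q_def\<close>)
    also have "\<dots> = c w" using w that by (simp add: Q_def)
    finally show False using w by simp
  qed
  have "Q {}" by (simp add: Q_def)
  then obtain G where G: "Q G" and Gmax: "\<And>H. Q H \<Longrightarrow> card H \<le> card G"
    using ex_has_greatest_nat[of Q _ card] Qb by blast
  have Gd: "finite G" "G \<subseteq> B" "\<And>x y. x \<in> G \<Longrightarrow> y \<in> G \<Longrightarrow> Tr (adj x * y) = (if x = y then 1 else 0)"
    using G by (auto simp: Q_def)
  have exp: "c = (\<Sum>x\<in>G. Tr (adj x * c) *\<^sub>C x)" if c: "c \<in> B" for c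
  proof (rule ccontr)
    define u where "u = c - (\<Sum>x\<in>G. Tr (adj x * c) *\<^sub>C x)"
    assume "c \<noteq> (\<Sum>x\<in>G. Tr (adj x * c) *\<^sub>C x)"
    then have u0: "u \<noteq> 0" by (simp add: u_def)
    have uB: "u \<in> B" unfolding u_def using c Gd by (intro diff sum scale) auto
    have o: "Tr (adj y * u) = 0" if "y \<in> G" for y
    proof -
      have "Tr (adj y * u)
          = Tr (adj y * c) - (\<Sum>x\<in>G. Tr (adj x * c) * Tr (adj y * x))"
        by (simp add: u_def right_diff_distrib sum_distrib_left)
      also have "(\<Sum>x\<in>G. Tr (adj x * c) * Tr (adj y * x))
          = (\<Sum>x\<in>G. if x = y then Tr (adj y * c) else 0)"
        by (rule sum.cong) (use Gd that in auto)
      finally show ?thesis using Gd that by simp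
    qed
    have o': "Tr (adj u * y) = 0" if "y \<in> G" for y
      using o[OF that] Tr_adj[of "adj y * u"] by simp
    define t where "t = Re (Tr (adj u * u))"
    have t: "Tr (adj u * u) = complex_of_real t" "t > 0"
      using Tr_adj_self_pos[OF u0] by (auto simp: t_def less_complex_def complex_eq_iff)
    define w where "w = complex_of_real (1 / sqrt t) *\<^sub>C u"
    have "1 / (complex_of_real (sqrt t) * complex_of_real (sqrt t)) * complex_of_real t = 1"
      using t(2) by (simp add: of_real_mult[symmetric] del: of_real_mult)
    then have w1: "Tr (adj w * w) = 1" using t(2) by (simp add: w_def t(1))
    have ow: "Tr (adj y * w) = 0 \<and> Tr (adj w * y) = 0" if "y \<in> G" for y
      using o[OF that] o'[OF that] by (simp add: w_def)
    have "w \<notin> G" using ow[of w] w1 by auto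
    moreover have "Q (insert w G)"
      unfolding Q_def
    proof (intro conjI ballI)
      fix x y assume "x \<in> insert w G" "y \<in> insert w G"
      then show "Tr (adj x * y) = (if x = y then 1 else 0)"
        using ow Gd(3) w1 \<open>w \<notin> G\<close> by (cases "x = w"; cases "y = w") auto
    qed (use Gd uB scale in \<open>auto simp: w_def\<close>)
    ultimately show False using Gmax[of "insert w G"] Gd by simp
  qed
  define r where "r = (\<Sum>x\<in>G. cnj (\<phi> x) *\<^sub>C x)"
  show thesis
  proof
    show "r \<in> B" unfolding r_def using Gd by (intro sum scale) auto
    have \<phi>0: "\<phi> 0 = 0" using assms(2)[OF zero, of 0] by simp
    have \<phi>sum: "\<phi> (\<Sum>i\<in>I. f i) = (\<Sum>i\<in>I. \<phi> (f i))" if "\<And>i. i \<in> I \<Longrightarrow> f i \<in> B" for I and f :: "fmat \<Rightarrow> fmat"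
      using that by (induction I rule: infinite_finite_induct) (auto simp: \<phi>0 assms(1) sum)
    fix x assume x: "x \<in> B"
    have "\<phi> x = \<phi> (\<Sum>y\<in>G. Tr (adj y * x) *\<^sub>C y)" using exp[OF x] by simp
    also have "\<dots> = (\<Sum>y\<in>G. Tr (adj y * x) * \<phi> y)"
      using Gd by (subst \<phi>sum) (auto intro!: scale sum.cong assms(2))
    also have "\<dots> = Tr (adj r * x)"
      by (simp add: r_def sum_distrib_right mult.commute)
    finally show "\<phi> x = Tr (adj r * x)" .
  qed
qed

text \<open>Positivity is tested only against elements of the algebra, which is all that is known
  about a density matrix found by Riesz. This suffices: the polynomials in M form a commutative
  star-algebra inside the given one, and the projections obtained from it are eigenprojections of M
  that may serve as test elements.\<close>

lemma positive_sqrt: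
  assumes M: "M \<in> B" "adj M = M" and I: "idm n \<in> B"
    and pos: "\<And>c. c \<in> B \<Longrightarrow> 0 \<le> Tr (adj c * M * c)"
  obtains R where "R \<in> B" "adj R = R" "R * R = M"
proof -
  have IM: "idm n * M = M" "M * idm n = M" using dim[OF M(1)] by (auto simp: idm_times times_idm)
  define B' where "B' = range (ev (idm n) M)"
  have evm: "ev (idm n) M p * ev (idm n) M q = ev (idm n) M (p * q)" for p q
    by (rule ev_mult[symmetric]) (auto simp: IM)
  have sub: "B' \<subseteq> B" using ev_mem[OF star_alg_axioms I M(1)] by (auto simp: B'_def)
  interpret B': star_alg n B'
  proof
    fix x y c assume x: "x \<in> B'"
    then show "dimle n x" using sub dim by blast
    obtain p where p: "x = ev (idm n) M p" using x by (auto simp: B'_def)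
    then show "c *\<^sub>C x \<in> B'" by (auto simp: B'_def ev_smult[symmetric])
    have "adj x = ev (idm n) M (map_poly cnj p)"
      unfolding p by (rule ev_adj) (auto simp: M IM)
    then show "adj x \<in> B'" by (simp add: B'_def)
    assume "y \<in> B'"
    then obtain q where q: "y = ev (idm n) M q" by (auto simp: B'_def)
    then show "x + y \<in> B'" using p by (simp add: B'_def ev_add[symmetric])
    show "x * y \<in> B'" using p q by (simp add: B'_def evm)
  next
    show "0 \<in> B'" using ev_0 unfolding B'_def by (metis rangeI)
  qed
  have comm: "\<forall>x\<in>B'. \<forall>y\<in>B'. x * y = y * x"
    by (auto simp: B'_def evm mult.commute)
  have "ev (idm n) M [:1:] = idm n" "ev (idm n) M [:0, 1:] = M" by (auto simp: IM)
  then have IB: "idm n \<in> B'" and MB: "M \<in> B'" unfolding B'_def by (metis rangeI)+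
  have zu: "\<forall>x\<in>B'. idm n * x = x"
    using B'.dim idm_times by blast
  from B'.commutative_projections[OF comm IB zu] obtain F where F': "finite F" "F \<subseteq> B'"
    "\<forall>e\<in>F. e \<noteq> 0 \<and> adj e = e \<and> e * e = e"
    "\<forall>e\<in>F. \<forall>f\<in>F. e \<noteq> f \<longrightarrow> e * f = 0" "\<Sum>F = idm n"
    "\<forall>e\<in>F. \<forall>x\<in>B'. \<exists>c. x * e = c *\<^sub>C e"
    by (elim exE conjE) (rule that)
  note F = F'(1,2) F'(3)[rule_format] F'(4)[rule_format] F'(5) F'(6)[rule_format]
  have "\<forall>e\<in>F. \<exists>c. M * e = c *\<^sub>C e" using F(6) MB by blast
  from bchoice[OF this] obtain c where c: "\<And>e. e \<in> F \<Longrightarrow> M * e = c e *\<^sub>C e" by blast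
  have Ms: "M = (\<Sum>e\<in>F. c e *\<^sub>C e)"
    using IM(2) F(5)[symmetric] by (simp add: sum_distrib_left c)
  \<comment> \<open>Testing against e gives 0 \<le> \<open>c e * Tr e\<close>, and
    \<open>Tr e\<close> is positive, so the eigenvalue \<open>c e\<close> is real and
    nonnegative.\<close>
  have c0: "complex_of_real (sqrt (Re (c e))) * complex_of_real (sqrt (Re (c e))) = c e" if e: "e \<in> F" for e
  proof -
    have "0 \<le> c e * Tr e"
      using pos[of e] e F(2,3) sub c by (simp add: mult.assoc subset_iff)
    moreover have "0 < Tr e" using Tr_adj_self_pos[of e] F(3)[OF e] by simp
    ultimately have "0 \<le> Re (c e) \<and> Im (c e) = 0"
      by (auto simp: less_eq_complex_def less_complex_def zero_le_mult_iff)
    then show ?thesis by (simp add: complex_eq_iff)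
  qed
  define R where "R = (\<Sum>e\<in>F. complex_of_real (sqrt (Re (c e))) *\<^sub>C e)"
  show thesis
  proof
    show "R \<in> B" unfolding R_def using F sub by (intro sum scale) auto
    show "adj R = R" unfolding R_def using F(3) by (simp cong: sum.cong)
    have "R * R = (\<Sum>e\<in>F. \<Sum>f\<in>F. (complex_of_real (sqrt (Re (c e))) * complex_of_real (sqrt (Re (c f)))) *\<^sub>C (e * f))"
      unfolding R_def by (simp add: sum_product mult.commute)
    also have "\<dots> = (\<Sum>e\<in>F. \<Sum>f\<in>F. if f = e then c e *\<^sub>C e else 0)"
      by (intro sum.cong refl) (use F c0 in auto)
    also have "\<dots> = M" using F(1) by (simp add: Ms)
    finally show "R * R = M" .
  qed
qed

end

lemma star_alg_full: "star_alg n {M. dimle n M}"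
  by standard (auto intro: dimle_add dimle_scC dimle_times)

lemma psd_sqrt:
  assumes "psd M" "dimle n M"
  obtains R where "dimle n R" "adj R = R" "R * R = M"
  using star_alg.positive_sqrt[OF star_alg_full, of M n] psd_adj_eq[OF assms(1)] assms
  by (auto simp: psd_def)

section \<open>Kronecker products\<close>

lemma sum_div_mod:
  fixes f :: "nat \<Rightarrow> nat \<Rightarrow> 'a::comm_monoid_add"
  shows "(\<Sum>k<n * m. f (k div m) (k mod m)) = (\<Sum>a<n. \<Sum>b<m. f a b)"
proof -
  have "(\<Sum>k<n * m. f (k div m) (k mod m)) = (\<Sum>(a, b)\<in>{..<n} \<times> {..<m}. f a b)"
  proof (rule sum.reindex_bij_witness[of _ "\<lambda>(a, b). a * m + b" "\<lambda>k. (k div m, k mod m)"])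
    fix p assume "p \<in> {..<n} \<times> {..<m}"
    then obtain a b where p: "p = (a, b)" "a < n" "b < m" by auto
    have "a * m + b < Suc a * m" using p by simp
    also have "\<dots> \<le> n * m" using p by (intro mult_right_mono) auto
    finally show "(case p of (a, b) \<Rightarrow> a * m + b) \<in> {..<n * m}" using p by simp
  next
    fix k assume "k \<in> {..<n * m}"
    then show "(k div m, k mod m) \<in> {..<n} \<times> {..<m}"
      by (auto simp: less_mult_imp_div_less) (metis gr0I mod_less_divisor mult_0_right not_less0)
  qed auto
  then show ?thesis by (simp add: sum.cartesian_product)
qed

text \<open>The sizes are arguments because an \<open>fmat\<close> does not record its own; m is the
  stride of the index pairs.\<close>

definition kr :: "nat \<Rightarrow> nat \<Rightarrow> fmat \<Rightarrow> fmat \<Rightarrow> fmat" where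
  "kr n m M N = mk (n * m) (\<lambda>i j. ent M (i div m) (j div m) * ent N (i mod m) (j mod m))"

lemma ent_kr: "ent (kr n m M N) i j =
    (if i < n * m \<and> j < n * m then ent M (i div m) (j div m) * ent N (i mod m) (j mod m) else 0)"
  by (simp add: kr_def)

lemma dimle_kr [simp]: "dimle (n * m) (kr n m M N)" by (simp add: kr_def)

lemma kr_adj: "adj (kr n m M N) = kr n m (adj M) (adj N)"
  by (rule fmat_eqI) (auto simp: ent_kr)

lemma kr_mult:
  assumes "dimle n M" "dimle m N"
  shows "kr n m M N * kr n m M' N' = kr n m (M * M') (N * N')"
proof (rule fmat_eqI)
  fix i j
  let ?f = "\<lambda>a b. (ent M (i div m) a * ent M' a (j div m)) * (ent N (i mod m) b * ent N' b (j mod m))"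
  have "ent (kr n m M N * kr n m M' N') i j = (\<Sum>k<n * m. ent (kr n m M N) i k * ent (kr n m M' N') k j)"
    by (simp add: ent_times_dimle)
  also have "\<dots> = (\<Sum>k<n * m. if i < n * m \<and> j < n * m then ?f (k div m) (k mod m) else 0)"
    by (rule sum.cong) (auto simp: ent_kr)
  also have "\<dots> = (if i < n * m \<and> j < n * m then (\<Sum>k<n * m. ?f (k div m) (k mod m)) else 0)"
    by (cases "i < n * m \<and> j < n * m") auto
  also have "(\<Sum>k<n * m. ?f (k div m) (k mod m)) = (\<Sum>a<n. \<Sum>b<m. ?f a b)"
    by (rule sum_div_mod)
  also have "\<dots> = ent (M * M') (i div m) (j div m) * ent (N * N') (i mod m) (j mod m)"
    by (simp only: sum_product ent_times_dimle[OF assms(1)] ent_times_dimle[OF assms(2)])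
  also have "(if i < n * m \<and> j < n * m then \<dots> else 0) = ent (kr n m (M * M') (N * N')) i j"
    by (simp add: ent_kr)
  finally show "ent (kr n m M N * kr n m M' N') i j = ent (kr n m (M * M') (N * N')) i j" .
qed

lemma kr_idm: "kr n m (idm n) (idm m) = idm (n * m)"
proof (rule fmat_eqI)
  fix i j
  have "i < n * m \<Longrightarrow> i div m < n \<and> i mod m < m"
    by (auto simp: less_mult_imp_div_less) (metis gr0I mod_less_divisor mult_0_right not_less0)
  moreover have "i div m = j div m \<and> i mod m = j mod m \<longleftrightarrow> i = j" by (metis div_mult_mod_eq)
  ultimately show "ent (kr n m (idm n) (idm m)) i j = ent (idm (n * m)) i j"
    by (auto simp: ent_kr ent_idm)
qed

lemma kr_sum_left: "kr n m (\<Sum>x\<in>I. f x) N = (\<Sum>x\<in>I. kr n m (f x) N)"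
proof (rule fmat_eqI)
  fix i j
  show "ent (kr n m (\<Sum>x\<in>I. f x) N) i j = ent (\<Sum>x\<in>I. kr n m (f x) N) i j"
    by (cases "i < n * m \<and> j < n * m") (auto simp: ent_kr sum_distrib_right)
qed

lemma kr_sum_right: "kr n m M (\<Sum>x\<in>I. f x) = (\<Sum>x\<in>I. kr n m M (f x))"
proof (rule fmat_eqI)
  fix i j
  show "ent (kr n m M (\<Sum>x\<in>I. f x)) i j = ent (\<Sum>x\<in>I. kr n m M (f x)) i j"
    by (cases "i < n * m \<and> j < n * m") (auto simp: ent_kr sum_distrib_left)
qed

text \<open>The product of hermitian square roots of the two factors is a square root of the
  whole.\<close>

lemma psd_kr:
  assumes "psd M" "dimle n M" "psd N" "dimle m N"
  shows "psd (kr n m M N)"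
proof -
  obtain R where R: "dimle n R" "adj R = R" "R * R = M" using psd_sqrt assms(1,2) by blast
  obtain Q where Q: "dimle m Q" "adj Q = Q" "Q * Q = N" using psd_sqrt assms(3,4) by blast
  have "kr n m M N = adj (kr n m R Q) * kr n m R Q" using R Q by (simp add: kr_adj kr_mult)
  then show ?thesis by (metis psd_adj_self)
qed

section \<open>Commuting operators on a finite-dimensional space\<close>

text \<open>The linear map taking x \<otimes> y to the product x y, as a contraction of the two
  inner indices. Given by a formula on all matrices, it needs no check of well-definedness on a span
  of Kronecker products.\<close>

definition mulmap :: "nat \<Rightarrow> fmat \<Rightarrow> fmat" where
  "mulmap d C = mk d (\<lambda>i l. \<Sum>k<d. ent C (i * d + k) (k * d + l))"

lemma mulmap_add: "mulmap d (C + D) = mulmap d C + mulmap d D"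
  by (rule fmat_eqI) (simp add: mulmap_def sum.distrib)

lemma mulmap_scC: "mulmap d (c *\<^sub>C C) = c *\<^sub>C mulmap d C"
  by (rule fmat_eqI) (simp add: mulmap_def sum_distrib_left)

lemma mulmap_0 [simp]: "mulmap d 0 = 0"
  by (rule fmat_eqI) (simp add: mulmap_def)

lemma mulmap_kr:
  assumes "dimle d x" "dimle d y"
  shows "mulmap d (kr d d x y) = x * y"
proof (rule fmat_eqI)
  fix i l
  have lt: "i * d + k < d * d" if "i < d" "k < d" for i k
  proof -
    have "i * d + k < Suc i * d" using that by simp
    also have "\<dots> \<le> d * d" using that by (intro mult_right_mono) auto
    finally show ?thesis .
  qed
  show "ent (mulmap d (kr d d x y)) i l = ent (x * y) i l"
  proof (cases "i < d \<and> l < d")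
    case True
    then have "ent (kr d d x y) (i * d + k) (k * d + l) = ent x i k * ent y k l" if "k < d" for k
      using that lt by (simp add: ent_kr)
    then show ?thesis using True assms by (simp add: mulmap_def ent_times_dimle)
  next
    case False
    then show ?thesis using dimle_times[OF assms] unfolding dimle_def mulmap_def by auto
  qed
qed

text \<open>The state \<open>x \<otimes> y \<mapsto> \<psi>\<^sup>* x y \<psi>\<close> on the algebra spanned by the \<open>x \<otimes> y\<close> has, by Riesz, a
  density matrix in that algebra, and positivity makes it a square.\<close>

theorem commuting_to_tensor:
  assumes X: "\<And>x. x \<in> X \<Longrightarrow> dimle d x \<and> adj x = x" and Y: "\<And>y. y \<in> Y \<Longrightarrow> dimle d y"
    and XY: "\<And>x y. x \<in> X \<Longrightarrow> y \<in> Y \<Longrightarrow> x * y = y * x"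
  obtains R where "dimle (d * d) R"
    "\<And>x y. x \<in> X \<Longrightarrow> y \<in> Y \<Longrightarrow> Tr (adj R * kr d d x y * R) = Tr (adj \<psi> * (x * y) * \<psi>)"
proof -
  \<comment> \<open>V is the commutant of X and U the commutant of V. Both are star-algebras with
    unit, V because the elements of X are hermitian. They commute with each other and contain Y and
    X respectively.\<close>
  define V where "V = {y. dimle d y \<and> (\<forall>x\<in>X. x * y = y * x)}"
  define U where "U = {x. dimle d x \<and> (\<forall>y\<in>V. x * y = y * x)}"
  have Vadj: "adj y \<in> V" if "y \<in> V" for y
    using that X unfolding V_def by (auto) (metis adj_mult)
  have Uadj: "adj x \<in> U" if "x \<in> U" for x
    using that Vadj unfolding U_def by (auto) (metis adj_adj adj_mult)
  have Vm: "y * y' \<in> V" if "y \<in> V" "y' \<in> V" for y y'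
    using that unfolding V_def by (auto intro: dimle_times) (metis mult.assoc)
  have Um: "x * x' \<in> U" if "x \<in> U" "x' \<in> U" for x x'
    using that unfolding U_def by (auto intro: dimle_times) (metis mult.assoc)
  have VI: "idm d \<in> V" using X by (auto simp: V_def idm_times times_idm)
  have UI: "idm d \<in> U" by (auto simp: U_def V_def idm_times times_idm)
  have XU: "X \<subseteq> U" using X by (auto simp: U_def V_def)
  have YV: "Y \<subseteq> V" using Y XY by (auto simp: V_def)
  have Ud: "dimle d x" if "x \<in> U" for x using that by (simp add: U_def)
  have Vd: "dimle d y" if "y \<in> V" for y using that by (simp add: V_def)
  have UV: "x * y = y * x" if "x \<in> U" "y \<in> V" for x y using that by (simp add: U_def)
  define G where "G = {kr d d x y | x y. x \<in> U \<and> y \<in> V}"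
  define C where "C = fmat.span G"
  \<comment> \<open>As U and V commute, x x' y y' = x y x' y', so \<open>mulmap\<close> is
    multiplicative on Kronecker products and, by bilinearity, on their span C.\<close>
  have Gm: "a * b \<in> C \<and> mulmap d (a * b) = mulmap d a * mulmap d b" if "a \<in> G" "b \<in> G" for a b
  proof -
    from that(1) obtain x y where 1: "a = kr d d x y" "x \<in> U" "y \<in> V" unfolding G_def by blast
    from that(2) obtain x' y' where 2: "b = kr d d x' y'" "x' \<in> U" "y' \<in> V" unfolding G_def by blast
    note * = 1(1) 2(1) 1(2,3) 2(2,3)
    then have m: "a * b = kr d d (x * x') (y * y')" by (simp add: kr_mult Ud Vd)
    then have "a * b \<in> G" using Um[OF *(3,5)] Vm[OF *(4,6)] unfolding G_def by blast
    moreover have "x * x' * (y * y') = x * y * (x' * y')"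
      using UV[of x' y] * by (metis mult.assoc)
    ultimately show ?thesis unfolding m using * by (simp add: C_def fmat.span_base mulmap_kr Ud Vd Um Vm)
  qed
  have Cm1: "a * b \<in> C \<and> mulmap d (a * b) = mulmap d a * mulmap d b" if "a \<in> G" "b \<in> C" for a b
    using that(2) unfolding C_def
  proof (induction rule: fmat.span_induct_alt)
    case base then show ?case by (simp add: fmat.span_zero)
  next
    case (step c x y)
    then show ?case using Gm[OF that(1) step(1)]
      by (simp add: distrib_left C_def fmat.span_add fmat.span_scale mulmap_add mulmap_scC)
  qed
  have Cm: "a * b \<in> C \<and> mulmap d (a * b) = mulmap d a * mulmap d b" if "a \<in> C" "b \<in> C" for a b
    using that(1) unfolding C_def
  proof (induction rule: fmat.span_induct_alt)
    case base then show ?case by (simp add: fmat.span_zero)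
  next
    case (step c x y)
    then show ?case using Cm1[OF step(1) that(2)]
      by (simp add: distrib_right C_def fmat.span_add fmat.span_scale mulmap_add mulmap_scC)
  qed
  have Ca: "adj a \<in> C \<and> mulmap d (adj a) = adj (mulmap d a)" if "a \<in> C" for a
    using that unfolding C_def
  proof (induction rule: fmat.span_induct_alt)
    case base then show ?case by (simp add: fmat.span_zero)
  next
    case (step c a b)
    then obtain x y where *: "a = kr d d x y" "x \<in> U" "y \<in> V" unfolding G_def by blast
    have "adj a \<in> G" using * Uadj Vadj unfolding G_def by (auto simp: kr_adj)
    moreover have "mulmap d (adj a) = adj (mulmap d a)"
      using * UV[OF Uadj Vadj] by (simp add: kr_adj mulmap_kr Ud Vd)
    ultimately show ?case using step
      by (simp add: fmat.span_add fmat.span_scale mulmap_add mulmap_scC fmat.span_base)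
  qed
  interpret C: star_alg "d * d" C
  proof
    fix x assume "x \<in> C"
    then show "dimle (d * d) x" unfolding C_def
      by (induction rule: fmat.span_induct_alt) (auto intro!: dimle_add dimle_scC simp: G_def)
  qed (use Cm Ca in \<open>auto simp: C_def fmat.span_add fmat.span_scale fmat.span_zero\<close>)
  define \<phi> where "\<phi> c = Tr (adj \<psi> * mulmap d c * \<psi>)" for c
  obtain r where r: "r \<in> C" "\<And>x. x \<in> C \<Longrightarrow> \<phi> x = Tr (adj r * x)"
    by (rule C.Riesz[of \<phi>]) (auto simp: \<phi>_def mulmap_add mulmap_scC distrib_left distrib_right)
  \<comment> \<open>The functional is hermitian, so r and \<open>adj r\<close> represent the same
    functional on C. Their difference lies in C and therefore vanishes.\<close>
  have "\<phi> (adj c) = cnj (\<phi> c)" if "c \<in> C" for c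
    using Tr_adj[of "adj \<psi> * mulmap d c * \<psi>"] Ca[OF that] by (simp add: \<phi>_def mult.assoc)
  then have h: "Tr (adj r * c) = Tr (r * c)" if "c \<in> C" for c
    using r(2)[OF that] r(2)[OF C.adj[OF that]] that Tr_adj[of "adj r * adj c"] Tr_commute[of r c]
    by (metis adj_adj adj_mult complex_cnj_cnj)
  define K where "K = adj r - r"
  have "adj K \<in> C" unfolding K_def using r C.adj C.diff by simp
  then have "Tr (K * adj K) = 0" using h by (simp add: K_def left_diff_distrib)
  then have "K = 0" using Tr_adj_self_eq_0[of K] Tr_commute by metis
  then have ra: "adj r = r" by (simp add: K_def)
  have "idm (d * d) \<in> C"
    unfolding C_def by (rule fmat.span_base) (use UI VI kr_idm[of d d] in \<open>auto simp: G_def intro: sym\<close>)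
  \<comment> \<open>This number is the state at \<open>c * adj c\<close>, which is the squared norm
    of \<open>adj (mulmap d c) * \<psi>\<close> because \<open>mulmap\<close> is a star-homomorphism
    on C.\<close>
  moreover have "0 \<le> Tr (adj c * r * c)" if c: "c \<in> C" for c
  proof -
    have "Tr (adj c * r * c) = Tr (adj r * (c * adj c))"
      using ra Tr_commute[of "adj c" "r * c"] by (simp add: mult.assoc)
    also have "\<dots> = \<phi> (c * adj c)" using r(2) C.mult C.adj c by simp
    also have "\<dots> = Tr (adj (adj (mulmap d c) * \<psi>) * (adj (mulmap d c) * \<psi>))"
      using Cm[OF c C.adj[OF c]] Ca[OF c] by (simp add: \<phi>_def mult.assoc)
    finally show ?thesis by (metis Tr_adj_self_nonneg)
  qed
  ultimately obtain R where R: "R \<in> C" "adj R = R" "R * R = r"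
    using C.positive_sqrt[OF r(1) ra] by blast
  show thesis
  proof
    show "dimle (d * d) R" using R C.dim by blast
    fix x y assume xy: "x \<in> X" "y \<in> Y"
    then have "kr d d x y \<in> G" using XU YV unfolding G_def by blast
    then have k: "kr d d x y \<in> C" by (simp add: C_def fmat.span_base)
    have "Tr (adj R * kr d d x y * R) = Tr (r * kr d d x y)"
      using R Tr_commute[of R "kr d d x y * R"] Tr_commute[of r "kr d d x y"]
      by (simp add: mult.assoc)
    also have "\<dots> = \<phi> (kr d d x y)" using r(2)[OF k] ra by simp
    also have "\<dots> = Tr (adj \<psi> * (x * y) * \<psi>)"
      using xy X Y by (simp add: \<phi>_def mulmap_kr)
    finally show "Tr (adj R * kr d d x y * R) = Tr (adj \<psi> * (x * y) * \<psi>)" .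
  qed
qed

section \<open>Models of correlations by finite matrices\<close>

definition povm :: "nat \<Rightarrow> 'a set \<Rightarrow> ('a \<Rightarrow> fmat) \<Rightarrow> bool" where
  "povm d A X \<longleftrightarrow> (\<forall>a\<in>A. dimle d (X a) \<and> psd (X a)) \<and> (\<Sum>a\<in>A. X a) = idm d"

text \<open>The two equations with \<open>idm d\<close> and \<open>idm 1\<close> make \<psi> a
  column of length d.\<close>

definition qc_model ::
  "'a set \<Rightarrow> 'b set \<Rightarrow> 's set \<Rightarrow> 't set \<Rightarrow> nat \<Rightarrow> ('s \<Rightarrow> 'a \<Rightarrow> fmat) \<Rightarrow> ('t \<Rightarrow> 'b \<Rightarrow> fmat) \<Rightarrow>
    fmat \<Rightarrow> ('a \<Rightarrow> 'b \<Rightarrow> 's \<Rightarrow> 't \<Rightarrow> real) \<Rightarrow> bool" where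
  "qc_model A B S T d X Y \<psi> P \<longleftrightarrow>
     (\<forall>s\<in>S. povm d A (X s)) \<and> (\<forall>t\<in>T. povm d B (Y t)) \<and>
     (\<forall>a\<in>A. \<forall>b\<in>B. \<forall>s\<in>S. \<forall>t\<in>T. X s a * Y t b = Y t b * X s a) \<and>
     idm d * \<psi> = \<psi> \<and> \<psi> * idm 1 = \<psi> \<and> Tr (adj \<psi> * \<psi>) = 1 \<and>
     (\<forall>a\<in>A. \<forall>b\<in>B. \<forall>s\<in>S. \<forall>t\<in>T.
        complex_of_real (P a b s t) = Tr (adj \<psi> * (X s a * Y t b) * \<psi>))"

text \<open>Size \<open>Suc d\<close> keeps column 0 in range for every d, including 0.\<close>

definition colm :: "nat \<Rightarrow> (nat \<Rightarrow> complex) \<Rightarrow> fmat" where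
  "colm d v = mk (Suc d) (\<lambda>i j. if j = 0 \<and> i < d then v i else 0)"

lemma ent_colm: "ent (colm d v) i j = (if j = 0 \<and> i < d then v i else 0)"
  by (auto simp: colm_def)

lemma idm_colm [simp]: "idm d * colm d v = colm d v"
  by (rule fmat_eqI) (auto simp: ent_idm_times ent_colm)

lemma colm_idm [simp]: "colm d v * idm (Suc 0) = colm d v"
  by (rule fmat_eqI) (auto simp: ent_times_idm ent_colm)

lemma colm_eqI: "idm d * \<psi> = \<psi> \<Longrightarrow> \<psi> * idm 1 = \<psi> \<Longrightarrow> \<psi> = colm d (\<lambda>i. ent \<psi> i 0)"
proof (rule fmat_eqI)
  fix i j assume "idm d * \<psi> = \<psi>" "\<psi> * idm 1 = \<psi>"
  then have "ent \<psi> i j = ent (idm d * (\<psi> * idm 1)) i j" by simp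
  then show "ent \<psi> i j = ent (colm d (\<lambda>i. ent \<psi> i 0)) i j"
    by (auto simp: ent_idm_times ent_times_idm ent_colm)
qed

lemma Tr_colm_colm: "Tr (adj (colm d u) * colm d v) = (\<Sum>i<d. cnj (u i) * v i)"
proof -
  have dm: "dimle (Suc d) (colm d w)" for w by (simp add: colm_def)
  have "Tr (adj (colm d u) * colm d v) = (\<Sum>k<Suc d. \<Sum>i<Suc d. cnj (ent (colm d u) i k) * ent (colm d v) i k)"
    by (subst Tr_dimle[of "Suc d"]) (auto simp: dimle_times dm ent_times_dimle[of "Suc d"])
  also have "\<dots> = (\<Sum>k<Suc d. if k = 0 then \<Sum>i<Suc d. cnj (ent (colm d u) i 0) * ent (colm d v) i 0 else 0)"
    by (rule sum.cong) (auto simp: ent_colm)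
  also have "\<dots> = (\<Sum>i<Suc d. cnj (ent (colm d u) i 0) * ent (colm d v) i 0)"
    by (subst sum.delta) auto
  finally show ?thesis by (simp add: ent_colm)
qed

definition mv :: "nat \<Rightarrow> fmat \<Rightarrow> (nat \<Rightarrow> complex) \<Rightarrow> nat \<Rightarrow> complex" where
  "mv d M v = (\<lambda>i. \<Sum>j<d. ent M i j * v j)"

lemma mult_colm: "dimle d M \<Longrightarrow> M * colm d v = colm d (mv d M v)"
  by (rule fmat_eqI) (auto simp: ent_times_dimle ent_colm mv_def dimle_zero_row intro!: sum.neutral)

lemma Tr_colm: "dimle d M \<Longrightarrow> Tr (adj (colm d u) * M * colm d v) = (\<Sum>i<d. cnj (u i) * mv d M v i)"
  by (simp add: mult.assoc mult_colm Tr_colm_colm)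

lemma mv_mult: "dimle d M \<Longrightarrow> mv d (M * N) v = mv d M (mv d N v)"
proof
  fix i assume "dimle d M"
  then have "mv d (M * N) v i = (\<Sum>j<d. \<Sum>k<d. ent M i k * ent N k j * v j)"
    by (simp add: mv_def ent_times_dimle sum_distrib_right)
  also have "\<dots> = mv d M (mv d N v) i"
    by (subst sum.swap) (simp add: mv_def sum_distrib_left mult.assoc)
  finally show "mv d (M * N) v i = mv d M (mv d N v) i" .
qed

lemma mv_sum: "mv d (\<Sum>a\<in>A. X a) v i = (\<Sum>a\<in>A. mv d (X a) v i)"
  by (simp add: mv_def sum_distrib_right) (rule sum.swap)

lemma mv_idm: "mv d (idm d) v = (\<lambda>i. if i < d then v i else 0)"
proof
  fix i
  have "mv d (idm d) v i = (\<Sum>j<d. if j = i then (if i < d then v i else 0) else 0)"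
    unfolding mv_def by (rule sum.cong) (auto simp: ent_idm)
  then show "mv d (idm d) v i = (if i < d then v i else 0)" by simp
qed

lemma mv_unit: "j < d \<Longrightarrow> mv d M (\<lambda>i. if i = j then 1 else 0) i = ent M i j"
proof -
  assume "j < d"
  have "mv d M (\<lambda>i. if i = j then 1 else 0) i = (\<Sum>k<d. if k = j then ent M i j else 0)"
    unfolding mv_def by (rule sum.cong) auto
  then show ?thesis using \<open>j < d\<close> by simp
qed

lemma mv_ext:
  assumes "dimle d M" "dimle d N" "\<And>v. (\<forall>i. d \<le> i \<longrightarrow> v i = 0) \<Longrightarrow> mv d M v = mv d N v"
  shows "M = N"
proof (rule fmat_eqI)
  fix i j
  show "ent M i j = ent N i j"
  proof (cases "j < d")
    case True
    then have "mv d M (\<lambda>i. if i = j then 1 else 0) i = mv d N (\<lambda>i. if i = j then 1 else 0) i"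
      by (subst assms(3)) auto
    then show ?thesis by (simp add: mv_unit[OF True])
  next
    case False
    then show ?thesis using assms by (simp add: dimle_zero_col)
  qed
qed

lemma psd_iff_mv:
  assumes "dimle d M"
  shows "psd M \<longleftrightarrow> (\<forall>v. (\<forall>i. d \<le> i \<longrightarrow> v i = 0) \<longrightarrow> 0 \<le> (\<Sum>i<d. cnj (v i) * mv d M v i))"
proof -
  have "(\<Sum>i<d. \<Sum>j<d. cnj (v i) * ent M i j * v j) = (\<Sum>i<d. cnj (v i) * mv d M v i)" for v
    by (simp add: mv_def sum_distrib_left mult.assoc)
  then have 1: "psd M \<longleftrightarrow> (\<forall>v. 0 \<le> (\<Sum>i<d. cnj (v i) * mv d M v i))"
    by (simp add: psd_iff_sum[OF assms])
  have 2: "(\<Sum>i<d. cnj (v i) * mv d M v i) =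
      (\<Sum>i<d. cnj (if i < d then v i else 0) * mv d M (\<lambda>i. if i < d then v i else 0) i)" for v
    by (simp add: mv_def)
  show ?thesis unfolding 1
  proof (intro iffI allI impI)
    fix v assume *: "\<forall>v. (\<forall>i. d \<le> i \<longrightarrow> v i = 0) \<longrightarrow> 0 \<le> (\<Sum>i<d. cnj (v i) * mv d M v i)"
    show "0 \<le> (\<Sum>i<d. cnj (v i) * mv d M v i)"
      unfolding 2[of v] by (rule *[rule_format]) simp
  qed simp
qed

subsection \<open>Square-summable sequences of finite dimension\<close>

lemma ell2_enat: "v \<in> ell2 (enat d) \<longleftrightarrow> (\<forall>i. d \<le> i \<longrightarrow> v i = 0)"
proof -
  have "summable (\<lambda>i. (cmod (v i))\<^sup>2)" if "\<forall>i. d \<le> i \<longrightarrow> v i = 0"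
    by (rule summable_finite[of "{..<d}"]) (use that in auto)
  then show ?thesis by (auto simp: ell2_def)
qed

lemma ell2_inner_enat: "u \<in> ell2 (enat d) \<Longrightarrow> ell2_inner u v = (\<Sum>i<d. cnj (u i) * v i)"
  unfolding ell2_inner_def by (rule suminf_finite) (auto simp: ell2_enat)

lemma ell2_norm_enat: "u \<in> ell2 (enat d) \<Longrightarrow> ell2_norm u = sqrt (\<Sum>i<d. (cmod (u i))\<^sup>2)"
  unfolding ell2_norm_def by (subst suminf_finite[of "{..<d}"]) (auto simp: ell2_enat)

lemma ell2_norm_1: "u \<in> ell2 (enat d) \<Longrightarrow> ell2_norm u = 1 \<longleftrightarrow> (\<Sum>i<d. cnj (u i) * u i) = 1"
proof -
  assume u: "u \<in> ell2 (enat d)"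
  have "(\<Sum>i<d. cnj (u i) * u i) = complex_of_real (\<Sum>i<d. (cmod (u i))\<^sup>2)"
    by (simp add: complex_norm_square mult.commute del: of_real_power)
  then show ?thesis by (simp add: ell2_norm_enat[OF u] del: of_real_sum)
qed

lemma bounded_opD:
  assumes "bounded_op d X"
  shows "v \<in> ell2 d \<Longrightarrow> X v \<in> ell2 d"
    and "u \<in> ell2 d \<Longrightarrow> v \<in> ell2 d \<Longrightarrow> X (\<lambda>i. u i + v i) = (\<lambda>i. X u i + X v i)"
    and "v \<in> ell2 d \<Longrightarrow> X (\<lambda>i. c * v i) = (\<lambda>i. c * X v i)"
  using assms by (simp_all add: bounded_op_def)

definition opmat :: "nat \<Rightarrow> ((nat \<Rightarrow> complex) \<Rightarrow> nat \<Rightarrow> complex) \<Rightarrow> fmat" where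
  "opmat d X = mk d (\<lambda>i j. X (\<lambda>k. if k = j then 1 else 0) i)"

text \<open>Expand v in unit vectors. Linearity of X is known on \<open>ell2 (enat d)\<close> only,
  so every partial sum of the expansion has to be shown to lie there.\<close>

lemma mv_opmat:
  assumes X: "bounded_op (enat d) X" and v: "v \<in> ell2 (enat d)"
  shows "mv d (opmat d X) v = X v"
proof
  fix i
  define u where "u j = (\<lambda>k. if k = j then 1 else (0::complex))" for j :: nat
  have u: "u j \<in> ell2 (enat d)" if "j < d" for j
    using that by (auto simp: ell2_enat u_def)
  have su: "(\<lambda>i. \<Sum>j<k. v j * u j i) \<in> ell2 (enat d)" if "k \<le> d" for k
    using that by (auto simp: ell2_enat u_def intro!: sum.neutral)
  have su1: "(\<lambda>i. c * u j i) \<in> ell2 (enat d)" if "j < d" for j c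
    using u[OF that] by (auto simp: ell2_enat)
  have X0: "X (\<lambda>i. 0) = (\<lambda>i. 0)"
    using bounded_opD(3)[OF X v, of 0] by simp
  have "X (\<lambda>i. \<Sum>j<k. v j * u j i) = (\<lambda>i. \<Sum>j<k. v j * X (u j) i)" if "k \<le> d" for k
    using that
  proof (induction k)
    case 0 then show ?case by (simp add: X0)
  next
    case (Suc k)
    then have k: "k \<le> d" "k < d" by auto
    have "X (\<lambda>i. (\<Sum>j<k. v j * u j i) + v k * u k i)
        = (\<lambda>i. X (\<lambda>i. \<Sum>j<k. v j * u j i) i + X (\<lambda>i. v k * u k i) i)"
      by (rule bounded_opD(2)[OF X su[OF k(1)] su1[OF k(2), of "v k"]])
    moreover have "X (\<lambda>i. v k * u k i) = (\<lambda>i. v k * X (u k) i)"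
      by (rule bounded_opD(3)[OF X u[OF k(2)]])
    ultimately show ?case using Suc k by simp
  qed
  from this[of d] have *: "X (\<lambda>i. \<Sum>j<d. v j * u j i) = (\<lambda>i. \<Sum>j<d. v j * X (u j) i)" by simp
  have "(\<lambda>i. \<Sum>j<d. v j * u j i) = v"
  proof
    fix i
    have "(\<Sum>j<d. v j * u j i) = (\<Sum>j<d. if j = i then v i else 0)"
      by (rule sum.cong) (auto simp: u_def)
    then show "(\<Sum>j<d. v j * u j i) = v i" using v by (auto simp: ell2_enat)
  qed
  with * have Xv: "X v i = (\<Sum>j<d. v j * X (u j) i)" by simp
  have Xu: "X (u j) i = 0" if "j < d" "d \<le> i" for j
    using bounded_opD(1)[OF X u[OF that(1)]] that by (simp add: ell2_enat)
  have "ent (opmat d X) i j = X (u j) i" if "j < d" for j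
    using Xu that by (auto simp: opmat_def u_def)
  then show "mv d (opmat d X) v i = X v i"
    unfolding mv_def Xv by (intro sum.cong) (auto simp: mult.commute)
qed

lemma bounded_op_mv:
  assumes M: "dimle d M"
  shows "bounded_op (enat d) (mv d M)"
  unfolding bounded_op_def
proof (intro conjI ballI allI)
  have mem: "mv d M v \<in> ell2 (enat d)" for v
    using dimle_zero_row[OF M] by (auto simp: ell2_enat mv_def)
  fix u v c assume v: "v \<in> ell2 (enat d)"
  show "mv d M v \<in> ell2 (enat d)" by (rule mem)
  show "mv d M (\<lambda>i. u i + v i) = (\<lambda>i. mv d M u i + mv d M v i)"
    by (auto simp: mv_def algebra_simps sum.distrib)
  show "mv d M (\<lambda>i. c * v i) = (\<lambda>i. c * mv d M v i)"
    by (auto simp: mv_def algebra_simps sum_distrib_left)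
next
  have mem: "mv d M v \<in> ell2 (enat d)" for v
    using dimle_zero_row[OF M] by (auto simp: ell2_enat mv_def)
  \<comment> \<open>The sum of all absolute values bounds each row sum, and with it each coordinate
    of the image; a factor \<open>sqrt (real d)\<close> then bounds the norm.\<close>
  define C where "C = (\<Sum>i<d. \<Sum>j<d. cmod (ent M i j))"
  have C0: "0 \<le> C" by (auto simp: C_def intro!: sum_nonneg)
  show "\<exists>K. \<forall>v\<in>ell2 (enat d). ell2_norm (mv d M v) \<le> K * ell2_norm v"
  proof (intro exI ballI)
    fix v assume v: "v \<in> ell2 (enat d)"
    have n: "ell2_norm v = sqrt (\<Sum>i<d. (cmod (v i))\<^sup>2)" by (rule ell2_norm_enat[OF v])
    have vj: "cmod (v j) \<le> ell2_norm v" if "j < d" for j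
      unfolding n by (rule real_le_rsqrt, rule member_le_sum) (use that in auto)
    have n0: "0 \<le> ell2_norm v" unfolding n by (auto intro: sum_nonneg)
    have b: "cmod (mv d M v i) \<le> C * ell2_norm v" if "i < d" for i
    proof -
      have "cmod (mv d M v i) \<le> (\<Sum>j<d. cmod (ent M i j) * ell2_norm v)"
        unfolding mv_def by (rule sum_norm_le) (auto simp: norm_mult intro!: mult_left_mono vj)
      also have "\<dots> = (\<Sum>j<d. cmod (ent M i j)) * ell2_norm v" by (simp add: sum_distrib_right)
      also have "\<dots> \<le> C * ell2_norm v"
        unfolding C_def using that n0
        by (intro mult_right_mono member_le_sum[of i "{..<d}" "\<lambda>i. \<Sum>j<d. cmod (ent M i j)"])
          (auto intro: sum_nonneg)
      finally show ?thesis .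
    qed
    have "ell2_norm (mv d M v) \<le> sqrt (\<Sum>i<d. (C * ell2_norm v)\<^sup>2)"
      unfolding ell2_norm_enat[OF mem] by (intro real_sqrt_le_mono sum_mono power_mono b) auto
    also have "\<dots> = sqrt (real d) * (C * ell2_norm v)"
      using C0 n0 by (simp add: real_sqrt_mult)
    finally show "ell2_norm (mv d M v) \<le> (sqrt (real d) * C) * ell2_norm v" by (simp add: mult.assoc)
  qed
qed

lemma povm_opmat:
  assumes "povm_op (enat d) A X"
  shows "povm d A (\<lambda>a. opmat d (X a))"
proof -
  have dm: "dimle d (opmat d (X a))" for a by (simp add: opmat_def)
  have b: "bounded_op (enat d) (X a)" if "a \<in> A" for a
    using assms that by (auto simp: povm_op_def psd_op_def)
  have "psd (opmat d (X a))" if a: "a \<in> A" for a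
    unfolding psd_iff_mv[OF dm]
  proof (intro allI impI)
    fix v :: "nat \<Rightarrow> complex" assume "\<forall>i. d \<le> i \<longrightarrow> v i = 0"
    then have v: "v \<in> ell2 (enat d)" by (simp add: ell2_enat)
    then have "ell2_inner v (X a v) \<in> \<real>\<^sub>\<ge>\<^sub>0" using assms a by (auto simp: povm_op_def psd_op_def)
    then show "0 \<le> (\<Sum>i<d. cnj (v i) * mv d (opmat d (X a)) v i)"
      using v by (simp add: mv_opmat[OF b[OF a]] ell2_inner_enat complex_nonneg_Reals_iff less_eq_complex_def)
  qed
  moreover have "(\<Sum>a\<in>A. opmat d (X a)) = idm d"
  proof (rule mv_ext[of d])
    show "dimle d (\<Sum>a\<in>A. opmat d (X a))" by (rule dimle_sum) (rule dm)
    fix v :: "nat \<Rightarrow> complex" assume vz: "\<forall>i. d \<le> i \<longrightarrow> v i = 0"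
    then have v: "v \<in> ell2 (enat d)" by (simp add: ell2_enat)
    have "(\<lambda>i. \<Sum>a\<in>A. X a v i) = v" using assms v by (auto simp: povm_op_def)
    then show "mv d (\<Sum>a\<in>A. opmat d (X a)) v = mv d (idm d) v"
      unfolding mv_idm by (intro ext) (use vz v in \<open>auto simp: mv_sum mv_opmat b fun_eq_iff not_less\<close>)
  qed simp
  ultimately show ?thesis by (simp add: povm_def dm)
qed

lemma povm_op_mv:
  assumes "povm d A X"
  shows "povm_op (enat d) A (\<lambda>a. mv d (X a))"
proof -
  have dm: "dimle d (X a)" if "a \<in> A" for a using assms that by (simp add: povm_def)
  have "psd_op (enat d) (mv d (X a))" if a: "a \<in> A" for a
  proof -
    have "psd (X a)" using assms a by (simp add: povm_def)
    then show ?thesis unfolding psd_op_def psd_iff_mv[OF dm[OF a]]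
      using bounded_op_mv[OF dm[OF a]]
      by (auto simp: ell2_enat ell2_inner_enat complex_nonneg_Reals_iff less_eq_complex_def)
  qed
  moreover have "(\<lambda>i. \<Sum>a\<in>A. mv d (X a) v i) = v" if "v \<in> ell2 (enat d)" for v
  proof -
    have "(\<lambda>i. \<Sum>a\<in>A. mv d (X a) v i) = mv d (idm d) v"
      using assms by (auto simp: povm_def mv_sum[symmetric])
    then show ?thesis using that by (auto simp: mv_idm ell2_enat fun_eq_iff)
  qed
  ultimately show ?thesis by (simp add: povm_op_def)
qed

text \<open>From here on operators on a finite-dimensional sequence space are replaced by matrices,
  in both directions.\<close>

theorem C_qc_dim_iff:
  "P \<in> C_qc_dim A B S T (enat d) \<longleftrightarrow>
    correlation A B S T P \<and> (\<exists>X Y \<psi>. qc_model A B S T d X Y \<psi> P)"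
proof
  assume "P \<in> C_qc_dim A B S T (enat d)"
  then have P: "correlation A B S T P" and "\<exists>\<psi> X Y. \<psi> \<in> ell2 (enat d) \<and> ell2_norm \<psi> = 1 \<and>
        (\<forall>s\<in>S. povm_op (enat d) A (X s)) \<and> (\<forall>t\<in>T. povm_op (enat d) B (Y t)) \<and>
        (\<forall>a\<in>A. \<forall>b\<in>B. \<forall>s\<in>S. \<forall>t\<in>T. \<forall>v\<in>ell2 (enat d). X s a (Y t b v) = Y t b (X s a v)) \<and>
        (\<forall>a\<in>A. \<forall>b\<in>B. \<forall>s\<in>S. \<forall>t\<in>T.
           complex_of_real (P a b s t) = ell2_inner \<psi> (X s a (Y t b \<psi>)))"
    by (simp_all add: C_qc_dim_def)
  then obtain \<psi> X Y where
    \<psi>: "\<psi> \<in> ell2 (enat d)" "ell2_norm \<psi> = 1" and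
    X: "\<forall>s\<in>S. povm_op (enat d) A (X s)" and Y: "\<forall>t\<in>T. povm_op (enat d) B (Y t)" and
    XY0: "\<forall>a\<in>A. \<forall>b\<in>B. \<forall>s\<in>S. \<forall>t\<in>T. \<forall>v\<in>ell2 (enat d). X s a (Y t b v) = Y t b (X s a v)" and
    val: "\<forall>a\<in>A. \<forall>b\<in>B. \<forall>s\<in>S. \<forall>t\<in>T.
      complex_of_real (P a b s t) = ell2_inner \<psi> (X s a (Y t b \<psi>))"
    by blast
  have XY: "X s a (Y t b v) = Y t b (X s a v)"
    if "a \<in> A" "b \<in> B" "s \<in> S" "t \<in> T" "v \<in> ell2 (enat d)" for a b s t v
    using XY0 that by blast
  have dm: "dimle d (opmat d Z)" for Z by (simp add: opmat_def)
  have bX: "bounded_op (enat d) (X s a)" if "a \<in> A" "s \<in> S" for a s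
    using X that by (auto simp: povm_op_def psd_op_def)
  have bY: "bounded_op (enat d) (Y t b)" if "b \<in> B" "t \<in> T" for b t
    using Y that by (auto simp: povm_op_def psd_op_def)
  have mem: "Z v \<in> ell2 (enat d)" if "bounded_op (enat d) Z" "v \<in> ell2 (enat d)" for Z v
    using that by (simp add: bounded_op_def)
  have XYmv: "mv d (opmat d (X s a) * opmat d (Y t b)) v = X s a (Y t b v)"
    "mv d (opmat d (Y t b) * opmat d (X s a)) v = Y t b (X s a v)"
    if "a \<in> A" "b \<in> B" "s \<in> S" "t \<in> T" "v \<in> ell2 (enat d)" for a b s t v
    using that by (simp_all add: mv_mult[OF dm] mv_opmat bX bY mem)
  have "qc_model A B S T d (\<lambda>s a. opmat d (X s a)) (\<lambda>t b. opmat d (Y t b)) (colm d \<psi>) P"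
    unfolding qc_model_def
  proof (intro conjI ballI)
    fix a b s t assume ab: "a \<in> A" "b \<in> B" "s \<in> S" "t \<in> T"
    show "opmat d (X s a) * opmat d (Y t b) = opmat d (Y t b) * opmat d (X s a)"
      by (rule mv_ext[of d]) (auto simp: dm dimle_times XYmv[OF ab] XY[OF ab] ell2_enat[symmetric])
    have "complex_of_real (P a b s t) = (\<Sum>i<d. cnj (\<psi> i) * X s a (Y t b \<psi>) i)"
      using val ab ell2_inner_enat[OF \<psi>(1)] by simp
    also have "\<dots> = Tr (adj (colm d \<psi>) * (opmat d (X s a) * opmat d (Y t b)) * colm d \<psi>)"
      by (simp add: Tr_colm dimle_times dm XYmv[OF ab \<psi>(1)])
    finally show "complex_of_real (P a b s t)
      = Tr (adj (colm d \<psi>) * (opmat d (X s a) * opmat d (Y t b)) * colm d \<psi>)" .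
  next
    show "Tr (adj (colm d \<psi>) * colm d \<psi>) = 1"
      using \<psi> by (simp add: Tr_colm_colm ell2_norm_1)
  qed (use X Y in \<open>auto intro!: povm_opmat\<close>)
  with P show "correlation A B S T P \<and> (\<exists>X Y \<psi>. qc_model A B S T d X Y \<psi> P)" by blast
next
  assume "correlation A B S T P \<and> (\<exists>X Y \<psi>. qc_model A B S T d X Y \<psi> P)"
  then obtain X Y \<psi> where P: "correlation A B S T P" and m: "qc_model A B S T d X Y \<psi> P" by blast
  define u where "u = (\<lambda>i. if i < d then ent \<psi> i 0 else 0)"
  have u: "u \<in> ell2 (enat d)" by (simp add: u_def ell2_enat)
  have "\<psi> = colm d (\<lambda>i. ent \<psi> i 0)" using m unfolding qc_model_def by (intro colm_eqI) auto
  also have "\<dots> = colm d u" by (rule fmat_eqI) (simp add: ent_colm u_def)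
  finally have \<psi>: "\<psi> = colm d u" .
  have dX: "dimle d (X s a)" if "a \<in> A" "s \<in> S" for a s
    using m that by (auto simp: qc_model_def povm_def)
  have dY: "dimle d (Y t b)" if "b \<in> B" "t \<in> T" for b t
    using m that by (auto simp: qc_model_def povm_def)
  show "P \<in> C_qc_dim A B S T (enat d)"
    unfolding C_qc_dim_def mem_Collect_eq
  proof (rule conjI[OF P], intro exI conjI ballI)
    show "u \<in> ell2 (enat d)" by (rule u)
    show "ell2_norm u = 1"
      using m u by (simp add: ell2_norm_1 qc_model_def \<psi> Tr_colm_colm)
    fix s assume "s \<in> S" then show "povm_op (enat d) A (\<lambda>a. mv d (X s a))"
      using m by (intro povm_op_mv) (simp add: qc_model_def)
  next
    fix t assume "t \<in> T" then show "povm_op (enat d) B (\<lambda>b. mv d (Y t b))"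
      using m by (intro povm_op_mv) (simp add: qc_model_def)
  next
    fix a b s t v assume ab: "a \<in> A" "b \<in> B" "s \<in> S" "t \<in> T"
    then have "X s a * Y t b = Y t b * X s a" using m by (auto simp: qc_model_def)
    then show "mv d (X s a) (mv d (Y t b) v) = mv d (Y t b) (mv d (X s a) v)"
      using ab by (simp add: mv_mult[symmetric] dX dY)
  next
    fix a b s t assume ab: "a \<in> A" "b \<in> B" "s \<in> S" "t \<in> T"
    then have "complex_of_real (P a b s t) = Tr (adj \<psi> * (X s a * Y t b) * \<psi>)"
      using m by (auto simp: qc_model_def)
    also have "\<dots> = (\<Sum>i<d. cnj (u i) * mv d (X s a * Y t b) u i)"
      unfolding \<psi> using ab by (intro Tr_colm dimle_times dX dY)
    finally show "complex_of_real (P a b s t) = ell2_inner u (mv d (X s a) (mv d (Y t b) u))"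
      using ab u by (simp add: ell2_inner_enat mv_mult dX)
  qed
qed

subsection \<open>The tensor product model\<close>

definition omat :: "nat \<Rightarrow> complex mat \<Rightarrow> fmat" where
  "omat d M = mk d (\<lambda>i j. M $$ (i, j))"

definition tomat :: "nat \<Rightarrow> fmat \<Rightarrow> complex mat" where
  "tomat d M = mat d d (\<lambda>(i, j). ent M i j)"

lemma tomat_carrier [simp]: "tomat d M \<in> carrier_mat d d" by (simp add: tomat_def)

lemma dimle_omat [simp]: "dimle d (omat d M)" by (simp add: omat_def)

lemma tomat_omat: "M \<in> carrier_mat d d \<Longrightarrow> tomat d (omat d M) = M"
  by (rule eq_matI) (auto simp: tomat_def omat_def)

lemma tomat_quadratic:
  assumes "dimle d M"
  shows "(tomat d M *\<^sub>v vec d u) \<bullet>c vec d v = Tr (adj (colm d v) * M * colm d u)"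
proof -
  have "(tomat d M *\<^sub>v vec d u) $ i = mv d M u i" if "i < d" for i
    using that by (simp add: tomat_def mv_def scalar_prod_def lessThan_atLeast0)
  then show ?thesis
    unfolding Tr_colm[OF assms]
    by (simp add: scalar_prod_def lessThan_atLeast0 mult.commute tomat_def)
qed

lemma vec_index_eta: "v \<in> carrier_vec d \<Longrightarrow> vec d (\<lambda>i. v $ i) = v"
  by (rule eq_vecI) auto

lemma psd_mat_tomat: "dimle d M \<Longrightarrow> psd_mat d (tomat d M) \<longleftrightarrow> psd M"
proof -
  assume M: "dimle d M"
  have *: "(tomat d M *\<^sub>v vec d v) \<bullet>c vec d v = (\<Sum>i<d. cnj (v i) * mv d M v i)" for v
    using tomat_quadratic[OF M, of v v] Tr_colm[OF M, of v v] by simp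
  have **: "(\<Sum>i<d. cnj (v i) * mv d M v i) \<in> \<real>\<^sub>\<ge>\<^sub>0 \<longleftrightarrow> 0 \<le> (\<Sum>i<d. cnj (v i) * mv d M v i)" for v
    by (auto simp: complex_nonneg_Reals_iff less_eq_complex_def)
  show ?thesis
  proof
    assume "psd_mat d (tomat d M)"
    then have "(tomat d M *\<^sub>v vec d v) \<bullet>c vec d v \<in> \<real>\<^sub>\<ge>\<^sub>0" for v
      by (simp add: psd_mat_def)
    then show "psd M" unfolding psd_iff_mv[OF M] * ** by simp
  next
    assume M': "psd M"
    have "(\<Sum>i<d. \<Sum>j<d. cnj (v i) * ent M i j * v j) = (\<Sum>i<d. cnj (v i) * mv d M v i)" for v
      by (simp add: mv_def sum_distrib_left mult.assoc)
    then have "0 \<le> (\<Sum>i<d. cnj (v i) * mv d M v i)" for v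
      using M' unfolding psd_iff_sum[OF M] by metis
    then have "(tomat d M *\<^sub>v vec d v) \<bullet>c vec d v \<in> \<real>\<^sub>\<ge>\<^sub>0" for v unfolding * ** .
    then have "(tomat d M *\<^sub>v v) \<bullet>c v \<in> \<real>\<^sub>\<ge>\<^sub>0" if "v \<in> carrier_vec d" for v
      using vec_index_eta[OF that] by metis
    then show "psd_mat d (tomat d M)" by (simp add: psd_mat_def)
  qed
qed

lemma povm_tomat:
  assumes "povm d A X"
  shows "povm_mat d A (\<lambda>a. tomat d (X a))"
proof -
  have s: "(\<Sum>a\<in>A. ent (X a) i j) = ent (idm d) i j" for i j
    using assms unfolding povm_def by (metis ent_sum)
  have "mat d d (\<lambda>ij. \<Sum>a\<in>A. tomat d (X a) $$ ij) = 1\<^sub>m d"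
    by (rule eq_matI) (auto simp: tomat_def s ent_idm)
  then show ?thesis using assms by (auto simp: povm_mat_def povm_def psd_mat_tomat)
qed

lemma povm_omat:
  assumes "povm_mat d A X"
  shows "povm d A (\<lambda>a. omat d (X a))"
proof -
  have c: "X a \<in> carrier_mat d d" if "a \<in> A" for a
    using assms that by (simp add: povm_mat_def psd_mat_def)
  have "psd (omat d (X a))" if "a \<in> A" for a
    using assms that psd_mat_tomat[OF dimle_omat, of d "X a"]
    by (simp add: povm_mat_def tomat_omat c)
  moreover have "(\<Sum>a\<in>A. omat d (X a)) = idm d"
  proof (rule fmat_eqI)
    fix i j
    have "mat d d (\<lambda>ij. \<Sum>a\<in>A. X a $$ ij) $$ (i, j) = 1\<^sub>m d $$ (i, j)"
      using assms by (simp add: povm_mat_def)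
    then have "i < d \<Longrightarrow> j < d \<Longrightarrow> (\<Sum>a\<in>A. X a $$ (i, j)) = (if i = j then 1 else 0)"
      by simp
    then show "ent (\<Sum>a\<in>A. omat d (X a)) i j = ent (idm d) i j"
      by (cases "i < d \<and> j < d") (auto simp: omat_def ent_idm)
  qed
  ultimately show ?thesis by (simp add: povm_def)
qed

lemma kronecker_tomat: "kronecker (tomat d M) (tomat d N) = tomat (d * d) (kr d d M N)"
proof (rule eq_matI)
  fix i j assume "i < dim_row (tomat (d * d) (kr d d M N))" "j < dim_col (tomat (d * d) (kr d d M N))"
  then have ij: "i < d * d" "j < d * d" by (auto simp: tomat_def)
  then have d: "0 < d" by (cases d) auto
  have "i div d < d" "j div d < d" "i mod d < d" "j mod d < d"
    using ij d by (auto simp: less_mult_imp_div_less)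
  then show "kronecker (tomat d M) (tomat d N) $$ (i, j) = tomat (d * d) (kr d d M N) $$ (i, j)"
    using ij by (simp add: kronecker_def tomat_def ent_kr)
qed (auto simp: kronecker_def tomat_def)

text \<open>The operators E \<otimes> 1 and 1 \<otimes> F commute and multiply to E \<otimes> F. The
  dimension d * d obtained here serves to show that \<open>D_qc\<close> is finite on
  \<open>C_q\<close>.\<close>

theorem C_q_dim_imp_qc_model:
  assumes "P \<in> C_q_dim A B S T d"
  shows "\<exists>X Y \<psi>. qc_model A B S T (d * d) X Y \<psi> P"
proof -
  from assms have "\<exists>\<psi> E F. \<psi> \<in> carrier_vec (d * d) \<and> \<psi> \<bullet>c \<psi> = 1 \<and>
        (\<forall>s\<in>S. povm_mat d A (E s)) \<and> (\<forall>t\<in>T. povm_mat d B (F t)) \<and>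
        (\<forall>a\<in>A. \<forall>b\<in>B. \<forall>s\<in>S. \<forall>t\<in>T.
           complex_of_real (P a b s t) = (kronecker (E s a) (F t b) *\<^sub>v \<psi>) \<bullet>c \<psi>)"
    by (simp add: C_q_dim_def)
  then obtain \<psi> E F where \<psi>: "\<psi> \<in> carrier_vec (d * d)" "\<psi> \<bullet>c \<psi> = 1" and
    E: "\<forall>s\<in>S. povm_mat d A (E s)" and F: "\<forall>t\<in>T. povm_mat d B (F t)" and
    val: "\<forall>a\<in>A. \<forall>b\<in>B. \<forall>s\<in>S. \<forall>t\<in>T.
      complex_of_real (P a b s t) = (kronecker (E s a) (F t b) *\<^sub>v \<psi>) \<bullet>c \<psi>"
    by blast
  define e where "e s a = omat d (E s a)" for s a
  define f where "f t b = omat d (F t b)" for t b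
  have e: "povm d A (e s)" if "s \<in> S" for s using E that povm_omat unfolding e_def by blast
  have f: "povm d B (f t)" if "t \<in> T" for t using F that povm_omat unfolding f_def by blast
  have I: "psd (idm d)" using psd_adj_self[of "idm d"] by simp
  define v where "v = colm (d * d) (\<lambda>i. \<psi> $ i)"
  have dm: "dimle d (e s a)" "dimle d (f t b)" for s a t b by (simp_all add: e_def f_def)
  have "qc_model A B S T (d * d) (\<lambda>s a. kr d d (e s a) (idm d)) (\<lambda>t b. kr d d (idm d) (f t b)) v P"
    unfolding qc_model_def
  proof (intro conjI ballI)
    fix s assume "s \<in> S"
    from e[OF this] show "povm (d * d) A (\<lambda>a. kr d d (e s a) (idm d))"
      by (auto simp: povm_def psd_kr I kr_sum_left[symmetric] kr_idm)
  next
    fix t assume "t \<in> T"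
    from f[OF this] show "povm (d * d) B (\<lambda>b. kr d d (idm d) (f t b))"
      by (auto simp: povm_def psd_kr I kr_sum_right[symmetric] kr_idm)
  next
    fix a b s t assume ab: "a \<in> A" "b \<in> B" "s \<in> S" "t \<in> T"
    show "kr d d (e s a) (idm d) * kr d d (idm d) (f t b) = kr d d (idm d) (f t b) * kr d d (e s a) (idm d)"
      by (simp add: kr_mult dm idm_times times_idm)
    have "E s a = tomat d (e s a)" "F t b = tomat d (f t b)"
      using E F ab by (auto simp: e_def f_def tomat_omat povm_mat_def psd_mat_def)
    then have "complex_of_real (P a b s t)
        = (tomat (d * d) (kr d d (e s a) (f t b)) *\<^sub>v vec (d * d) (\<lambda>i. \<psi> $ i)) \<bullet>c vec (d * d) (\<lambda>i. \<psi> $ i)"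
      using val ab by (simp add: kronecker_tomat vec_index_eta[OF \<psi>(1)])
    also have "\<dots> = Tr (adj v * kr d d (e s a) (f t b) * v)"
      unfolding v_def by (rule tomat_quadratic) simp
    finally show "complex_of_real (P a b s t)
        = Tr (adj v * (kr d d (e s a) (idm d) * kr d d (idm d) (f t b)) * v)"
      by (simp add: kr_mult dm idm_times times_idm)
  next
    show "idm (d * d) * v = v" "v * idm 1 = v" by (simp_all add: v_def)
    have "\<psi> \<bullet>c \<psi> = (\<Sum>i<d * d. cnj (\<psi> $ i) * \<psi> $ i)"
      using \<psi>(1) by (simp add: scalar_prod_def lessThan_atLeast0 mult.commute)
    then show "Tr (adj v * v) = 1" using \<psi>(2) by (simp add: v_def Tr_colm_colm)
  qed
  then show ?thesis by blast
qed

text \<open>The columns of \<open>R\<close> become the branches of a purification, indexed by an ancilla that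
  both parties carry as the leading tensor factor and that the second party keeps in state 0.\<close>

lemma purification:
  fixes R x y :: fmat
  assumes R: "dimle (d * d) R" and d: "0 < d" and x: "dimle d x" and y: "dimle d y"
  defines "m \<equiv> d * d" and "D \<equiv> d * d * d"
  defines "\<psi> \<equiv> colm (D * D) (\<lambda>n. if n mod D < d
    then ent R (n div D mod d * d + n mod D) (n div D div d) else 0)"
  shows "Tr (adj \<psi> * kr D D (kr m d (idm m) x) (kr m d (idm m) y) * \<psi>) = Tr (adj R * kr d d x y * R)"
proof -
  \<comment> \<open>The index \<alpha> of the first party encodes the ancilla, i.e. the column of R,
    as \<alpha> div d and the local basis vector as \<alpha> mod d. The condition \<beta> < d says
    that the ancilla of the second party is in state 0.\<close>
  define g where "g \<alpha> \<beta> = (if \<beta> < d then ent R (\<alpha> mod d * d + \<beta>) (\<alpha> div d) else 0)" for \<alpha> \<beta>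
  have \<psi>: "\<psi> = colm (D * D) (\<lambda>n. g (n div D) (n mod D))" by (simp add: \<psi>_def g_def)
  have D: "D = m * d" by (simp add: D_def m_def)
  have m0: "0 < m" using d by (simp add: m_def)
  let ?X = "kr m d (idm m) x" and ?Y = "kr m d (idm m) y"
  have "Tr (adj \<psi> * kr D D ?X ?Y * \<psi>) = (\<Sum>n<D*D. \<Sum>n'<D*D.
      cnj (g (n div D) (n mod D)) * (ent ?X (n div D) (n' div D) * ent ?Y (n mod D) (n' mod D)) *
      g (n' div D) (n' mod D))"
    unfolding \<psi> by (subst Tr_colm) (simp_all add: mv_def ent_kr sum_distrib_left mult.assoc)
  also have "\<dots> = (\<Sum>n<D*D. (\<lambda>\<alpha> \<beta>. \<Sum>\<alpha>'<D. \<Sum>\<beta>'<D.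
      cnj (g \<alpha> \<beta>) * (ent ?X \<alpha> \<alpha>' * ent ?Y \<beta> \<beta>') * g \<alpha>' \<beta>') (n div D) (n mod D))"
    by (rule sum.cong[OF refl]) (rule sum_div_mod)
  also have "\<dots> = (\<Sum>\<alpha><D. \<Sum>\<beta><D. \<Sum>\<alpha>'<D. \<Sum>\<beta>'<D.
      cnj (g \<alpha> \<beta>) * (ent ?X \<alpha> \<alpha>' * ent ?Y \<beta> \<beta>') * g \<alpha>' \<beta>')"
    by (rule sum_div_mod)
  also have "\<dots> = (\<Sum>\<alpha><D. \<Sum>\<beta><d. \<Sum>\<alpha>'<D. \<Sum>\<beta>'<d.
      cnj (g \<alpha> \<beta>) * (ent ?X \<alpha> \<alpha>' * ent ?Y \<beta> \<beta>') * g \<alpha>' \<beta>')"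
  proof -
    have dD: "d \<le> D" using m0 by (simp add: D)
    have *: "(\<Sum>\<beta><D. f \<beta>) = (\<Sum>\<beta><d. f \<beta>)" if "\<And>\<beta>. d \<le> \<beta> \<Longrightarrow> f \<beta> = 0" for f :: "nat \<Rightarrow> complex"
      by (rule sum.mono_neutral_right) (use dD that in auto)
    show ?thesis by (subst *, simp add: g_def, intro sum.cong refl *, simp add: g_def)
  qed
  also have "\<dots> = (\<Sum>\<alpha><D. \<Sum>\<beta><d. \<Sum>\<alpha>'<D. \<Sum>\<beta>'<d.
      cnj (ent R (\<alpha> mod d * d + \<beta>) (\<alpha> div d)) *
      ((if \<alpha> div d = \<alpha>' div d then ent x (\<alpha> mod d) (\<alpha>' mod d) else 0) * ent y \<beta> \<beta>') *
      ent R (\<alpha>' mod d * d + \<beta>') (\<alpha>' div d))"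
  proof (intro sum.cong refl)
    fix \<alpha> \<beta> \<alpha>' \<beta>' assume *: "\<alpha> \<in> {..<D}" "\<beta> \<in> {..<d}" "\<alpha>' \<in> {..<D}" "\<beta>' \<in> {..<d}"
    have "\<alpha> div d < m" using * by (auto simp: D less_mult_imp_div_less)
    then have 1: "ent ?X \<alpha> \<alpha>' = (if \<alpha> div d = \<alpha>' div d then ent x (\<alpha> mod d) (\<alpha>' mod d) else 0)"
      using * by (simp add: ent_kr D ent_idm)
    have "\<beta> < m * d" "\<beta>' < m * d" using * m0 by (auto intro: less_le_trans)
    then have 2: "ent ?Y \<beta> \<beta>' = ent y \<beta> \<beta>'" using * m0 by (simp add: ent_kr ent_idm)
    show "cnj (g \<alpha> \<beta>) * (ent ?X \<alpha> \<alpha>' * ent ?Y \<beta> \<beta>') * g \<alpha>' \<beta>' =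
      cnj (ent R (\<alpha> mod d * d + \<beta>) (\<alpha> div d)) *
      ((if \<alpha> div d = \<alpha>' div d then ent x (\<alpha> mod d) (\<alpha>' mod d) else 0) * ent y \<beta> \<beta>') *
      ent R (\<alpha>' mod d * d + \<beta>') (\<alpha>' div d)"
      unfolding 1 2 using * by (simp add: g_def)
  qed
  also have "\<dots> = (\<Sum>k<m. \<Sum>i<d. \<Sum>\<beta><d. \<Sum>k'<m. \<Sum>i'<d. \<Sum>\<beta>'<d.
      cnj (ent R (i * d + \<beta>) k) * ((if k = k' then ent x i i' else 0) * ent y \<beta> \<beta>') *
      ent R (i' * d + \<beta>') k')"
    (is "_ = (\<Sum>k<m. \<Sum>i<d. \<Sum>\<beta><d. ?H k i \<beta>)")
  proof -
    have "(\<Sum>\<alpha>'<D. \<Sum>\<beta>'<d. cnj (ent R (i * d + \<beta>) k) *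
        ((if k = \<alpha>' div d then ent x i (\<alpha>' mod d) else 0) * ent y \<beta> \<beta>') *
        ent R (\<alpha>' mod d * d + \<beta>') (\<alpha>' div d)) = ?H k i \<beta>" for k i \<beta>
      unfolding D by (rule sum_div_mod)
    then show ?thesis unfolding D by (simp only: sum_div_mod[of "\<lambda>k i. \<Sum>\<beta><d. ?H k i \<beta>"])
  qed
  \<comment> \<open>The operator of the first party is the identity on the ancilla, so different
    columns k and k' do not interfere and the value is a sum over the columns of R.\<close>
  also have "\<dots> = (\<Sum>k<m. \<Sum>i<d. \<Sum>\<beta><d. \<Sum>i'<d. \<Sum>\<beta>'<d.
      cnj (ent R (i * d + \<beta>) k) * (ent x i i' * ent y \<beta> \<beta>') * ent R (i' * d + \<beta>') k)"
  proof ((rule sum.cong[OF refl])+)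
    fix k i \<beta> assume k: "k \<in> {..<m}"
    have "(\<Sum>k'<m. \<Sum>i'<d. \<Sum>\<beta>'<d.
        cnj (ent R (i * d + \<beta>) k) * ((if k = k' then ent x i i' else 0) * ent y \<beta> \<beta>') * ent R (i' * d + \<beta>') k')
      = (\<Sum>k'<m. if k' = k then \<Sum>i'<d. \<Sum>\<beta>'<d.
        cnj (ent R (i * d + \<beta>) k) * (ent x i i' * ent y \<beta> \<beta>') * ent R (i' * d + \<beta>') k else 0)"
      by (rule sum.cong) auto
    then show "(\<Sum>k'<m. \<Sum>i'<d. \<Sum>\<beta>'<d.
        cnj (ent R (i * d + \<beta>) k) * ((if k = k' then ent x i i' else 0) * ent y \<beta> \<beta>') * ent R (i' * d + \<beta>') k')
      = (\<Sum>i'<d. \<Sum>\<beta>'<d. cnj (ent R (i * d + \<beta>) k) * (ent x i i' * ent y \<beta> \<beta>') * ent R (i' * d + \<beta>') k)"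
      using k by simp
  qed
  also have "\<dots> = (\<Sum>k<m. \<Sum>p<d*d. \<Sum>q<d*d.
      cnj (ent R p k) * (ent x (p div d) (q div d) * ent y (p mod d) (q mod d)) * ent R q k)"
  proof (rule sum.cong[OF refl])
    fix k
    have "(\<Sum>p<d*d. \<Sum>q<d*d.
        cnj (ent R p k) * (ent x (p div d) (q div d) * ent y (p mod d) (q mod d)) * ent R q k)
      = (\<Sum>p<d*d. (\<lambda>i \<beta>. \<Sum>q<d*d. (\<lambda>i' \<beta>'. cnj (ent R (i * d + \<beta>) k) * (ent x i i' * ent y \<beta> \<beta>') *
          ent R (i' * d + \<beta>') k) (q div d) (q mod d)) (p div d) (p mod d))"
      by simp
    also have "\<dots> = (\<Sum>i<d. \<Sum>\<beta><d. \<Sum>i'<d. \<Sum>\<beta>'<d.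
        cnj (ent R (i * d + \<beta>) k) * (ent x i i' * ent y \<beta> \<beta>') * ent R (i' * d + \<beta>') k)"
      unfolding sum_div_mod[of "\<lambda>i' \<beta>'. cnj (ent R _ k) * (ent x _ i' * ent y _ \<beta>') * ent R (i' * d + \<beta>') k"]
      by (rule sum_div_mod)
    finally show "(\<Sum>i<d. \<Sum>\<beta><d. \<Sum>i'<d. \<Sum>\<beta>'<d.
        cnj (ent R (i * d + \<beta>) k) * (ent x i i' * ent y \<beta> \<beta>') * ent R (i' * d + \<beta>') k)
      = (\<Sum>p<d*d. \<Sum>q<d*d.
        cnj (ent R p k) * (ent x (p div d) (q div d) * ent y (p mod d) (q mod d)) * ent R q k)" by simp
  qed
  also have "\<dots> = Tr (adj R * kr d d x y * R)"
    unfolding m_def using R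
    by (subst Tr_dimle[of "d * d"])
      (auto simp: dimle_times ent_times_dimle[of "d * d"] mult.assoc sum_distrib_left ent_kr intro!: sum.cong)
  finally show ?thesis .
qed

text \<open>The commuting model yields a square root R of a mixed state on the tensor square, and
  \<open>purification\<close> turns it into a vector state at the price of local dimension d * d *
  d.\<close>

theorem qc_model_imp_C_q:
  assumes P: "correlation A B S T P" and m: "qc_model A B S T d X Y \<psi> P"
  shows "P \<in> C_q A B S T"
proof -
  have X: "povm d A (X s)" if "s \<in> S" for s using m that by (simp add: qc_model_def)
  have Y: "povm d B (Y t)" if "t \<in> T" for t using m that by (simp add: qc_model_def)
  have "d \<noteq> 0"
  proof
    assume "d = 0"
    moreover have "idm 0 = 0" by (rule fmat_eqI) (simp add: ent_idm)
    ultimately have "\<psi> = 0" using m by (simp add: qc_model_def)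
    then show False using m by (simp add: qc_model_def)
  qed
  then have d: "0 < d" by simp
  \<comment> \<open>With the identities adjoined, the agreement of the two states also covers the
    product of the identities, which normalises the new vector.\<close>
  define XX where "XX = insert (idm d) {X s a | s a. s \<in> S \<and> a \<in> A}"
  define YY where "YY = insert (idm d) {Y t b | t b. t \<in> T \<and> b \<in> B}"
  have dX: "dimle d (X s a) \<and> psd (X s a)" if "s \<in> S" "a \<in> A" for s a
    using X[OF that(1)] that by (simp add: povm_def)
  have dY: "dimle d (Y t b) \<and> psd (Y t b)" if "t \<in> T" "b \<in> B" for t b
    using Y[OF that(1)] that by (simp add: povm_def)
  have comm: "X s a * Y t b = Y t b * X s a" if "s \<in> S" "a \<in> A" "t \<in> T" "b \<in> B" for s a t b
    using m that by (simp add: qc_model_def)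
  obtain R where R: "dimle (d * d) R"
    "\<And>x y. x \<in> XX \<Longrightarrow> y \<in> YY \<Longrightarrow> Tr (adj R * kr d d x y * R) = Tr (adj \<psi> * (x * y) * \<psi>)"
  proof (rule commuting_to_tensor[of XX d YY \<psi>])
    show "dimle d x \<and> adj x = x" if "x \<in> XX" for x
      using that dX psd_adj_eq by (auto simp: XX_def)
    show "dimle d y" if "y \<in> YY" for y using that dY by (auto simp: YY_def)
    show "x * y = y * x" if "x \<in> XX" "y \<in> YY" for x y
      using that comm dX dY by (auto simp: XX_def YY_def idm_times times_idm)
  qed (rule that; assumption)
  define k where "k = d * d"
  define D where "D = d * d * d"
  have D: "D = k * d" by (simp add: D_def k_def)
  define u where "u = (\<lambda>n. if n mod D < d
    then ent R (n div D mod d * d + n mod D) (n div D div d) else 0)"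
  have val: "Tr (adj (colm (D * D) u) * kr D D (kr k d (idm k) x) (kr k d (idm k) y) * colm (D * D) u)
      = Tr (adj \<psi> * (x * y) * \<psi>)" if "x \<in> XX" "y \<in> YY" for x y
  proof -
    have "dimle d x" "dimle d y" using that dX dY by (auto simp: XX_def YY_def)
    from purification[OF R(1) d this] show ?thesis
      unfolding u_def k_def D_def R(2)[OF that] .
  qed
  have I: "psd (idm k)" using psd_adj_self[of "idm k"] by simp
  have "P \<in> C_q_dim A B S T D"
    unfolding C_q_dim_def mem_Collect_eq
  proof (rule conjI[OF P], intro exI conjI ballI)
    show "vec (D * D) u \<in> carrier_vec (D * D)" by simp
    have "Tr (adj (colm (D * D) u) * colm (D * D) u) = 1"
      using val[of "idm d" "idm d"] m
      by (simp add: XX_def YY_def kr_idm D[symmetric] mult.assoc qc_model_def)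
    then show "vec (D * D) u \<bullet>c vec (D * D) u = 1"
      by (simp add: scalar_prod_def lessThan_atLeast0 mult.commute Tr_colm_colm)
    fix s assume s: "s \<in> S"
    show "povm_mat D A (\<lambda>a. tomat D (kr k d (idm k) (X s a)))"
      using X[OF s] by (intro povm_tomat)
        (auto simp: povm_def D psd_kr I kr_sum_right[symmetric] kr_idm)
  next
    fix t assume t: "t \<in> T"
    show "povm_mat D B (\<lambda>b. tomat D (kr k d (idm k) (Y t b)))"
      using Y[OF t] by (intro povm_tomat)
        (auto simp: povm_def D psd_kr I kr_sum_right[symmetric] kr_idm)
  next
    fix a b s t assume ab: "a \<in> A" "b \<in> B" "s \<in> S" "t \<in> T"
    have "complex_of_real (P a b s t) = Tr (adj \<psi> * (X s a * Y t b) * \<psi>)"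
      using m ab by (simp add: qc_model_def)
    also have "\<dots> = Tr (adj (colm (D * D) u) *
        kr D D (kr k d (idm k) (X s a)) (kr k d (idm k) (Y t b)) * colm (D * D) u)"
      by (rule val[symmetric]) (use ab in \<open>auto simp: XX_def YY_def\<close>)
    finally show "complex_of_real (P a b s t) =
        (kronecker (tomat D (kr k d (idm k) (X s a))) (tomat D (kr k d (idm k) (Y t b))) *\<^sub>v vec (D * D) u)
        \<bullet>c vec (D * D) u"
      by (simp add: kronecker_tomat tomat_quadratic)
  qed
  then show ?thesis by (auto simp: C_q_def)
qed

section \<open>Compactness\<close>

lemma bounded_family_subseq:
  fixes f :: "nat \<Rightarrow> 'j \<Rightarrow> complex"
  assumes "finite J" "\<And>j. j \<in> J \<Longrightarrow> \<exists>K. \<forall>n. cmod (f n j) \<le> K"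
  shows "\<exists>r l. strict_mono r \<and> (\<forall>j\<in>J. (\<lambda>n. f (r n) j) \<longlonglongrightarrow> l j)"
  using assms
proof (induction J rule: finite_induct)
  case empty
  show ?case by (rule exI[of _ id]) (simp add: strict_mono_def)
next
  case (insert j J)
  obtain r l where r: "strict_mono r" "\<forall>j\<in>J. (\<lambda>n. f (r n) j) \<longlonglongrightarrow> l j"
    using insert.IH insert.prems by blast
  obtain K where "\<forall>n. cmod (f (r n) j) \<le> K" using insert.prems by blast
  from Bolzano_Weierstrass_complex_disc[OF this]
  obtain g z where g: "strict_mono (g :: nat \<Rightarrow> nat)"
    "\<forall>e>0. \<exists>N. \<forall>n\<ge>N. cmod (f (r (g n)) j - z) < e"
    by (elim exE conjE) (rule that)
  have "(\<lambda>n. f (r (g n)) j) \<longlonglongrightarrow> z" using g(2) by (simp add: LIMSEQ_def dist_norm)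
  moreover have "(\<lambda>n. f (r (g n)) i) \<longlonglongrightarrow> l i" if "i \<in> J" for i
    using LIMSEQ_subseq_LIMSEQ[OF r(2)[rule_format, OF that] g(1)] by (simp add: o_def)
  moreover have "strict_mono (\<lambda>n. r (g n))" using r(1) g(1) by (simp add: strict_mono_def)
  ultimately show ?case
    using insert.hyps by (intro exI[of _ "\<lambda>n. r (g n)"] exI[of _ "l(j := z)"]) auto
qed

section \<open>Entrywise limits of matrices of bounded size\<close>

definition mconv :: "(nat \<Rightarrow> fmat) \<Rightarrow> fmat \<Rightarrow> bool" where
  "mconv F M \<longleftrightarrow> (\<forall>i j. (\<lambda>n. ent (F n) i j) \<longlonglongrightarrow> ent M i j)"

lemma mconv_const: "mconv (\<lambda>n. M) M" by (simp add: mconv_def)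

lemma mconv_adj: "mconv F M \<Longrightarrow> mconv (\<lambda>n. adj (F n)) (adj M)"
  by (auto simp: mconv_def intro: tendsto_cnj)

lemma mconv_sum: "(\<And>a. a \<in> A \<Longrightarrow> mconv (\<lambda>n. F n a) (M a)) \<Longrightarrow> mconv (\<lambda>n. \<Sum>a\<in>A. F n a) (\<Sum>a\<in>A. M a)"
  by (auto simp: mconv_def intro!: tendsto_sum)

lemma mconv_mult:
  assumes "mconv F M" "mconv G N" "\<And>n. dimle d (F n)" "dimle d M"
  shows "mconv (\<lambda>n. F n * G n) (M * N)"
  unfolding mconv_def ent_times_dimle[OF assms(3)] ent_times_dimle[OF assms(4)]
  using assms(1,2) by (intro allI tendsto_sum tendsto_mult) (simp_all add: mconv_def)

lemma mconv_Tr: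
  assumes "mconv F M" "\<And>n. dimle d (F n)" "dimle d M"
  shows "(\<lambda>n. Tr (F n)) \<longlonglongrightarrow> Tr M"
  unfolding Tr_dimle[OF assms(2)] Tr_dimle[OF assms(3)]
  using assms(1) by (intro tendsto_sum) (simp add: mconv_def)

lemma mconv_unique:
  assumes "mconv F M" "mconv F N"
  shows "M = N"
proof (rule fmat_eqI)
  fix i j
  have "(\<lambda>n. ent (F n) i j) \<longlonglongrightarrow> ent M i j" "(\<lambda>n. ent (F n) i j) \<longlonglongrightarrow> ent N i j"
    using assms by (simp_all add: mconv_def)
  then show "ent M i j = ent N i j" by (rule LIMSEQ_unique)
qed

lemma mconv_psd:
  assumes "mconv F M" "\<And>n. dimle d (F n)" "dimle d M" "\<And>n. psd (F n)"
  shows "psd M"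
  unfolding psd_iff_sum[OF assms(3)]
proof
  fix v :: "nat \<Rightarrow> complex"
  let ?s = "\<lambda>M. \<Sum>i<d. \<Sum>j<d. cnj (v i) * ent M i j * v j"
  have l: "(\<lambda>n. ?s (F n)) \<longlonglongrightarrow> ?s M"
    using assms(1) unfolding mconv_def by (intro tendsto_intros) auto
  have p: "0 \<le> ?s (F n)" for n using assms(4)[of n] unfolding psd_iff_sum[OF assms(2)] by blast
  have "0 \<le> Re (?s M)"
    by (rule LIMSEQ_le_const[OF tendsto_Re[OF l]]) (use p in \<open>auto simp: less_eq_complex_def\<close>)
  moreover have "(\<lambda>n. Im (?s (F n))) = (\<lambda>n. 0)" using p by (auto simp: less_eq_complex_def)
  then have "(\<lambda>n. 0) \<longlonglongrightarrow> Im (?s M)" using tendsto_Im[OF l] by simp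
  then have "Im (?s M) = 0" by (simp add: LIMSEQ_const_iff)
  ultimately show "0 \<le> ?s M" by (simp add: less_eq_complex_def)
qed

lemma fmat_family_subseq:
  fixes F :: "nat \<Rightarrow> 'j \<Rightarrow> fmat"
  assumes "finite J" "\<And>n j. j \<in> J \<Longrightarrow> dimle d (F n j)"
    and b: "\<And>n j i k. j \<in> J \<Longrightarrow> cmod (ent (F n j) i k) \<le> K"
  shows "\<exists>r M. strict_mono r \<and> (\<forall>j\<in>J. dimle d (M j) \<and> mconv (\<lambda>n. F (r n) j) (M j))"
proof -
  obtain r l where r: "strict_mono r"
    "\<forall>x\<in>J \<times> {..<d} \<times> {..<d}. (\<lambda>n. ent (F (r n) (fst x)) (fst (snd x)) (snd (snd x))) \<longlonglongrightarrow> l x"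
    using bounded_family_subseq[of "J \<times> {..<d} \<times> {..<d}" "\<lambda>n x. ent (F n (fst x)) (fst (snd x)) (snd (snd x))"]
      assms(1) b by fastforce
  have "mconv (\<lambda>n. F (r n) j) (mk d (\<lambda>i k. l (j, i, k)))" if j: "j \<in> J" for j
    unfolding mconv_def
  proof (intro allI)
    fix i k
    show "(\<lambda>n. ent (F (r n) j) i k) \<longlonglongrightarrow> ent (mk d (\<lambda>i k. l (j, i, k))) i k"
    proof (cases "i < d \<and> k < d")
      case True
      then show ?thesis using r(2)[rule_format, of "(j, i, k)"] j by simp
    next
      case False
      then have "ent (F (r n) j) i k = 0" for n
        using assms(2)[OF j] unfolding dimle_def by blast
      then show ?thesis using False by auto
    qed
  qed
  with r(1) show ?thesis by (intro exI[of _ r] exI[of _ "\<lambda>j. mk d (\<lambda>i k. l (j, i, k))"]) simp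
qed

lemma psd_factor_ent:
  assumes "psd M" "dimle d M"
  obtains R where "dimle d R" "\<And>i j. ent M i j = (\<Sum>k<d. ent R i k * cnj (ent R j k))"
proof -
  obtain R where R: "dimle d R" "adj R = R" "R * R = M" using psd_sqrt assms by blast
  have "ent M i j = (\<Sum>k<d. ent R i k * cnj (ent R j k))" for i j
  proof -
    have "ent M i j = (\<Sum>k<d. ent R i k * ent (adj R) k j)"
      using R by (metis ent_times_dimle)
    then show ?thesis by simp
  qed
  then show thesis using R(1) that by blast
qed

lemma psd_diag: "psd M \<Longrightarrow> 0 \<le> ent M i i"
proof -
  assume M: "psd M"
  obtain d where "dimle d M" using dimle_ex by blast
  with M obtain R where "ent M i i = (\<Sum>k<d. ent R i k * cnj (ent R i k))" using psd_factor_ent by metis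
  then show ?thesis by (auto simp: less_eq_complex_def intro!: sum_nonneg)
qed

text \<open>Write M as a Gram matrix of the rows of R. The diagonal of M bounds the norms of these
  rows, hence their entries by 1, and an entry of M is a sum of d products of such entries.\<close>

lemma psd_ent_bound:
  assumes M: "psd M" "dimle d M" and b: "\<And>i. Re (ent M i i) \<le> 1"
  shows "cmod (ent M i j) \<le> real d"
proof -
  obtain R where R: "\<And>i j. ent M i j = (\<Sum>k<d. ent R i k * cnj (ent R j k))"
    using psd_factor_ent M by metis
  have r: "cmod (ent R i k) \<le> 1" if "k < d" for i k
  proof -
    have "Re (ent M i i) = (\<Sum>k<d. (cmod (ent R i k))\<^sup>2)"
      by (simp add: R complex_norm_square[symmetric] del: complex_mult_cnj)
    moreover have "(cmod (ent R i k))\<^sup>2 \<le> (\<Sum>k<d. (cmod (ent R i k))\<^sup>2)"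
      by (rule member_le_sum) (use that in auto)
    ultimately have "(cmod (ent R i k))\<^sup>2 \<le> 1\<^sup>2" using b[of i] by simp
    then show ?thesis by (rule power2_le_imp_le) simp
  qed
  have "cmod (ent M i j) \<le> (\<Sum>k<d. 1)"
    unfolding R by (rule sum_norm_le) (auto simp: norm_mult intro!: mult_le_one r)
  then show ?thesis by simp
qed

text \<open>Diagonal entries of positive matrices are nonnegative, and over the POVM they add up to
  at most 1, so each of them is at most 1.\<close>

lemma povm_ent_bound:
  assumes X: "povm d A X" and A: "finite A" and a: "a \<in> A"
  shows "cmod (ent (X a) i j) \<le> real d"
proof (rule psd_ent_bound)
  show "psd (X a)" "dimle d (X a)" using X a by (auto simp: povm_def)
  fix i
  have "Re (ent (X a) i i) \<le> (\<Sum>a\<in>A. Re (ent (X a) i i))"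
    by (rule member_le_sum) (use X A a psd_diag in \<open>auto simp: povm_def less_eq_complex_def\<close>)
  also have "\<dots> = Re (ent (idm d) i i)" using X by (metis Re_sum ent_sum povm_def)
  also have "\<dots> \<le> 1" by (simp add: ent_idm)
  finally show "Re (ent (X a) i i) \<le> 1" .
qed

lemma unit_ent_bound:
  assumes "Tr (adj \<psi> * \<psi>) = 1"
  shows "cmod (ent \<psi> i j) \<le> 1"
proof -
  obtain d where d: "dimle d \<psi>" using dimle_ex by blast
  have s: "(\<Sum>j<d. \<Sum>i<d. (cmod (ent \<psi> i j))\<^sup>2) = 1"
    using assms unfolding Tr_adj_self[OF d] by (simp only: of_real_eq_1_iff)
  show ?thesis
  proof (cases "i < d \<and> j < d")
    case True
    then have "(cmod (ent \<psi> i j))\<^sup>2 \<le> (\<Sum>i<d. (cmod (ent \<psi> i j))\<^sup>2)"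
      by (intro member_le_sum) auto
    also have "\<dots> \<le> (\<Sum>j<d. \<Sum>i<d. (cmod (ent \<psi> i j))\<^sup>2)"
      using True by (intro member_le_sum[of j "{..<d}" "\<lambda>j. \<Sum>i<d. (cmod (ent \<psi> i j))\<^sup>2"])
        (auto intro: sum_nonneg)
    finally have "(cmod (ent \<psi> i j))\<^sup>2 \<le> 1\<^sup>2" using s by simp
    then show ?thesis by (rule power2_le_imp_le) simp
  next
    case False
    then have "ent \<psi> i j = 0" using d unfolding dimle_def by blast
    then show ?thesis by simp
  qed
qed

text \<open>For fixed d the POVM elements and states have uniformly bounded entries, and all
  defining conditions of a model are closed under entrywise limits.\<close>

theorem C_qc_dim_closed:
  assumes fin: "finite A" "finite B" "finite S" "finite T"
    and Q: "\<And>n. Q n \<in> C_qc_dim A B S T (enat d)"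
    and lim: "\<And>a b s t. a \<in> A \<Longrightarrow> b \<in> B \<Longrightarrow> s \<in> S \<Longrightarrow> t \<in> T \<Longrightarrow> (\<lambda>n. Q n a b s t) \<longlonglongrightarrow> P a b s t"
  shows "P \<in> C_qc_dim A B S T (enat d)"
proof -
  have cor: "correlation A B S T (Q n)" for n using Q by (simp add: C_qc_dim_iff)
  have "\<forall>n. \<exists>X Y \<psi>. qc_model A B S T d X Y \<psi> (Q n)" using Q by (simp add: C_qc_dim_iff)
  then obtain X Y \<psi> where m: "\<And>n. qc_model A B S T d (X n) (Y n) (\<psi> n) (Q n)" by metis
  have X: "povm d A (X n s)" if "s \<in> S" for n s using m[of n] that by (simp add: qc_model_def)
  have Y: "povm d B (Y n t)" if "t \<in> T" for n t using m[of n] that by (simp add: qc_model_def)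
  have \<psi>: "idm d * \<psi> n = \<psi> n" "\<psi> n * idm (Suc 0) = \<psi> n" "Tr (adj (\<psi> n) * \<psi> n) = 1" for n
    using m[of n] by (simp_all add: qc_model_def)
  have d\<psi>: "dimle (Suc d) (\<psi> n)" for n
  proof -
    have "\<psi> n = colm d (\<lambda>i. ent (\<psi> n) i 0)" using \<psi> by (intro colm_eqI) auto
    moreover have "dimle (Suc d) (colm d v)" for v by (simp add: colm_def)
    ultimately show ?thesis by metis
  qed
  \<comment> \<open>All matrices of a model are packed into one family, so that a single subsequence
    serves them all; \<open>None\<close> stands for the state.\<close>
  define F where "F n j = (case j of None \<Rightarrow> \<psi> n | Some (Inl (s, a)) \<Rightarrow> X n s a | Some (Inr (t, b)) \<Rightarrow> Y n t b)" for n j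
  define J where "J = insert None (Some ` ((S \<times> A) <+> (T \<times> B)))"
  have FJ: "finite J" using fin by (simp add: J_def)
  have dX: "dimle d (X n s a)" if "s \<in> S" "a \<in> A" for n s a
    using X that by (simp add: povm_def)
  have dY: "dimle d (Y n t b)" if "t \<in> T" "b \<in> B" for n t b
    using Y that by (simp add: povm_def)
  have dF: "dimle (Suc d) (F n j)" if "j \<in> J" for n j
    using that d\<psi> dimle_mono[OF dX, of _ _ "Suc d"] dimle_mono[OF dY, of _ _ "Suc d"]
    by (auto simp: J_def F_def)
  have bF: "cmod (ent (F n j) i k) \<le> real d + 1" if "j \<in> J" for n j i k
  proof -
    have "cmod (ent (\<psi> n) i k) \<le> real d + 1"
      using unit_ent_bound[OF \<psi>(3), of n i k] by linarith
    moreover have "cmod (ent (X n s a) i k) \<le> real d + 1" if "s \<in> S" "a \<in> A" for s a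
      using povm_ent_bound[OF X[OF that(1)] fin(1) that(2), of n i k] by linarith
    moreover have "cmod (ent (Y n t b) i k) \<le> real d + 1" if "t \<in> T" "b \<in> B" for t b
      using povm_ent_bound[OF Y[OF that(1)] fin(2) that(2), of n i k] by linarith
    ultimately show ?thesis using that by (auto simp: J_def F_def)
  qed
  have "\<exists>r M. strict_mono r \<and> (\<forall>j\<in>J. dimle (Suc d) (M j) \<and> mconv (\<lambda>n. F (r n) j) (M j))"
    using dF bF by (intro fmat_family_subseq[OF FJ]) auto
  then obtain r M where r: "strict_mono r"
    and M: "\<And>j. j \<in> J \<Longrightarrow> dimle (Suc d) (M j) \<and> mconv (\<lambda>n. F (r n) j) (M j)"
    by (elim exE conjE) (rule that, auto)
  define X' where "X' s a = M (Some (Inl (s, a)))" for s a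
  define Y' where "Y' t b = M (Some (Inr (t, b)))" for t b
  define u where "u = M None"
  have cX: "mconv (\<lambda>n. X (r n) s a) (X' s a)" "dimle (Suc d) (X' s a)" if "s \<in> S" "a \<in> A" for s a
    using M[of "Some (Inl (s, a))"] that by (auto simp: J_def F_def X'_def)
  have cY: "mconv (\<lambda>n. Y (r n) t b) (Y' t b)" "dimle (Suc d) (Y' t b)" if "t \<in> T" "b \<in> B" for t b
    using M[of "Some (Inr (t, b))"] that by (auto simp: J_def F_def Y'_def)
  have cu: "mconv (\<lambda>n. \<psi> (r n)) u" "dimle (Suc d) u"
    using M[of None] by (auto simp: J_def F_def u_def)
  \<comment> \<open>The common size \<open>Suc d\<close> was chosen to accommodate the states;
    limits of POVM elements still have size d.\<close>
  have dlim: "dimle d N" if "mconv G N" "\<And>n. dimle d (G n)" for G N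
    unfolding dimle_def
  proof (intro allI impI, rule ccontr)
    fix i j assume "ent N i j \<noteq> 0" "\<not> (i < d \<and> j < d)"
    moreover have "(\<lambda>n. ent (G n) i j) = (\<lambda>n. 0)"
      using that(2) \<open>\<not> (i < d \<and> j < d)\<close> unfolding dimle_def by blast
    moreover have "(\<lambda>n. ent (G n) i j) \<longlonglongrightarrow> ent N i j" using that(1) by (simp add: mconv_def)
    ultimately show False by (simp add: LIMSEQ_const_iff)
  qed
  have dX': "dimle d (X' s a)" if "s \<in> S" "a \<in> A" for s a by (rule dlim[OF cX(1)]) (use that dX in auto)
  have dY': "dimle d (Y' t b)" if "t \<in> T" "b \<in> B" for t b by (rule dlim[OF cY(1)]) (use that dY in auto)
  have pX: "povm d A (X' s)" if s: "s \<in> S" for s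
    unfolding povm_def
  proof (intro conjI ballI)
    fix a assume a: "a \<in> A"
    show "dimle d (X' s a)" by (rule dX'[OF s a])
    show "psd (X' s a)"
      by (rule mconv_psd[OF cX(1)[OF s a] dX[OF s a] dX'[OF s a]]) (use X[OF s] a in \<open>simp add: povm_def\<close>)
  next
    have "mconv (\<lambda>n. \<Sum>a\<in>A. X (r n) s a) (\<Sum>a\<in>A. X' s a)" by (rule mconv_sum) (rule cX(1)[OF s])
    moreover have "(\<lambda>n. \<Sum>a\<in>A. X (r n) s a) = (\<lambda>n. idm d)" using X[OF s] by (simp add: povm_def)
    ultimately show "(\<Sum>a\<in>A. X' s a) = idm d" using mconv_unique[OF _ mconv_const[of "idm d"]] by simp
  qed
  have pY: "povm d B (Y' t)" if t: "t \<in> T" for t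
    unfolding povm_def
  proof (intro conjI ballI)
    fix b assume b: "b \<in> B"
    show "dimle d (Y' t b)" by (rule dY'[OF t b])
    show "psd (Y' t b)"
      by (rule mconv_psd[OF cY(1)[OF t b] dY[OF t b] dY'[OF t b]]) (use Y[OF t] b in \<open>simp add: povm_def\<close>)
  next
    have "mconv (\<lambda>n. \<Sum>b\<in>B. Y (r n) t b) (\<Sum>b\<in>B. Y' t b)" by (rule mconv_sum) (rule cY(1)[OF t])
    moreover have "(\<lambda>n. \<Sum>b\<in>B. Y (r n) t b) = (\<lambda>n. idm d)" using Y[OF t] by (simp add: povm_def)
    ultimately show "(\<Sum>b\<in>B. Y' t b) = idm d" using mconv_unique[OF _ mconv_const[of "idm d"]] by simp
  qed
  have "qc_model A B S T d X' Y' u P"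
    unfolding qc_model_def
  proof (intro conjI ballI)
    fix a b s t assume ab: "a \<in> A" "b \<in> B" "s \<in> S" "t \<in> T"
    have 1: "mconv (\<lambda>n. X (r n) s a * Y (r n) t b) (X' s a * Y' t b)"
      by (rule mconv_mult[OF cX(1)[OF ab(3,1)] cY(1)[OF ab(4,2)] dX[OF ab(3,1)] dX'[OF ab(3,1)]])
    have 2: "mconv (\<lambda>n. Y (r n) t b * X (r n) s a) (Y' t b * X' s a)"
      by (rule mconv_mult[OF cY(1)[OF ab(4,2)] cX(1)[OF ab(3,1)] dY[OF ab(4,2)] dY'[OF ab(4,2)]])
    have "(\<lambda>n. X (r n) s a * Y (r n) t b) = (\<lambda>n. Y (r n) t b * X (r n) s a)"
      using m ab by (simp add: qc_model_def)
    then show "X' s a * Y' t b = Y' t b * X' s a" using mconv_unique[OF 1] 2 by simp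
    have dd: "dimle (Suc d) (X (r n) s a * Y (r n) t b)" for n
      using ab by (intro dimle_mono[OF dimle_times[OF dX dY]]) auto
    have dd': "dimle (Suc d) (X' s a * Y' t b)"
      using ab by (intro dimle_mono[OF dimle_times[OF dX' dY']]) auto
    have "(\<lambda>n. Tr (adj (\<psi> (r n)) * (X (r n) s a * Y (r n) t b) * \<psi> (r n)))
      \<longlonglongrightarrow> Tr (adj u * (X' s a * Y' t b) * u)"
      by (rule mconv_Tr[of _ _ "Suc d"])
        (auto intro!: mconv_mult[where d = "Suc d"] mconv_adj cu 1 dimle_times d\<psi> dd dd')
    moreover have "(\<lambda>n. Tr (adj (\<psi> (r n)) * (X (r n) s a * Y (r n) t b) * \<psi> (r n)))
      = (\<lambda>n. complex_of_real (Q (r n) a b s t))"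
      using m ab by (simp add: qc_model_def)
    moreover have "(\<lambda>n. complex_of_real (Q (r n) a b s t)) \<longlonglongrightarrow> complex_of_real (P a b s t)"
      using LIMSEQ_subseq_LIMSEQ[OF lim[OF ab] r] by (intro tendsto_of_real) (simp add: o_def)
    ultimately show "complex_of_real (P a b s t) = Tr (adj u * (X' s a * Y' t b) * u)"
      by (metis LIMSEQ_unique)
  next
    have "mconv (\<lambda>n. idm d * \<psi> (r n)) (idm d * u)"
      by (rule mconv_mult[of _ _ _ _ d]) (auto intro: mconv_const cu)
    then show "idm d * u = u" using cu(1) \<psi>(1) mconv_unique by simp
    have "mconv (\<lambda>n. \<psi> (r n) * idm 1) (u * idm 1)"
      by (rule mconv_mult[of _ _ _ _ "Suc d"]) (auto intro: mconv_const cu d\<psi>)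
    then show "u * idm 1 = u" using cu(1) \<psi>(2) mconv_unique by simp
    have "(\<lambda>n. Tr (adj (\<psi> (r n)) * \<psi> (r n))) \<longlonglongrightarrow> Tr (adj u * u)"
      by (rule mconv_Tr[of _ _ "Suc d"])
        (auto intro!: mconv_mult[where d = "Suc d"] mconv_adj cu dimle_times d\<psi>)
    then show "Tr (adj u * u) = 1" using \<psi>(3) by (simp add: LIMSEQ_const_iff)
  qed (use pX pY in auto)
  moreover have "correlation A B S T P"
    unfolding correlation_def
  proof (intro conjI ballI)
    fix a b s t assume ab: "a \<in> A" "b \<in> B" "s \<in> S" "t \<in> T"
    show "0 \<le> P a b s t"
      by (rule LIMSEQ_le_const[OF lim[OF ab]]) (use cor ab in \<open>auto simp: correlation_def\<close>)
  next
    fix s t assume st: "s \<in> S" "t \<in> T"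
    have "(\<lambda>n. \<Sum>a\<in>A. \<Sum>b\<in>B. Q n a b s t) \<longlonglongrightarrow> (\<Sum>a\<in>A. \<Sum>b\<in>B. P a b s t)"
      using st by (intro tendsto_sum lim)
    moreover have "(\<lambda>n. \<Sum>a\<in>A. \<Sum>b\<in>B. Q n a b s t) = (\<lambda>n. 1)"
      using cor st by (auto simp: correlation_def)
    ultimately show "(\<Sum>a\<in>A. \<Sum>b\<in>B. P a b s t) = 1" by (simp add: LIMSEQ_const_iff)
  qed
  ultimately show ?thesis by (auto simp: C_qc_dim_iff)
qed

section \<open>Optimal decompositions\<close>

definition dec ::
  "'a set \<Rightarrow> 'b set \<Rightarrow> 's set \<Rightarrow> 't set \<Rightarrow> ('a \<Rightarrow> 'b \<Rightarrow> 's \<Rightarrow> 't \<Rightarrow> real) \<Rightarrow>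
    'i set \<Rightarrow> ('i \<Rightarrow> real) \<Rightarrow> ('i \<Rightarrow> 'a \<Rightarrow> 'b \<Rightarrow> 's \<Rightarrow> 't \<Rightarrow> real) \<Rightarrow> bool" where
  "dec A B S T P F l Q \<longleftrightarrow> finite F \<and> (\<forall>i\<in>F. 0 \<le> l i \<and> Q i \<in> C_q A B S T) \<and> (\<Sum>i\<in>F. l i) = 1 \<and>
     (\<forall>a\<in>A. \<forall>b\<in>B. \<forall>s\<in>S. \<forall>t\<in>T. P a b s t = (\<Sum>i\<in>F. l i * Q i a b s t))"

text \<open>Meant for elements of \<open>C_q\<close>, where \<open>C_q_D_qc\<close> shows that the
  dimension is finite.\<close>

definition Dnat ::
  "'a set \<Rightarrow> 'b set \<Rightarrow> 's set \<Rightarrow> 't set \<Rightarrow> ('a \<Rightarrow> 'b \<Rightarrow> 's \<Rightarrow> 't \<Rightarrow> real) \<Rightarrow> nat" where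
  "Dnat A B S T Q = the_enat (D_qc A B S T Q)"

definition cost ::
  "'a set \<Rightarrow> 'b set \<Rightarrow> 's set \<Rightarrow> 't set \<Rightarrow> 'i set \<Rightarrow> ('i \<Rightarrow> real) \<Rightarrow>
    ('i \<Rightarrow> 'a \<Rightarrow> 'b \<Rightarrow> 's \<Rightarrow> 't \<Rightarrow> real) \<Rightarrow> real" where
  "cost A B S T F l Q = (\<Sum>i\<in>F. l i * real (Dnat A B S T (Q i)))"

lemma D_qc_le: "Q \<in> C_qc_dim A B S T d \<Longrightarrow> D_qc A B S T Q \<le> d"
  unfolding D_qc_def by (rule Inf_lower) simp

lemma C_q_correlation: "Q \<in> C_q A B S T \<Longrightarrow> correlation A B S T Q"
  by (auto simp: C_q_def C_q_dim_def)

text \<open>A tensor model supplies one finite commuting dimension; the infimum over the resulting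
  nonempty set is finite and attained.\<close>

lemma C_q_D_qc:
  assumes "Q \<in> C_q A B S T"
  shows "D_qc A B S T Q = enat (Dnat A B S T Q)" "Q \<in> C_qc_dim A B S T (enat (Dnat A B S T Q))"
proof -
  obtain d where "Q \<in> C_q_dim A B S T d" using assms by (auto simp: C_q_def)
  then have d: "Q \<in> C_qc_dim A B S T (enat (d * d))"
    using C_q_dim_imp_qc_model C_q_correlation[OF assms] by (auto simp: C_qc_dim_iff)
  then have "D_qc A B S T Q = (LEAST d. Q \<in> C_qc_dim A B S T d)"
    unfolding D_qc_def Inf_enat_def by auto
  then have *: "Q \<in> C_qc_dim A B S T (D_qc A B S T Q)" using LeastI[of "\<lambda>d. Q \<in> C_qc_dim A B S T d", OF d] by simp
  have "D_qc A B S T Q \<noteq> \<infinity>" using D_qc_le[OF d] by (cases "D_qc A B S T Q") auto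
  then show "D_qc A B S T Q = enat (Dnat A B S T Q)" by (auto simp: Dnat_def)
  with * show "Q \<in> C_qc_dim A B S T (enat (Dnat A B S T Q))" by simp
qed

lemma Dnat_le: "Q \<in> C_qc_dim A B S T (enat d) \<Longrightarrow> Dnat A B S T Q \<le> d"
  using D_qc_le[of Q A B S T "enat d"] unfolding Dnat_def
  by (metis enat_ile enat_ord_simps(1) the_enat.simps)

lemma qc_model_0: "\<not> qc_model A B S T 0 X Y \<psi> P"
proof
  assume m: "qc_model A B S T 0 X Y \<psi> P"
  moreover have "idm 0 = 0" by (rule fmat_eqI) (simp add: ent_idm)
  ultimately have "\<psi> = 0" by (simp add: qc_model_def)
  then show False using m by (simp add: qc_model_def)
qed

text \<open>There is no unit vector in dimension 0. Bounds can therefore be divided by the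
  dimension.\<close>

lemma Dnat_pos: "Q \<in> C_q A B S T \<Longrightarrow> 0 < Dnat A B S T Q"
  using C_q_D_qc(2)[of Q A B S T] qc_model_0 by (metis C_qc_dim_iff gr0I)

lemma cost_ereal:
  assumes "\<And>i. i \<in> F \<Longrightarrow> Q i \<in> C_q A B S T"
  shows "(\<Sum>i\<in>F. ereal (l i) * ereal_of_enat (D_qc A B S T (Q i))) = ereal (cost A B S T F l Q)"
proof -
  have "(\<Sum>i\<in>F. ereal (l i) * ereal_of_enat (D_qc A B S T (Q i)))
      = (\<Sum>i\<in>F. ereal (l i * real (Dnat A B S T (Q i))))"
    by (rule sum.cong[OF refl]) (simp add: C_q_D_qc(1)[OF assms])
  then show ?thesis by (simp add: cost_def)
qed

lemma A_qc_eq: "A_qc A B S T P = Inf {ereal (cost A B S T {..<I} l Q) | I l Q. dec A B S T P {..<I::nat} l Q}"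
proof -
  have "{\<Sum>i<I. ereal (l i) * ereal_of_enat (D_qc A B S T (Q i)) | I l Q.
     (\<forall>i<I. 0 \<le> l i) \<and> (\<Sum>i<I. l i) = 1 \<and>
     (\<forall>a\<in>A. \<forall>b\<in>B. \<forall>s\<in>S. \<forall>t\<in>T. P a b s t = (\<Sum>i<(I::nat). l i * Q i a b s t)) \<and>
     (\<forall>i<I. Q i \<in> C_q A B S T)}
    = {\<Sum>i<I. ereal (l i) * ereal_of_enat (D_qc A B S T (Q i)) | I l Q. dec A B S T P {..<I::nat} l Q}"
    unfolding dec_def by (rule Collect_cong) (intro ex_cong1, auto)
  also have "\<dots> = {ereal (cost A B S T {..<I} l Q) | I l Q. dec A B S T P {..<I::nat} l Q}"
  proof -
    have "(\<Sum>i<I. ereal (l i) * ereal_of_enat (D_qc A B S T (Q i))) = ereal (cost A B S T {..<I} l Q)"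
      if "dec A B S T P {..<I::nat} l Q" for I l Q
      by (rule cost_ereal) (use that in \<open>simp add: dec_def\<close>)
    then show ?thesis by (intro Collect_cong ex_cong1 rev_conj_cong refl) simp
  qed
  finally show ?thesis unfolding A_qc_def by simp
qed

lemma dec_reindex:
  assumes "dec A B S T P F l Q" "bij_betw h G F"
  shows "dec A B S T P G (\<lambda>i. l (h i)) (\<lambda>i. Q (h i))"
    "cost A B S T G (\<lambda>i. l (h i)) (\<lambda>i. Q (h i)) = cost A B S T F l Q"
proof -
  have s: "(\<Sum>i\<in>G. f (h i)) = (\<Sum>i\<in>F. f i)" for f :: "_ \<Rightarrow> real"
    by (rule sum.reindex_bij_betw[OF assms(2)])
  have "finite G" using assms bij_betw_finite by (auto simp: dec_def)
  moreover have "h i \<in> F" if "i \<in> G" for i using assms(2) that by (auto simp: bij_betw_def)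
  ultimately show "dec A B S T P G (\<lambda>i. l (h i)) (\<lambda>i. Q (h i))"
    using assms(1) s[of l] s[of "\<lambda>i. l i * Q i _ _ _ _"] by (simp add: dec_def)
  show "cost A B S T G (\<lambda>i. l (h i)) (\<lambda>i. Q (h i)) = cost A B S T F l Q"
    unfolding cost_def by (rule s)
qed

lemma A_qc_le:
  assumes "dec A B S T P F l Q"
  shows "A_qc A B S T P \<le> ereal (cost A B S T F l Q)"
proof -
  obtain h where h: "bij_betw h {..<card F} F"
    using ex_bij_betw_nat_finite[of F] assms by (auto simp: dec_def lessThan_atLeast0)
  show ?thesis
    unfolding A_qc_eq dec_reindex(2)[OF assms h, symmetric]
    by (rule Inf_lower) (use dec_reindex(1)[OF assms h] in blast)
qed

text \<open>Caratheodory's theorem, moving along a linear dependence in the direction that does not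
  increase the cost.\<close>

lemma dec_reduce_step:
  assumes fin: "finite A" "finite B" "finite S" "finite T" and d: "dec A B S T P F l Q"
    and big: "card (A \<times> B \<times> S \<times> T) + 1 < card F"
  shows "\<exists>i l'. i \<in> F \<and> dec A B S T P (F - {i}) l' Q \<and> cost A B S T (F - {i}) l' Q \<le> cost A B S T F l Q"
proof -
  have F: "finite F" using d by (simp add: dec_def)
  \<comment> \<open>One equation for each entry of the correlation, and \<open>None\<close> for the
    sum of the weights; this is the origin of the summand 1 in the bound.\<close>
  define K where "K = insert None (Some ` (A \<times> B \<times> S \<times> T))"
  define g where "g k i = (case k of None \<Rightarrow> 1 | Some (a, b, s, t) \<Rightarrow> Q i a b s t)" for k i
  have "card K < card F" "finite K"
    using big fin by (auto simp: K_def card_insert_if card_image)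
  then obtain c0 where c0: "\<exists>i\<in>F. c0 i \<noteq> 0" "\<forall>k\<in>K. (\<Sum>i\<in>F. c0 i * g k i) = 0"
    using linear_dependence[of K F g] F by blast
  define D where "D i = real (Dnat A B S T (Q i))" for i
  \<comment> \<open>The weights will move by a negative multiple of c, so the sign of c is chosen to
    make its cost nonnegative.\<close>
  define c where "c = (if (\<Sum>i\<in>F. c0 i * D i) \<ge> 0 then c0 else (\<lambda>i. - c0 i))"
  have c1: "\<exists>i\<in>F. c i \<noteq> 0" using c0(1) by (auto simp: c_def)
  have c2: "(\<Sum>i\<in>F. c i * g k i) = 0" if "k \<in> K" for k
    using c0(2) that by (auto simp: c_def sum_negf)
  have c3: "0 \<le> (\<Sum>i\<in>F. c i * D i)" by (auto simp: c_def sum_negf)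
  have cs: "(\<Sum>i\<in>F. c i) = 0" using c2[of None] by (simp add: K_def g_def)
  have cQ: "(\<Sum>i\<in>F. c i * Q i a b s t) = 0" if "a \<in> A" "b \<in> B" "s \<in> S" "t \<in> T" for a b s t
    using c2[of "Some (a, b, s, t)"] that by (simp add: K_def g_def)
  define Z where "Z = {i \<in> F. 0 < c i}"
  \<comment> \<open>The coefficients sum to 0 without all vanishing, so one of them is
    positive.\<close>
  have "Z \<noteq> {}"
  proof
    assume "Z = {}"
    then have "\<forall>i\<in>F. 0 \<le> - c i" by (auto simp: Z_def not_less)
    moreover have "(\<Sum>i\<in>F. - c i) = 0" using cs by (simp add: sum_negf)
    ultimately have "\<forall>i\<in>F. - c i = 0" using sum_nonneg_eq_0_iff[OF F, of "\<lambda>i. - c i"] by simp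
    then show False using c1 by auto
  qed
  moreover have "finite Z" using F by (simp add: Z_def)
  \<comment> \<open>The ratio test: moving along -c, the weight of i is the first to reach 0, so the
    other weights stay nonnegative.\<close>
  ultimately obtain i where i: "i \<in> Z" "\<And>j. j \<in> Z \<Longrightarrow> l i / c i \<le> l j / c j"
    using ex_min_if_finite[of "(\<lambda>j. l j / c j) ` Z"] by (auto simp: not_less)
  define r where "r = l i / c i"
  have iF: "i \<in> F" and ci: "0 < c i" using i by (auto simp: Z_def)
  have l0: "0 \<le> l j" if "j \<in> F" for j using d that by (simp add: dec_def)
  have r0: "0 \<le> r" using l0[OF iF] ci by (simp add: r_def)
  define l' where "l' j = l j - r * c j" for j
  have l'0: "0 \<le> l' j" if "j \<in> F" for j
  proof (cases "0 < c j")
    case True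
    then have "r \<le> l j / c j" using i(2)[of j] that by (simp add: Z_def r_def)
    then show ?thesis using True by (simp add: l'_def pos_le_divide_eq)
  next
    case False
    then have "r * c j \<le> 0" using r0 by (simp add: mult_nonneg_nonpos)
    then show ?thesis using l0[OF that] by (simp add: l'_def)
  qed
  have l'i: "l' i = 0" using ci by (simp add: l'_def r_def)
  have s: "(\<Sum>j\<in>F - {i}. l' j * f j) = (\<Sum>j\<in>F. l j * f j) - r * (\<Sum>j\<in>F. c j * f j)" for f :: "_ \<Rightarrow> real"
  proof -
    have "(\<Sum>j\<in>F. l' j * f j) = l' i * f i + (\<Sum>j\<in>F - {i}. l' j * f j)"
      by (rule sum.remove[OF F iF])
    moreover have "(\<Sum>j\<in>F. l' j * f j) = (\<Sum>j\<in>F. l j * f j) - r * (\<Sum>j\<in>F. c j * f j)"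
      by (simp add: l'_def left_diff_distrib sum_subtractf sum_distrib_left mult.assoc)
    ultimately show ?thesis using l'i by simp
  qed
  have "dec A B S T P (F - {i}) l' Q"
    using d l'0 s[of "\<lambda>_. 1"] s[of "\<lambda>i. Q i _ _ _ _"] cs cQ by (simp add: dec_def)
  moreover have "cost A B S T (F - {i}) l' Q \<le> cost A B S T F l Q"
    using s[of D] c3 r0 by (simp add: cost_def D_def[symmetric])
  ultimately show ?thesis using iF by blast
qed

lemma dec_reduce:
  assumes fin: "finite A" "finite B" "finite S" "finite T" and "dec A B S T P F l Q"
  shows "\<exists>G l'. G \<subseteq> F \<and> card G \<le> card (A \<times> B \<times> S \<times> T) + 1 \<and> dec A B S T P G l' Q \<and>
    cost A B S T G l' Q \<le> cost A B S T F l Q"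
  using assms(5)
proof (induction "card F" arbitrary: F l rule: less_induct)
  case less
  show ?case
  proof (cases "card F \<le> card (A \<times> B \<times> S \<times> T) + 1")
    case True
    with less.prems show ?thesis by blast
  next
    case False
    then obtain i l' where i: "i \<in> F" "dec A B S T P (F - {i}) l' Q"
      "cost A B S T (F - {i}) l' Q \<le> cost A B S T F l Q"
      using dec_reduce_step[OF fin less.prems] by auto
    have "card (F - {i}) < card F"
      using i(1) less.prems by (intro psubset_card_mono) (auto simp: dec_def)
    from less.hyps[OF this i(2)] obtain G m where "G \<subseteq> F - {i}" "card G \<le> card (A \<times> B \<times> S \<times> T) + 1"
      "dec A B S T P G m Q" "cost A B S T G m Q \<le> cost A B S T (F - {i}) l' Q" by blast
    with i(3) show ?thesis by (intro exI[of _ G] exI[of _ m]) auto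
  qed
qed

text \<open>Copies of P with weight 0 fill the decomposition up to a fixed length. Every member of a
  minimising sequence is then indexed by the same finite set.\<close>

lemma dec_bounded_size:
  assumes fin: "finite A" "finite B" "finite S" "finite T" and d: "dec A B S T P F l Q"
    and P: "P \<in> C_q A B S T"
  shows "\<exists>m R. dec A B S T P {..<card (A \<times> B \<times> S \<times> T) + 1} m R \<and>
    cost A B S T {..<card (A \<times> B \<times> S \<times> T) + 1} m R \<le> cost A B S T F l Q"
proof -
  let ?N = "card (A \<times> B \<times> S \<times> T) + 1"
  obtain G l' where G: "card G \<le> ?N" "dec A B S T P G l' Q" "cost A B S T G l' Q \<le> cost A B S T F l Q"
    using dec_reduce[OF fin d] by blast
  obtain h where h: "bij_betw h {..<card G} G"
    using ex_bij_betw_nat_finite[of G] G(2) by (auto simp: dec_def lessThan_atLeast0)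
  note d' = dec_reindex[OF G(2) h]
  define m where "m i = (if i < card G then l' (h i) else 0)" for i
  define R where "R i = (if i < card G then Q (h i) else P)" for i
  have s: "(\<Sum>i<?N. m i * f (R i)) = (\<Sum>i<card G. l' (h i) * f (Q (h i)))" for f :: "_ \<Rightarrow> real"
  proof -
    have "(\<Sum>i<?N. m i * f (R i)) = (\<Sum>i<card G. m i * f (R i))"
      by (rule sum.mono_neutral_right) (use G(1) in \<open>auto simp: m_def\<close>)
    then show ?thesis by (simp add: m_def R_def)
  qed
  have "dec A B S T P {..<?N} m R"
    using d'(1) P s[of "\<lambda>_. 1"] s[of "\<lambda>Q. Q _ _ _ _"] unfolding dec_def by (auto simp: m_def R_def)
  moreover have "cost A B S T {..<?N} m R \<le> cost A B S T F l Q"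
    using s[of "\<lambda>Q. real (Dnat A B S T Q)"] d'(2) G(3) by (simp add: cost_def)
  ultimately show ?thesis by blast
qed

lemma correlation_nonneg:
  "correlation A B S T Q \<Longrightarrow> a \<in> A \<Longrightarrow> b \<in> B \<Longrightarrow> s \<in> S \<Longrightarrow> t \<in> T \<Longrightarrow> 0 \<le> Q a b s t"
  by (simp add: correlation_def)

lemma correlation_le_1:
  assumes "correlation A B S T Q" "finite A" "finite B" "a \<in> A" "b \<in> B" "s \<in> S" "t \<in> T"
  shows "Q a b s t \<le> 1"
proof -
  have "Q a b s t \<le> (\<Sum>b\<in>B. Q a b s t)"
    using assms by (intro member_le_sum) (auto simp: correlation_def)
  also have "\<dots> \<le> (\<Sum>a\<in>A. \<Sum>b\<in>B. Q a b s t)"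
    using assms by (intro member_le_sum[of a A "\<lambda>a. \<Sum>b\<in>B. Q a b s t"])
      (auto simp: correlation_def intro!: sum_nonneg)
  also have "\<dots> = 1" using assms by (simp add: correlation_def)
  finally show ?thesis .
qed

text \<open>A nonzero limit of the reciprocals makes D itself converge, and a Cauchy sequence of
  integers is eventually constant.\<close>

lemma nat_reciprocal_limit:
  fixes D :: "nat \<Rightarrow> nat"
  assumes "(\<lambda>n. 1 / real (D n)) \<longlonglongrightarrow> k" "k \<noteq> 0"
  shows "\<exists>N d. \<forall>n\<ge>N. D n = d"
proof -
  have "(\<lambda>n. real (D n)) \<longlonglongrightarrow> 1 / k"
    using tendsto_divide[OF tendsto_const[of 1] assms] by simp
  then have "Cauchy (\<lambda>n. real (D n))" by (intro convergent_Cauchy) (auto simp: convergent_def)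
  then obtain N where N: "\<forall>m\<ge>N. \<forall>n\<ge>N. norm (real (D m) - real (D n)) < 1"
    using CauchyD[of "\<lambda>n. real (D n)" 1] by auto
  have "D n = D N" if "n \<ge> N" for n
    using N[rule_format, OF that order_refl] by (simp add: abs_less_iff)
  then show ?thesis by blast
qed

text \<open>Along a minimising sequence a term either keeps a constant dimension, so that its limit is
  again admissible, or its dimension is unbounded, and then its weight tends to 0.\<close>

theorem A_qc_attained:
  fixes A :: "'a set" and B :: "'b set" and S :: "'s set" and T :: "'t set"
  assumes fin: "finite A" "finite B" "finite S" "finite T" and P: "P \<in> C_q A B S T"
  obtains I l Q where "dec A B S T P {..<I::nat} l Q" "A_qc A B S T P = ereal (cost A B S T {..<I} l Q)"
proof -
  let ?N = "card (A \<times> B \<times> S \<times> T) + 1"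
  let ?D = "Dnat A B S T"
  define V where "V = {cost A B S T {..<I} l Q | I l Q. dec A B S T P {..<I::nat} l Q}"
  define v where "v = Inf V"
  have dP: "dec A B S T P {..<1::nat} (\<lambda>_. 1) (\<lambda>_. P)" using P by (simp add: dec_def)
  have "cost A B S T {..<1::nat} (\<lambda>_. 1) (\<lambda>_. P) \<in> V" unfolding V_def using dP by blast
  then have Vne: "V \<noteq> {}" by blast
  have "0 \<le> x" if "x \<in> V" for x
    using that by (auto simp: V_def cost_def dec_def intro!: sum_nonneg)
  then have Vb: "bdd_below V" by (rule bdd_belowI)
  have "\<exists>l Q. dec A B S T P {..<?N} l Q \<and> cost A B S T {..<?N} l Q \<le> v + 1 / Suc n" for n
  proof -
    have "v < v + 1 / Suc n" by simp
    then obtain x where "x \<in> V" "x < v + 1 / Suc n"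
      unfolding v_def using cInf_lessD[OF Vne] by blast
    then obtain I l Q where d: "dec A B S T P {..<I::nat} l Q" "cost A B S T {..<I} l Q < v + 1 / Suc n"
      by (auto simp: V_def)
    then show ?thesis using dec_bounded_size[OF fin d(1) P] by force
  qed
  then obtain l Q where d: "\<And>n. dec A B S T P {..<?N} (l n) (Q n)"
    and c: "\<And>n. cost A B S T {..<?N} (l n) (Q n) \<le> v + 1 / Suc n" by metis
  have l0: "0 \<le> l n i" and Qq: "Q n i \<in> C_q A B S T" if "i < ?N" for n i
    using d[of n] that by (auto simp: dec_def)
  have l1: "l n i \<le> 1" if "i < ?N" for n i
  proof -
    have "l n i \<le> (\<Sum>i<?N. l n i)" by (rule member_le_sum) (use that l0 in auto)
    then show ?thesis using d[of n] by (simp add: dec_def)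
  qed
  have D1: "1 \<le> real (?D (Q n i))" if "i < ?N" for n i
    using Dnat_pos[OF Qq[OF that]] by (metis One_nat_def Suc_leI of_nat_1 of_nat_le_iff)
  \<comment> \<open>For each term, \<open>Inl True\<close> marks the weight,
    \<open>Inl False\<close> the reciprocal of the dimension, and \<open>Inr\<close> the entries.
    All three kinds are bounded by 1, even where the dimension itself is unbounded.\<close>
  define J :: "(nat \<times> (bool + 'a \<times> 'b \<times> 's \<times> 't)) set"
    where "J = {..<?N} \<times> (UNIV <+> (A \<times> B \<times> S \<times> T))"
  define f where "f n j = complex_of_real (case snd j of
      Inl p \<Rightarrow> (if p then l n (fst j) else 1 / real (?D (Q n (fst j))))
    | Inr (a, b, s, t) \<Rightarrow> Q n (fst j) a b s t)" for n j
  have FJ: "finite J" using fin by (simp add: J_def)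
  have bnd: "\<exists>K. \<forall>n. cmod (f n j) \<le> K" if "j \<in> J" for j
  proof (intro exI allI)
    fix n
    have "\<bar>l n i\<bar> \<le> 1" "\<bar>1 / real (?D (Q n i))\<bar> \<le> 1" if "i < ?N" for i
      using l0[OF that, of n] l1[OF that, of n] D1[OF that, of n] by (simp_all add: divide_le_eq)
    moreover have "\<bar>Q n i a b s t\<bar> \<le> 1" if "i < ?N" "a \<in> A" "b \<in> B" "s \<in> S" "t \<in> T" for i a b s t
      using correlation_le_1[OF C_q_correlation[OF Qq[OF that(1)]] fin(1,2) that(2-5), of n]
        correlation_nonneg[OF C_q_correlation[OF Qq[OF that(1)]] that(2-5), of n] by simp
    ultimately show "cmod (f n j) \<le> 1"
      using that by (cases j) (auto simp: J_def f_def)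
  qed
  have "\<exists>r L. strict_mono r \<and> (\<forall>j\<in>J. (\<lambda>n. f (r n) j) \<longlonglongrightarrow> L j)"
    by (rule bounded_family_subseq[OF FJ]) (rule bnd)
  then obtain r L where r: "strict_mono r" and L: "\<And>j. j \<in> J \<Longrightarrow> (\<lambda>n. f (r n) j) \<longlonglongrightarrow> L j"
    by (elim exE conjE) (rule that, auto)
  have Lr: "(\<lambda>n. Re (f (r n) j)) \<longlonglongrightarrow> Re (L j)" if "j \<in> J" for j
    by (rule tendsto_Re[OF L[OF that]])
  define la where "la i = Re (L (i, Inl True))" for i
  define ka where "ka i = Re (L (i, Inl False))" for i
  define q where "q i a b s t = Re (L (i, Inr (a, b, s, t)))" for i a b s t
  have la: "(\<lambda>n. l (r n) i) \<longlonglongrightarrow> la i" if "i < ?N" for i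
    using Lr[of "(i, Inl True)"] that by (auto simp: J_def f_def la_def)
  have ka: "(\<lambda>n. 1 / real (?D (Q (r n) i))) \<longlonglongrightarrow> ka i" if "i < ?N" for i
    using Lr[of "(i, Inl False)"] that by (auto simp: J_def f_def ka_def)
  have q: "(\<lambda>n. Q (r n) i a b s t) \<longlonglongrightarrow> q i a b s t"
    if "i < ?N" "a \<in> A" "b \<in> B" "s \<in> S" "t \<in> T" for i a b s t
    using Lr[of "(i, Inr (a, b, s, t))"] that by (auto simp: J_def f_def q_def)
  have la0: "0 \<le> la i" if "i < ?N" for i
    by (rule LIMSEQ_le_const[OF la[OF that]]) (use l0 that in auto)
  have cterm: "l n i * real (?D (Q n i)) \<le> v + 1" if "i < ?N" for n i
  proof -
    have "l n i * real (?D (Q n i)) \<le> cost A B S T {..<?N} (l n) (Q n)"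
      unfolding cost_def by (rule member_le_sum) (use that l0 in auto)
    also have "\<dots> \<le> v + 1 / Suc n" by (rule c)
    also have "\<dots> \<le> v + 1" by simp
    finally show ?thesis .
  qed
  \<comment> \<open>Each single term costs at most v + 1, so its weight is at most (v + 1) times the
    reciprocal dimension and tends to 0 with it.\<close>
  have bad: "la i = 0" if i: "i < ?N" "ka i = 0" for i
  proof -
    have "l (r n) i \<le> (v + 1) * (1 / real (?D (Q (r n) i)))" for n
      using cterm[OF i(1), of "r n"] D1[OF i(1), of "r n"] by (simp add: pos_le_divide_eq)
    moreover have "(\<lambda>n. (v + 1) * (1 / real (?D (Q (r n) i)))) \<longlonglongrightarrow> (v + 1) * ka i"
      by (intro tendsto_mult tendsto_const ka[OF i(1)])
    ultimately have "la i \<le> (v + 1) * ka i"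
      using la[OF i(1)] by (intro LIMSEQ_le) auto
    then show ?thesis using la0[OF i(1)] i(2) by simp
  qed
  have "\<exists>n0 dd. (\<forall>n\<ge>n0. ?D (Q (r n) i) = dd) \<and> q i \<in> C_qc_dim A B S T (enat dd)"
    if i: "i < ?N" "ka i \<noteq> 0" for i
  proof -
    obtain n0 dd where n0: "\<forall>n\<ge>n0. ?D (Q (r n) i) = dd"
      using nat_reciprocal_limit[OF ka[OF i(1)] i(2)] by blast
    have "q i \<in> C_qc_dim A B S T (enat dd)"
    proof (rule C_qc_dim_closed[OF fin])
      fix n
      have "?D (Q (r (n + n0)) i) = dd" using n0 by simp
      then show "Q (r (n + n0)) i \<in> C_qc_dim A B S T (enat dd)"
        using C_q_D_qc(2)[OF Qq[OF i(1)], of "r (n + n0)"] by simp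
    next
      fix a b s t assume "a \<in> A" "b \<in> B" "s \<in> S" "t \<in> T"
      then show "(\<lambda>n. Q (r (n + n0)) i a b s t) \<longlonglongrightarrow> q i a b s t"
        using q[OF i(1)] by (intro LIMSEQ_ignore_initial_segment)
    qed
    with n0 show ?thesis by blast
  qed
  then obtain n0 dd where n0: "\<And>i n. i < ?N \<Longrightarrow> ka i \<noteq> 0 \<Longrightarrow> n \<ge> n0 i \<Longrightarrow> ?D (Q (r n) i) = dd i"
    and qd: "\<And>i. i < ?N \<Longrightarrow> ka i \<noteq> 0 \<Longrightarrow> q i \<in> C_qc_dim A B S T (enat (dd i))"
    by metis
  \<comment> \<open>Where the dimension escapes to infinity, the limit correlation is not known to
    lie in \<open>C_q\<close>. Its weight is 0, so P can take its place.\<close>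
  define R where "R i = (if ka i = 0 then P else q i)" for i
  have Rq: "R i \<in> C_q A B S T" if "i < ?N" for i
    using qd[OF that] qc_model_imp_C_q P by (auto simp: R_def C_qc_dim_iff)
  have decR: "dec A B S T P {..<?N} la R"
    unfolding dec_def
  proof (intro conjI ballI)
    have "(\<lambda>n. \<Sum>i<?N. l (r n) i) \<longlonglongrightarrow> (\<Sum>i<?N. la i)"
      by (intro tendsto_sum la) simp
    moreover have "(\<lambda>n. \<Sum>i<?N. l (r n) i) = (\<lambda>n. 1)" using d by (simp add: dec_def)
    ultimately show "(\<Sum>i<?N. la i) = 1" by (simp add: LIMSEQ_const_iff)
    fix a b s t assume ab: "a \<in> A" "b \<in> B" "s \<in> S" "t \<in> T"
    have "(\<lambda>n. \<Sum>i<?N. l (r n) i * Q (r n) i a b s t) \<longlonglongrightarrow> (\<Sum>i<?N. la i * q i a b s t)"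
      using ab by (intro tendsto_sum tendsto_mult la q) simp_all
    moreover have "(\<lambda>n. \<Sum>i<?N. l (r n) i * Q (r n) i a b s t) = (\<lambda>n. P a b s t)"
      using d ab by (simp add: dec_def)
    ultimately have "P a b s t = (\<Sum>i<?N. la i * q i a b s t)" by (simp add: LIMSEQ_const_iff)
    also have "\<dots> = (\<Sum>i<?N. la i * R i a b s t)"
      by (rule sum.cong) (use bad in \<open>auto simp: R_def\<close>)
    finally show "P a b s t = (\<Sum>i<?N. la i * R i a b s t)" .
  qed (use la0 Rq in auto)
  have "cost A B S T {..<?N} la R \<le> (\<Sum>i<?N. if ka i = 0 then 0 else la i * real (dd i))"
    unfolding cost_def
    by (rule sum_mono) (use bad la0 Dnat_le[OF qd] in \<open>auto simp: R_def intro!: mult_left_mono\<close>)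
  \<comment> \<open>From some n on the retained terms have their final dimensions
    \<open>dd i\<close>, so they cost no more than the whole n-th decomposition. Passing to the
    limit in n gives the bound v.\<close>
  also have "\<dots> \<le> v"
  proof (rule LIMSEQ_le)
    show "(\<lambda>n. \<Sum>i<?N. if ka i = 0 then 0 else l (r n) i * real (dd i))
        \<longlonglongrightarrow> (\<Sum>i<?N. if ka i = 0 then 0 else la i * real (dd i))"
      by (intro tendsto_sum) (use la in \<open>auto intro!: tendsto_intros\<close>)
    show "(\<lambda>n. v + 1 / Suc (r n)) \<longlonglongrightarrow> v"
      using tendsto_add[OF tendsto_const[of v] LIMSEQ_subseq_LIMSEQ[OF LIMSEQ_inverse_real_of_nat r]]
      by (simp add: o_def inverse_eq_divide)
    show "\<exists>N. \<forall>n\<ge>N. (\<Sum>i<?N. if ka i = 0 then 0 else l (r n) i * real (dd i)) \<le> v + 1 / Suc (r n)"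
    proof (intro exI allI impI)
      fix n assume n: "n \<ge> Max (n0 ` {..<?N})"
      then have n': "n0 i \<le> n" if "i < ?N" for i
        using that by (meson Max_ge finite_imageI finite_lessThan imageI lessThan_iff order_trans)
      have "(\<Sum>i<?N. if ka i = 0 then 0 else l (r n) i * real (dd i)) \<le> cost A B S T {..<?N} (l (r n)) (Q (r n))"
        unfolding cost_def by (rule sum_mono) (use n' n0 l0 in auto)
      also have "\<dots> \<le> v + 1 / Suc (r n)" by (rule c)
      finally show "(\<Sum>i<?N. if ka i = 0 then 0 else l (r n) i * real (dd i)) \<le> v + 1 / Suc (r n)" .
    qed
  qed
  finally have le: "cost A B S T {..<?N} la R \<le> v" .
  show thesis
  proof (rule that[OF decR])
    have "ereal (cost A B S T {..<?N} la R) \<le> A_qc A B S T P"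
      unfolding A_qc_eq
    proof (rule Inf_greatest)
      fix x assume "x \<in> {ereal (cost A B S T {..<I} l Q) | I l Q. dec A B S T P {..<I::nat} l Q}"
      then obtain y where y: "x = ereal y" "y \<in> V" by (auto simp: V_def)
      then have "v \<le> y" unfolding v_def using Vb by (intro cInf_lower)
      then show "ereal (cost A B S T {..<?N} la R) \<le> x" using le y by simp
    qed
    then show "A_qc A B S T P = ereal (cost A B S T {..<?N} la R)"
      using A_qc_le[OF decR] by (intro antisym)
  qed
qed

section \<open>Functionals given by their values on words\<close>

definition extend :: "(('a, 'b, 's, 't) symb list \<Rightarrow> real) \<Rightarrow> ('a, 'b, 's, 't) ncpoly \<Rightarrow> real" where
  "extend \<phi> p = (\<Sum>w\<in>Poly_Mapping.keys p. Poly_Mapping.lookup p w * \<phi> w)"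

lemma extend_superset:
  assumes "finite F" "Poly_Mapping.keys p \<subseteq> F"
  shows "extend \<phi> p = (\<Sum>w\<in>F. Poly_Mapping.lookup p w * \<phi> w)"
  unfolding extend_def by (rule sum.mono_neutral_left) (use assms in \<open>auto simp: in_keys_iff\<close>)

lemma extend_add [simp]: "extend \<phi> (p + q) = extend \<phi> p + extend \<phi> q"
proof -
  let ?F = "Poly_Mapping.keys p \<union> Poly_Mapping.keys q"
  have "extend \<phi> (p + q) = (\<Sum>w\<in>?F. Poly_Mapping.lookup (p + q) w * \<phi> w)"
    by (rule extend_superset) (auto simp: keys_add)
  also have "\<dots> = (\<Sum>w\<in>?F. Poly_Mapping.lookup p w * \<phi> w) + (\<Sum>w\<in>?F. Poly_Mapping.lookup q w * \<phi> w)"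
    by (simp add: lookup_add distrib_right sum.distrib)
  also have "\<dots> = extend \<phi> p + extend \<phi> q"
    by (subst (1 2) extend_superset[of ?F]) auto
  finally show ?thesis .
qed

lemma extend_zero [simp]: "extend \<phi> 0 = 0" by (simp add: extend_def)

lemma extend_uminus [simp]: "extend \<phi> (- p) = - extend \<phi> p"
  using extend_add[of \<phi> p "- p"] by simp

lemma extend_diff [simp]: "extend \<phi> (p - q) = extend \<phi> p - extend \<phi> q"
  using extend_add[of \<phi> p "- q"] by simp

lemma extend_sum [simp]: "extend \<phi> (\<Sum>i\<in>I. f i) = (\<Sum>i\<in>I. extend \<phi> (f i))"
  by (induction I rule: infinite_finite_induct) auto

lemma extend_single [simp]: "extend \<phi> (Poly_Mapping.single w c) = c * \<phi> w"
  by (subst extend_superset[of "{w}"]) auto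

lemma extend_mon [simp]: "extend \<phi> (mon w) = \<phi> w"
  by (simp add: mon_def)

lemma lookup_scale [simp]: "Poly_Mapping.lookup (scale c p) w = c * Poly_Mapping.lookup p w"
  unfolding scale_def by transfer (simp add: when_def)

lemma extend_scale [simp]: "extend \<phi> (scale c p) = c * extend \<phi> p"
proof -
  have "extend \<phi> (scale c p) = (\<Sum>w\<in>Poly_Mapping.keys p. Poly_Mapping.lookup (scale c p) w * \<phi> w)"
    by (rule extend_superset) (auto simp: in_keys_iff)
  then show ?thesis by (simp add: extend_def sum_distrib_left mult.assoc)
qed

lemma ncpoly_sum_single: "(p::('a, 'b, 's, 't) ncpoly) = (\<Sum>w\<in>Poly_Mapping.keys p. Poly_Mapping.single w (Poly_Mapping.lookup p w))"
proof (rule poly_mapping_eqI)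
  fix v
  have "Poly_Mapping.lookup (\<Sum>w\<in>Poly_Mapping.keys p. Poly_Mapping.single w (Poly_Mapping.lookup p w)) v
      = (\<Sum>w\<in>Poly_Mapping.keys p. if w = v then Poly_Mapping.lookup p v else 0)"
    unfolding lookup_sum by (rule sum.cong) (auto simp: lookup_single when_def)
  then show "Poly_Mapping.lookup p v = Poly_Mapping.lookup (\<Sum>w\<in>Poly_Mapping.keys p. Poly_Mapping.single w (Poly_Mapping.lookup p w)) v"
    by (auto simp: in_keys_iff)
qed

lemma single_times_single:
  "Poly_Mapping.single u (a::real) * Poly_Mapping.single v b = Poly_Mapping.single (u @ v :: ('a, 'b, 's, 't) symb list) (a * b)"
  by (simp add: mult_single plus_list_def)

lemma mon_mult: "mon u * mon v = mon (u @ v)"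
  by (simp add: mon_def single_times_single)

lemma one_mon: "1 = mon []"
  by (metis mon_def single_one zero_list_def)

lemma star_single: "star (Poly_Mapping.single w c) = Poly_Mapping.single (rev w) c"
proof -
  have "inj (rev :: ('a, 'b, 'c, 'd) symb list \<Rightarrow> _)" by (rule inj_on_rev)
  from map_key_single[OF this, of "rev w" c] show ?thesis by (simp add: star_def)
qed

lemma star_mon: "star (mon w) = mon (rev w)" by (simp add: mon_def star_single)

lemma star_add: "star (p + q) = star p + star q"
  unfolding star_def by (rule map_key_plus[OF inj_on_rev])

lemma star_zero: "star 0 = 0"
  unfolding star_def by (rule map_key_zero[OF inj_on_rev])

lemma star_sum: "star (\<Sum>i\<in>I. f i) = (\<Sum>i\<in>I. star (f i))"
  by (induction I rule: infinite_finite_induct) (auto simp: star_add star_zero)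

lemma extend_quadratic:
  "extend \<phi> (star (\<Sum>u\<in>U. Poly_Mapping.single u (c u)) * mon g * (\<Sum>v\<in>V. Poly_Mapping.single v (d v)))
    = (\<Sum>u\<in>U. \<Sum>v\<in>V. c u * d v * \<phi> (rev u @ g @ v))"
  by (simp add: star_sum star_single mon_def sum_distrib_left sum_distrib_right single_times_single
      sum.swap[of _ V U])

section \<open>Words and polynomials in the given letters\<close>

lemma nc_words_append [simp]: "u @ v \<in> nc_words A B S T \<longleftrightarrow> u \<in> nc_words A B S T \<and> v \<in> nc_words A B S T"
  by (auto simp: nc_words_def)

lemma nc_words_rev [simp]: "rev u \<in> nc_words A B S T \<longleftrightarrow> u \<in> nc_words A B S T"
  by (simp add: nc_words_def in_lists_conv_set)

lemma nc_words_Nil [simp]: "[] \<in> nc_words A B S T"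
  by (simp add: nc_words_def)

lemma nc_words_Cons: "x # u \<in> nc_words A B S T \<longleftrightarrow>
    (case x of SymX a s \<Rightarrow> a \<in> A \<and> s \<in> S | SymY b t \<Rightarrow> b \<in> B \<and> t \<in> T | SymZ \<Rightarrow> True) \<and> u \<in> nc_words A B S T"
  by (cases x) (auto simp: nc_words_def)

lemma ncpolys_mon: "mon w \<in> ncpolys A B S T \<longleftrightarrow> w \<in> nc_words A B S T"
  by (simp add: ncpolys_def mon_def)

lemma ncpolys_single: "w \<in> nc_words A B S T \<Longrightarrow> Poly_Mapping.single w c \<in> ncpolys A B S T"
  by (simp add: ncpolys_def)

lemma ncpolys_zero: "0 \<in> ncpolys A B S T" by (simp add: ncpolys_def)

lemma ncpolys_add: "p \<in> ncpolys A B S T \<Longrightarrow> q \<in> ncpolys A B S T \<Longrightarrow> p + q \<in> ncpolys A B S T"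
  using keys_add[of p q] by (auto simp: ncpolys_def)

lemma ncpolys_sum: "(\<And>i. i \<in> I \<Longrightarrow> f i \<in> ncpolys A B S T) \<Longrightarrow> sum f I \<in> ncpolys A B S T"
  by (induction I rule: infinite_finite_induct) (auto intro: ncpolys_add ncpolys_zero)

lemma ncpolys_uminus: "p \<in> ncpolys A B S T \<Longrightarrow> - p \<in> ncpolys A B S T"
  by (auto simp: ncpolys_def in_keys_iff)

lemma ncpolys_diff: "p \<in> ncpolys A B S T \<Longrightarrow> q \<in> ncpolys A B S T \<Longrightarrow> p - q \<in> ncpolys A B S T"
  using ncpolys_add[OF _ ncpolys_uminus, of p A B S T q] by simp

lemma ncpolys_mult: "p \<in> ncpolys A B S T \<Longrightarrow> q \<in> ncpolys A B S T \<Longrightarrow> p * q \<in> ncpolys A B S T"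
  using keys_mult[of p q] by (force simp: ncpolys_def plus_list_def)

lemma ncpolys_star: "p \<in> ncpolys A B S T \<Longrightarrow> star p \<in> ncpolys A B S T"
proof -
  assume p: "p \<in> ncpolys A B S T"
  have "star p = (\<Sum>w\<in>Poly_Mapping.keys p. Poly_Mapping.single (rev w) (Poly_Mapping.lookup p w))"
    using arg_cong[OF ncpoly_sum_single[of p], of star] by (simp only: star_sum star_single)
  moreover have "w \<in> nc_words A B S T" if "w \<in> Poly_Mapping.keys p" for w
    using p that by (auto simp: ncpolys_def)
  ultimately show ?thesis by (simp add: ncpolys_sum ncpolys_single)
qed

lemma linear_functional_extend:
  assumes L: "linear_functional A B S T L" and p: "p \<in> ncpolys A B S T"
  shows "L p = extend (\<lambda>w. L (mon w)) p"
proof -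
  have add: "L (p + q) = L p + L q" if "p \<in> ncpolys A B S T" "q \<in> ncpolys A B S T" for p q
    using L that by (simp add: linear_functional_def)
  have sc: "L (scale c p) = c * L p" if "p \<in> ncpolys A B S T" for p c
    using L that by (simp add: linear_functional_def)
  have L0: "L 0 = 0" using add[OF ncpolys_zero ncpolys_zero] by simp
  have single: "Poly_Mapping.single w c = scale c (mon w)" for w :: "('a, 'b, 'c, 'd) symb list" and c
    by (rule poly_mapping_eqI) (simp add: mon_def lookup_single when_def)
  have s: "L (\<Sum>i\<in>I. f i) = (\<Sum>i\<in>I. L (f i))" if "\<And>i. i \<in> I \<Longrightarrow> f i \<in> ncpolys A B S T"
    for I :: "('a, 'b, 'c, 'd) symb list set" and f
    using that by (induction I rule: infinite_finite_induct) (auto simp: L0 add ncpolys_sum)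
  have k: "w \<in> nc_words A B S T" if "w \<in> Poly_Mapping.keys p" for w
    using p that by (auto simp: ncpolys_def)
  have "L p = L (\<Sum>w\<in>Poly_Mapping.keys p. Poly_Mapping.single w (Poly_Mapping.lookup p w))"
    using ncpoly_sum_single[of p] by simp
  also have "\<dots> = (\<Sum>w\<in>Poly_Mapping.keys p. L (Poly_Mapping.single w (Poly_Mapping.lookup p w)))"
    by (rule s) (auto intro!: ncpolys_single k)
  also have "\<dots> = (\<Sum>w\<in>Poly_Mapping.keys p. Poly_Mapping.lookup p w * L (mon w))"
    by (rule sum.cong) (auto simp: single sc ncpolys_mon k)
  finally show ?thesis by (simp add: extend_def)
qed

text \<open>Feasibility tested on words. The cone generators and 1 are precisely the words of length
  at most 1, so one family of quadratic forms covers the cone condition; by linearity the ideal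
  conditions need only be tested on left multiples by words. The rank condition is kept
  apart.\<close>

definition word_feasible ::
  "'a set \<Rightarrow> 'b set \<Rightarrow> 's set \<Rightarrow> 't set \<Rightarrow> ('a \<Rightarrow> 'b \<Rightarrow> 's \<Rightarrow> 't \<Rightarrow> real) \<Rightarrow>
     (('a, 'b, 's, 't) symb list \<Rightarrow> real) \<Rightarrow> bool" where
  "word_feasible A B S T P \<phi> \<longleftrightarrow> (let W = nc_words A B S T in
     (\<forall>w\<in>W. \<phi> w = \<phi> (rev w)) \<and> (\<forall>w\<in>W. \<forall>w'\<in>W. \<phi> (w @ w') = \<phi> (w' @ w)) \<and>
     \<phi> [SymZ] = 1 \<and>
     (\<forall>a\<in>A. \<forall>b\<in>B. \<forall>s\<in>S. \<forall>t\<in>T. \<phi> [SymX a s, SymY b t, SymZ] = P a b s t) \<and>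
     (\<forall>g\<in>W. \<forall>U c. length g \<le> 1 \<longrightarrow> finite U \<longrightarrow> U \<subseteq> W \<longrightarrow>
        0 \<le> (\<Sum>u\<in>U. \<Sum>v\<in>U. c u * c v * \<phi> (rev u @ g @ v))) \<and>
     (\<forall>u\<in>W. \<phi> (u @ [SymZ]) = \<phi> (u @ [SymZ, SymZ])) \<and>
     (\<forall>u\<in>W. \<forall>s\<in>S. \<phi> u = (\<Sum>a\<in>A. \<phi> (u @ [SymX a s]))) \<and>
     (\<forall>u\<in>W. \<forall>t\<in>T. \<phi> u = (\<Sum>b\<in>B. \<phi> (u @ [SymY b t]))) \<and>
     (\<forall>u\<in>W. \<forall>a\<in>A. \<forall>b\<in>B. \<forall>s\<in>S. \<forall>t\<in>T.
        \<phi> (u @ [SymX a s, SymY b t]) = \<phi> (u @ [SymY b t, SymX a s])) \<and>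
     (\<forall>w\<in>W. \<forall>u\<in>W. \<forall>v\<in>W. \<phi> (w @ [SymZ] @ u @ [SymZ] @ v @ [SymZ])
        = \<phi> (w @ [SymZ] @ v @ [SymZ] @ u @ [SymZ])))"

lemma word_feasibleD:
  fixes A :: "'a set" and B :: "'b set" and S :: "'s set" and T :: "'t set"
  assumes "word_feasible A B S T P \<phi>"
  defines "W \<equiv> nc_words A B S T"
  shows "\<forall>w\<in>W. \<phi> w = \<phi> (rev w)"
    and "\<forall>w\<in>W. \<forall>w'\<in>W. \<phi> (w @ w') = \<phi> (w' @ w)"
    and "\<phi> [SymZ] = 1"
    and "\<forall>a\<in>A. \<forall>b\<in>B. \<forall>s\<in>S. \<forall>t\<in>T. \<phi> [SymX a s, SymY b t, SymZ] = P a b s t"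
    and "\<forall>g\<in>W. \<forall>U c. length g \<le> 1 \<longrightarrow> finite U \<longrightarrow> U \<subseteq> W \<longrightarrow>
        0 \<le> (\<Sum>u\<in>U. \<Sum>v\<in>U. c u * c v * \<phi> (rev u @ g @ v))"
    and "\<forall>u\<in>W. \<phi> (u @ [SymZ]) = \<phi> (u @ [SymZ, SymZ])"
    and "\<forall>u\<in>W. \<forall>s\<in>S. \<phi> u = (\<Sum>a\<in>A. \<phi> (u @ [SymX a s]))"
    and "\<forall>u\<in>W. \<forall>t\<in>T. \<phi> u = (\<Sum>b\<in>B. \<phi> (u @ [SymY b t]))"
    and "\<forall>u\<in>W. \<forall>a\<in>A. \<forall>b\<in>B. \<forall>s\<in>S. \<forall>t\<in>T.
        \<phi> (u @ [SymX a s, SymY b t]) = \<phi> (u @ [SymY b t, SymX a s])"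
    and "\<forall>w\<in>W. \<forall>u\<in>W. \<forall>v\<in>W. \<phi> (w @ [SymZ] @ u @ [SymZ] @ v @ [SymZ])
        = \<phi> (w @ [SymZ] @ v @ [SymZ] @ u @ [SymZ])"
  using assms(1) unfolding word_feasible_def Let_def W_def by - ((elim conjE, assumption)+)

lemma word_letter_cases:
  assumes "g \<in> nc_words A B S T" "length g \<le> 1"
  shows "mon g \<in> G_set A B S T \<union> {1}"
proof (cases g)
  case Nil
  then show ?thesis by (simp add: one_mon)
next
  case (Cons x xs)
  then show ?thesis using assms by (cases x) (auto simp: G_set_def nc_words_Cons)
qed

lemma G_set_word: "g \<in> G_set A B S T \<union> {1} \<Longrightarrow> \<exists>w\<in>nc_words A B S T. length w \<le> 1 \<and> g = mon w"
proof -
  assume "g \<in> G_set A B S T \<union> {1}"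
  then have "(\<exists>x. [x] \<in> nc_words A B S T \<and> g = mon [x]) \<or> g = mon []"
    unfolding G_set_def nc_words_Cons one_mon by (auto split: symb.splits)
  then show ?thesis
  proof (elim disjE exE conjE)
    fix x assume "[x] \<in> nc_words A B S T" "g = mon [x]"
    then show ?thesis by (intro bexI[of _ "[x]"]) auto
  next
    assume "g = mon []"
    then show ?thesis by (intro bexI[of _ "[]"]) auto
  qed
qed

lemma xi_feasible_imp_word_feasible:
  assumes L: "xi_feasible A B S T P L"
  defines "\<phi> \<equiv> \<lambda>w. L (mon w)"
  shows "word_feasible A B S T P \<phi>"
    "matrix_rank (nc_words A B S T) (\<lambda>u v. \<phi> (rev u @ v)) < \<infinity>"
    "L 1 = \<phi> []"
proof -
  let ?W = "nc_words A B S T"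
  have lin: "linear_functional A B S T L" using L by (simp add: xi_feasible_def)
  have L_ext: "L p = extend \<phi> p" if "p \<in> ncpolys A B S T" for p
    unfolding \<phi>_def by (rule linear_functional_extend[OF lin that])
  have "(\<lambda>u v. \<phi> (rev u @ v)) = moment_matrix L"
    by (intro ext) (simp add: \<phi>_def moment_matrix_def star_mon mon_mult)
  then show "matrix_rank ?W (\<lambda>u v. \<phi> (rev u @ v)) < \<infinity>"
    using L by (simp add: xi_feasible_def)
  show "L 1 = \<phi> []" by (simp add: \<phi>_def one_mon)
  have H: "extend \<phi> (mon w * h) = 0"
    if "w \<in> ?W" "h \<in> H_set A B S T \<union> R_inf A B S T" "h \<in> ncpolys A B S T" for w h
  proof -
    have "mon w \<in> ncpolys A B S T" using that by (simp add: ncpolys_mon)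
    then have "mon w * h \<in> left_multiples A B S T (H_set A B S T \<union> R_inf A B S T)"
      unfolding left_multiples_def using that(2) by blast
    then have "L (mon w * h) = 0" using L by (simp add: xi_feasible_def)
    moreover have "mon w * h \<in> ncpolys A B S T"
      using that by (intro ncpolys_mult) (simp_all add: ncpolys_mon)
    ultimately show ?thesis by (simp add: L_ext)
  qed
  show "word_feasible A B S T P \<phi>"
    unfolding word_feasible_def Let_def
  proof (intro conjI ballI allI impI)
    fix w assume "w \<in> ?W"
    then have "L (mon w) = L (star (mon w))"
      using L unfolding xi_feasible_def symmetric_functional_def by blast
    then show "\<phi> w = \<phi> (rev w)" by (simp add: \<phi>_def star_mon)
  next
    fix w w' assume "w \<in> ?W" "w' \<in> ?W"
    then have "L (mon w * mon w') = L (mon w' * mon w)"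
      using L unfolding xi_feasible_def tracial_functional_def by blast
    then show "\<phi> (w @ w') = \<phi> (w' @ w)" by (simp add: \<phi>_def mon_mult)
  next
    show "\<phi> [SymZ] = 1" using L by (simp add: xi_feasible_def \<phi>_def)
  next
    fix a b s t assume "a \<in> A" "b \<in> B" "s \<in> S" "t \<in> T"
    then show "\<phi> [SymX a s, SymY b t, SymZ] = P a b s t"
      using L by (simp add: xi_feasible_def \<phi>_def mon_mult)
  next
    fix g U and c :: "_ \<Rightarrow> real"
    assume g: "g \<in> ?W" "length g \<le> 1" and U: "finite U" "U \<subseteq> ?W"
    define p where "p = (\<Sum>u\<in>U. Poly_Mapping.single u (c u))"
    have p: "p \<in> ncpolys A B S T" unfolding p_def using U by (intro ncpolys_sum ncpolys_single) auto
    have "star p * mon g * p \<in> quad_cone A B S T (G_set A B S T)"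
      by (rule quad_cone.gen[OF p word_letter_cases[OF g]])
    then have "0 \<le> L (star p * mon g * p)" using L by (simp add: xi_feasible_def)
    also have "\<dots> = extend \<phi> (star p * mon g * p)"
      using g by (intro L_ext ncpolys_mult ncpolys_star p) (simp add: ncpolys_mon)
    finally show "0 \<le> (\<Sum>u\<in>U. \<Sum>v\<in>U. c u * c v * \<phi> (rev u @ g @ v))"
      unfolding p_def extend_quadratic .
  next
    fix u assume u: "u \<in> ?W"
    have "varz - varz * varz \<in> ncpolys A B S T"
      by (intro ncpolys_diff ncpolys_mult) (simp_all add: ncpolys_mon nc_words_Cons)
    from H[OF u _ this] show "\<phi> (u @ [SymZ]) = \<phi> (u @ [SymZ, SymZ])"
      by (simp add: H_set_def right_diff_distrib mon_mult)
  next
    fix u s assume u: "u \<in> ?W" and s: "s \<in> S"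
    have "1 - (\<Sum>a\<in>A. varx a s) \<in> ncpolys A B S T"
      using s by (intro ncpolys_diff ncpolys_sum) (simp_all add: ncpolys_mon one_mon nc_words_Cons)
    moreover have "1 - (\<Sum>a\<in>A. varx a s) \<in> H_set A B S T \<union> R_inf A B S T"
      using s unfolding H_set_def by blast
    ultimately have "extend \<phi> (mon u * (1 - (\<Sum>a\<in>A. varx a s))) = 0" using H[OF u] by blast
    then show "\<phi> u = (\<Sum>a\<in>A. \<phi> (u @ [SymX a s]))"
      by (simp add: right_diff_distrib mon_mult sum_distrib_left)
  next
    fix u t assume u: "u \<in> ?W" and t: "t \<in> T"
    have "1 - (\<Sum>b\<in>B. vary b t) \<in> ncpolys A B S T"
      using t by (intro ncpolys_diff ncpolys_sum) (simp_all add: ncpolys_mon one_mon nc_words_Cons)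
    moreover have "1 - (\<Sum>b\<in>B. vary b t) \<in> H_set A B S T \<union> R_inf A B S T"
      using t unfolding H_set_def by blast
    ultimately have "extend \<phi> (mon u * (1 - (\<Sum>b\<in>B. vary b t))) = 0" using H[OF u] by blast
    then show "\<phi> u = (\<Sum>b\<in>B. \<phi> (u @ [SymY b t]))"
      by (simp add: right_diff_distrib mon_mult sum_distrib_left)
  next
    fix u a b s t assume u: "u \<in> ?W" and ab: "a \<in> A" "b \<in> B" "s \<in> S" "t \<in> T"
    have "varx a s * vary b t - vary b t * varx a s \<in> ncpolys A B S T"
      using ab by (intro ncpolys_diff ncpolys_mult) (simp_all add: ncpolys_mon nc_words_Cons)
    moreover have "varx a s * vary b t - vary b t * varx a s \<in> H_set A B S T \<union> R_inf A B S T"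
      using ab unfolding H_set_def by blast
    ultimately have "extend \<phi> (mon u * (varx a s * vary b t - vary b t * varx a s)) = 0"
      using H[OF u] by blast
    then show "\<phi> (u @ [SymX a s, SymY b t]) = \<phi> (u @ [SymY b t, SymX a s])"
      by (simp add: right_diff_distrib mon_mult)
  next
    fix w u v assume w: "w \<in> ?W" and uv: "u \<in> ?W" "v \<in> ?W"
    let ?h = "varz * mon u * varz * mon v * varz - varz * mon v * varz * mon u * varz"
    have "?h \<in> ncpolys A B S T"
      using uv by (intro ncpolys_diff ncpolys_mult) (simp_all add: ncpolys_mon nc_words_Cons)
    moreover have "?h \<in> H_set A B S T \<union> R_inf A B S T"
      using uv unfolding R_inf_def by blast
    ultimately have "extend \<phi> (mon w * ?h) = 0" using H[OF w] by blast
    then show "\<phi> (w @ [SymZ] @ u @ [SymZ] @ v @ [SymZ]) = \<phi> (w @ [SymZ] @ v @ [SymZ] @ u @ [SymZ])"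
      by (simp add: right_diff_distrib mon_mult)
  qed
qed

lemma word_feasible_imp_xi_feasible:
  assumes wf: "word_feasible A B S T P \<phi>"
    and rank: "matrix_rank (nc_words A B S T) (\<lambda>u v. \<phi> (rev u @ v)) < \<infinity>"
  shows "xi_feasible A B S T P (extend \<phi>)"
  unfolding xi_feasible_def
proof (intro conjI ballI)
  note w = word_feasibleD[OF wf]
  let ?W = "nc_words A B S T"
  show "linear_functional A B S T (extend \<phi>)" by (simp add: linear_functional_def)
  show "symmetric_functional A B S T (extend \<phi>)"
    unfolding symmetric_functional_def star_mon extend_mon by (rule w(1))
  show "tracial_functional A B S T (extend \<phi>)"
    unfolding tracial_functional_def mon_mult extend_mon by (rule w(2))
  show "extend \<phi> varz = 1" using w(3) by simp
  show "extend \<phi> (varx a s * vary b t * varz) = P a b s t" if "a \<in> A" "b \<in> B" "s \<in> S" "t \<in> T" for a b s t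
    using w(4) that by (simp add: mon_mult)
  have "(\<lambda>u v. \<phi> (rev u @ v)) = moment_matrix (extend \<phi>)"
    by (intro ext) (simp add: moment_matrix_def star_mon mon_mult)
  then show "matrix_rank ?W (moment_matrix (extend \<phi>)) < \<infinity>" using rank by simp
  fix p
  show "0 \<le> extend \<phi> p" if "p \<in> quad_cone A B S T (G_set A B S T)"
    using that
  proof (induction rule: quad_cone.induct)
    case (gen p g)
    obtain v where v: "v \<in> ?W" "length v \<le> 1" "g = mon v" using G_set_word[OF gen(2)] by blast
    have "Poly_Mapping.keys p \<subseteq> ?W" using gen(1) by (simp add: ncpolys_def)
    moreover have "extend \<phi> (star p * g * p)
        = (\<Sum>x\<in>Poly_Mapping.keys p. \<Sum>y\<in>Poly_Mapping.keys p. Poly_Mapping.lookup p x * Poly_Mapping.lookup p y * \<phi> (rev x @ v @ y))"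
      unfolding v(3) extend_quadratic[symmetric] using ncpoly_sum_single[of p] by simp
    ultimately show ?case using w(5) v by simp
  qed simp_all
  show "extend \<phi> p = 0" if pm: "p \<in> left_multiples A B S T (H_set A B S T \<union> R_inf A B S T)"
  proof -
    obtain q h where q: "q \<in> ncpolys A B S T" "h \<in> H_set A B S T \<union> R_inf A B S T" "p = q * h"
      using pm unfolding left_multiples_def by blast
    \<comment> \<open>By linearity in the left factor it is enough to multiply a relation by
      words.\<close>
    have k: "extend \<phi> (mon u * h) = 0" if u: "u \<in> ?W" for u
      using q(2) unfolding H_set_def R_inf_def
    proof (elim UnE CollectE exE conjE singletonE)
      assume "h = varz - varz * varz"
      then show ?thesis using w(6) u by (simp add: right_diff_distrib mon_mult)
    next
      fix s assume "h = 1 - (\<Sum>a\<in>A. varx a s)" "s \<in> S"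
      then show ?thesis using w(7)[rule_format, OF u, of s]
        by (simp add: right_diff_distrib mon_mult sum_distrib_left)
    next
      fix t assume "h = 1 - (\<Sum>b\<in>B. vary b t)" "t \<in> T"
      then show ?thesis using w(8)[rule_format, OF u, of t]
        by (simp add: right_diff_distrib mon_mult sum_distrib_left)
    next
      fix a b s t assume "h = varx a s * vary b t - vary b t * varx a s" "a \<in> A" "b \<in> B" "s \<in> S" "t \<in> T"
      then show ?thesis using w(9)[rule_format, OF u, of a b s t]
        by (simp add: right_diff_distrib mon_mult)
    next
      fix x y assume h: "h = varz * mon x * varz * mon y * varz - varz * mon y * varz * mon x * varz"
        and xy: "x \<in> ?W" "y \<in> ?W"
      have "\<phi> (u @ [SymZ] @ x @ [SymZ] @ y @ [SymZ]) = \<phi> (u @ [SymZ] @ y @ [SymZ] @ x @ [SymZ])"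
        using w(10) u xy by blast
      then show ?thesis by (simp add: h right_diff_distrib mon_mult)
    qed
    have k': "extend \<phi> (Poly_Mapping.single u c * h) = 0" if "u \<in> ?W" for u c
    proof -
      have "Poly_Mapping.single u c * h = scale c (mon u * h)"
      proof (rule poly_mapping_eqI)
        fix x
        have "Poly_Mapping.single u c = Poly_Mapping.single 0 c * mon u"
          by (simp add: mon_def mult_single)
        moreover have "Poly_Mapping.single 0 c * r = scale c r" for r :: "('a, 'b, 'c, 'd) ncpoly"
        proof -
          have "Poly_Mapping.single 0 c * r = (\<Sum>w\<in>Poly_Mapping.keys r. Poly_Mapping.single w (c * Poly_Mapping.lookup r w))"
            by (subst (1) ncpoly_sum_single[of r]) (simp add: sum_distrib_left mult_single)
          also have "\<dots> = scale c r"
          proof (rule poly_mapping_eqI)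
            fix v
            have "Poly_Mapping.lookup (\<Sum>w\<in>Poly_Mapping.keys r. Poly_Mapping.single w (c * Poly_Mapping.lookup r w)) v
                = (\<Sum>w\<in>Poly_Mapping.keys r. if w = v then c * Poly_Mapping.lookup r v else 0)"
              unfolding lookup_sum by (rule sum.cong) (auto simp: lookup_single when_def)
            then show "Poly_Mapping.lookup (\<Sum>w\<in>Poly_Mapping.keys r. Poly_Mapping.single w (c * Poly_Mapping.lookup r w)) v = Poly_Mapping.lookup (scale c r) v"
              by (auto simp: in_keys_iff)
          qed
          finally show ?thesis .
        qed
        ultimately show "Poly_Mapping.lookup (Poly_Mapping.single u c * h) x = Poly_Mapping.lookup (scale c (mon u * h)) x"
          by (metis mult.assoc)
      qed
      then show ?thesis using k[OF that] by simp
    qed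
    have "extend \<phi> p = extend \<phi> ((\<Sum>u\<in>Poly_Mapping.keys q. Poly_Mapping.single u (Poly_Mapping.lookup q u)) * h)"
      using q(3) ncpoly_sum_single[of q] by simp
    also have "\<dots> = 0"
      unfolding sum_distrib_right extend_sum
      by (rule sum.neutral) (use q(1) k' in \<open>auto simp: ncpolys_def\<close>)
    finally show ?thesis .
  qed
qed

section \<open>Decompositions yield feasible functionals\<close>

primrec wev :: "nat \<Rightarrow> ('x \<Rightarrow> fmat) \<Rightarrow> 'x list \<Rightarrow> fmat" where
  "wev d V [] = idm d"
| "wev d V (g # w) = V g * wev d V w"

lemma wev_dimle: "(\<And>g. g \<in> set w \<Longrightarrow> dimle d (V g)) \<Longrightarrow> dimle d (wev d V w)"
  by (induction w) (auto intro: dimle_times)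

lemma wev_append:
  assumes "\<And>g. g \<in> set v \<Longrightarrow> dimle d (V g)"
  shows "wev d V (u @ v) = wev d V u * wev d V v"
  using wev_dimle[of v d V] assms by (induction u) (auto simp: idm_times mult.assoc)

lemma wev_rev:
  assumes "\<And>g. g \<in> set w \<Longrightarrow> dimle d (V g) \<and> adj (V g) = V g"
  shows "wev d V (rev w) = adj (wev d V w)"
  using assms
proof (induction w)
  case (Cons g w)
  have "wev d V (rev w @ [g]) = wev d V (rev w) * wev d V [g]"
    by (rule wev_append) (use Cons.prems in auto)
  then show ?case using Cons by (simp add: times_idm)
qed simp

primrec letter_val ::
  "('s \<Rightarrow> 'a \<Rightarrow> fmat) \<Rightarrow> ('t \<Rightarrow> 'b \<Rightarrow> fmat) \<Rightarrow> fmat \<Rightarrow> ('a, 'b, 's, 't) symb \<Rightarrow> fmat" where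
  "letter_val X Y Z (SymX a s) = X s a"
| "letter_val X Y Z (SymY b t) = Y t b"
| "letter_val X Y Z SymZ = Z"

lemma scalar_fmat:
  assumes "idm (Suc 0) * K = K" "K * idm (Suc 0) = K"
  shows "K = Tr K *\<^sub>C idm (Suc 0)"
proof (rule fmat_eqI)
  have K: "ent K i j = (if i = 0 \<and> j = 0 then ent K 0 0 else 0)" for i j
  proof -
    have "ent K i j = ent (idm (Suc 0) * (K * idm (Suc 0))) i j" using assms by simp
    then show ?thesis by (auto simp: ent_idm_times ent_times_idm)
  qed
  then have "dimle (Suc 0) K" unfolding dimle_def by (metis zero_less_Suc)
  then have "Tr K = ent K 0 0" by (simp add: Tr_dimle)
  then show "ent K i j = ent (Tr K *\<^sub>C idm (Suc 0)) i j" for i j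
    by (subst K) (auto simp: ent_idm)
qed

text \<open>The letter z is sent to the rank-one projection Z onto the state. Then Z M Z is a scalar
  multiple of Z for every M, so compressions by Z commute, which is what the last family of
  relations demands. At the empty word the functional takes the value d.\<close>

lemma qc_model_word_feasible:
  fixes A :: "'a set" and B :: "'b set" and S :: "'s set" and T :: "'t set"
  assumes m: "qc_model A B S T d X Y \<psi> P"
  defines "V \<equiv> letter_val X Y (\<psi> * adj \<psi>) :: ('a, 'b, 's, 't) symb \<Rightarrow> fmat"
  shows "word_feasible A B S T P (\<lambda>w. Re (Tr (wev d V w)))"
    and "w \<in> nc_words A B S T \<Longrightarrow> dimle d (wev d V w) \<and> wev d V (rev w) = adj (wev d V w)"
    and "u \<in> nc_words A B S T \<Longrightarrow> v \<in> nc_words A B S T \<Longrightarrow> wev d V (u @ v) = wev d V u * wev d V v"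
proof -
  let ?W = "nc_words A B S T"
  define Z where "Z = \<psi> * adj \<psi>"
  have X: "povm d A (X s)" if "s \<in> S" for s using m that by (simp add: qc_model_def)
  have Y: "povm d B (Y t)" if "t \<in> T" for t using m that by (simp add: qc_model_def)
  have \<psi>: "idm d * \<psi> = \<psi>" "\<psi> * idm (Suc 0) = \<psi>" "Tr (adj \<psi> * \<psi>) = 1"
    using m by (simp_all add: qc_model_def)
  have \<psi>a: "adj \<psi> * idm d = adj \<psi>" "idm (Suc 0) * adj \<psi> = adj \<psi>"
    using arg_cong[OF \<psi>(1), of adj] arg_cong[OF \<psi>(2), of adj] by simp_all
  have scal: "adj \<psi> * M * \<psi> = Tr (adj \<psi> * M * \<psi>) *\<^sub>C idm (Suc 0)" for M
    by (rule scalar_fmat) (metis \<psi> \<psi>a mult.assoc)+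
  have ZZ: "Z * Z = Z"
  proof -
    have "adj \<psi> * \<psi> = idm (Suc 0)"
      using scalar_fmat[of "adj \<psi> * \<psi>"] \<psi> \<psi>a by (simp add: mult.assoc) (simp add: mult.assoc[symmetric])
    then show ?thesis unfolding Z_def by (metis \<psi>(2) mult.assoc)
  qed
  have Zd: "dimle d Z"
  proof -
    have "ent Z i j = ent (idm d * (Z * idm d)) i j" for i j
      unfolding Z_def by (metis \<psi> \<psi>a mult.assoc)
    then have "ent Z i j = (if i < d \<and> j < d then ent Z i j else 0)" for i j
      by (metis ent_idm_times ent_times_idm)
    then show ?thesis unfolding dimle_def by metis
  qed
  have Zpsd: "psd Z" using psd_adj_self[of "adj \<psi>"] by (simp add: Z_def)
  have let': "dimle d (V g) \<and> psd (V g)" if "[g] \<in> ?W" for g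
    using that X Y Zd Zpsd by (cases g) (auto simp: nc_words_Cons V_def povm_def Z_def)
  have letw: "dimle d (V g) \<and> adj (V g) = V g" if "w \<in> ?W" "g \<in> set w" for g w
  proof -
    have "[g] \<in> ?W" using that by (auto simp: nc_words_def)
    then show ?thesis using let' psd_adj_eq by blast
  qed
  have Wd: "dimle d (wev d V w)" if "w \<in> ?W" for w by (rule wev_dimle) (use letw that in blast)
  have Wr: "wev d V (rev w) = adj (wev d V w)" if "w \<in> ?W" for w
    by (rule wev_rev) (use letw that in blast)
  have Wa: "wev d V (u @ v) = wev d V u * wev d V v" if "v \<in> ?W" for u v
    by (rule wev_append) (use letw that in blast)
  show "w \<in> ?W \<Longrightarrow> dimle d (wev d V w) \<and> wev d V (rev w) = adj (wev d V w)" using Wd Wr by blast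
  show "u \<in> ?W \<Longrightarrow> v \<in> ?W \<Longrightarrow> wev d V (u @ v) = wev d V u * wev d V v" using Wa by blast
  have one: "wev d V [g] = V g" if "[g] \<in> ?W" for g using let'[OF that] by (simp add: times_idm)
  have two: "wev d V [g, h] = V g * V h" if "[h] \<in> ?W" for g h using let'[OF that] by (simp add: times_idm)
  have vv: "V (SymX a s) = X s a" "V (SymY b t) = Y t b" "V SymZ = Z" for a s b t
    by (simp_all add: V_def Z_def)
  show "word_feasible A B S T P (\<lambda>w. Re (Tr (wev d V w)))"
    unfolding word_feasible_def Let_def
  proof (intro conjI ballI allI impI)
    fix w assume "w \<in> ?W"
    then show "Re (Tr (wev d V w)) = Re (Tr (wev d V (rev w)))" by (simp add: Wr)
  next
    fix w w' assume "w \<in> ?W" "w' \<in> ?W"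
    then show "Re (Tr (wev d V (w @ w'))) = Re (Tr (wev d V (w' @ w)))"
      using Tr_commute[of "wev d V w" "wev d V w'"] by (simp add: Wa)
  next
    have "Tr Z = 1" using \<psi>(3) Tr_commute[of \<psi> "adj \<psi>"] by (simp add: Z_def)
    then show "Re (Tr (wev d V [SymZ])) = 1"
      using Zd by (simp add: V_def Z_def times_idm)
  next
    fix a b s t assume ab: "a \<in> A" "b \<in> B" "s \<in> S" "t \<in> T"
    have "Tr (wev d V [SymX a s, SymY b t, SymZ]) = Tr ((X s a * Y t b * \<psi>) * adj \<psi>)"
      by (simp add: V_def mult.assoc \<psi>a)
    also have "\<dots> = Tr (adj \<psi> * (X s a * Y t b) * \<psi>)"
      by (subst Tr_commute) (simp add: mult.assoc)
    also have "\<dots> = complex_of_real (P a b s t)" using m ab by (simp add: qc_model_def)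
    finally show "Re (Tr (wev d V [SymX a s, SymY b t, SymZ])) = P a b s t" by simp
  next
    fix g U and c :: "('a, 'b, 's, 't) symb list \<Rightarrow> real"
    assume g: "g \<in> ?W" "length g \<le> 1" and U: "finite U" "U \<subseteq> ?W"
    define M where "M = (\<Sum>u\<in>U. complex_of_real (c u) *\<^sub>C wev d V u)"
    have "psd (wev d V g)"
    proof (cases g)
      case Nil
      then show ?thesis using psd_adj_self[of "idm d"] by simp
    next
      case (Cons x xs)
      then have "g = [x]" using g(2) by simp
      then show ?thesis using one[of x] let'[of x] g(1) by simp
    qed
    then have "0 \<le> Tr (adj M * wev d V g * M)" by (simp add: psd_def)
    also have "Tr (adj M * wev d V g * M)
        = (\<Sum>u\<in>U. \<Sum>v\<in>U. complex_of_real (c u * c v) * Tr (adj (wev d V u) * wev d V g * wev d V v))"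
    proof -
      have aM: "adj M = (\<Sum>u\<in>U. complex_of_real (c u) *\<^sub>C adj (wev d V u))" by (simp add: M_def)
      have 1: "Tr (adj M * wev d V g * M)
          = (\<Sum>u\<in>U. complex_of_real (c u) * Tr (adj (wev d V u) * wev d V g * M))"
        by (simp add: aM sum_distrib_right)
      have 2: "Tr (adj (wev d V u) * wev d V g * M)
          = (\<Sum>v\<in>U. complex_of_real (c v) * Tr (adj (wev d V u) * wev d V g * wev d V v))" for u
        by (simp add: M_def sum_distrib_left)
      show ?thesis unfolding 1 2 by (simp add: sum_distrib_left mult.assoc)
    qed
    also have "\<dots> = (\<Sum>u\<in>U. \<Sum>v\<in>U. complex_of_real (c u * c v) * Tr (wev d V (rev u @ g @ v)))"
      using U g by (intro sum.cong refl) (simp add: Wa Wr subset_iff mult.assoc)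
    finally show "0 \<le> (\<Sum>u\<in>U. \<Sum>v\<in>U. c u * c v * Re (Tr (wev d V (rev u @ g @ v))))"
      by (simp add: less_eq_complex_def)
  next
    fix u assume "u \<in> ?W"
    show "Re (Tr (wev d V (u @ [SymZ]))) = Re (Tr (wev d V (u @ [SymZ, SymZ])))"
    proof -
      have "[SymZ] \<in> ?W" "[SymZ, SymZ] \<in> ?W" by (simp_all add: nc_words_Cons)
      then show ?thesis using one[of SymZ] two[of SymZ SymZ] ZZ
        by (simp add: Wa vv del: wev.simps)
    qed
  next
    fix u s assume u: "u \<in> ?W" and s: "s \<in> S"
    have "(\<Sum>a\<in>A. Tr (wev d V (u @ [SymX a s]))) = (\<Sum>a\<in>A. Tr (wev d V u * X s a))"
    proof (rule sum.cong[OF refl])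
      fix a assume "a \<in> A"
      then have "[SymX a s] \<in> ?W" using s by (simp add: nc_words_Cons)
      then show "Tr (wev d V (u @ [SymX a s])) = Tr (wev d V u * X s a)"
        using one[of "SymX a s"] by (simp add: Wa vv del: wev.simps)
    qed
    also have "\<dots> = Tr (wev d V u * (\<Sum>a\<in>A. X s a))" by (simp add: sum_distrib_left)
    also have "\<dots> = Tr (wev d V u)" using X[OF s] Wd[OF u] by (simp add: povm_def times_idm)
    finally show "Re (Tr (wev d V u)) = (\<Sum>a\<in>A. Re (Tr (wev d V (u @ [SymX a s]))))"
      by (metis Re_sum)
  next
    fix u t assume u: "u \<in> ?W" and t: "t \<in> T"
    have "(\<Sum>b\<in>B. Tr (wev d V (u @ [SymY b t]))) = (\<Sum>b\<in>B. Tr (wev d V u * Y t b))"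
    proof (rule sum.cong[OF refl])
      fix b assume "b \<in> B"
      then have "[SymY b t] \<in> ?W" using t by (simp add: nc_words_Cons)
      then show "Tr (wev d V (u @ [SymY b t])) = Tr (wev d V u * Y t b)"
        using one[of "SymY b t"] by (simp add: Wa vv del: wev.simps)
    qed
    also have "\<dots> = Tr (wev d V u * (\<Sum>b\<in>B. Y t b))" by (simp add: sum_distrib_left)
    also have "\<dots> = Tr (wev d V u)" using Y[OF t] Wd[OF u] by (simp add: povm_def times_idm)
    finally show "Re (Tr (wev d V u)) = (\<Sum>b\<in>B. Re (Tr (wev d V (u @ [SymY b t]))))"
      by (metis Re_sum)
  next
    fix u a b s t assume "u \<in> ?W" and ab: "a \<in> A" "b \<in> B" "s \<in> S" "t \<in> T"
    have W: "[SymX a s] \<in> ?W" "[SymY b t] \<in> ?W" "[SymX a s, SymY b t] \<in> ?W" "[SymY b t, SymX a s] \<in> ?W"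
      using ab by (simp_all add: nc_words_Cons)
    have "X s a * Y t b = Y t b * X s a" using m ab by (simp add: qc_model_def)
    then show "Re (Tr (wev d V (u @ [SymX a s, SymY b t]))) = Re (Tr (wev d V (u @ [SymY b t, SymX a s])))"
      using W two[OF W(1), of "SymY b t"] two[OF W(2), of "SymX a s"]
      by (simp add: Wa vv del: wev.simps)
  next
    fix w u v assume W: "w \<in> ?W" "u \<in> ?W" "v \<in> ?W"
    have z: "[SymZ] \<in> ?W" by (simp add: nc_words_Cons)
    have e: "wev d V (w @ [SymZ] @ u @ [SymZ] @ v @ [SymZ])
        = wev d V w * (Z * wev d V u * Z * wev d V v * Z)" if "u \<in> ?W" "v \<in> ?W" for u v
      using that W z one[OF z] by (simp add: Wa vv mult.assoc del: wev.simps append_Cons)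
    have c: "Z * M * Z * N * Z = (Tr (adj \<psi> * M * \<psi>) * Tr (adj \<psi> * N * \<psi>)) *\<^sub>C Z" for M N
    proof -
      have "Z * M * Z * N * Z = \<psi> * (adj \<psi> * M * \<psi>) * (adj \<psi> * N * \<psi>) * adj \<psi>"
        by (simp add: Z_def mult.assoc)
      also have "\<dots> = (Tr (adj \<psi> * M * \<psi>) * Tr (adj \<psi> * N * \<psi>)) *\<^sub>C Z"
        by (subst scal[of M], subst scal[of N]) (simp add: \<psi> \<psi>a Z_def mult.assoc mult.commute)
      finally show ?thesis .
    qed
    show "Re (Tr (wev d V (w @ [SymZ] @ u @ [SymZ] @ v @ [SymZ])))
        = Re (Tr (wev d V (w @ [SymZ] @ v @ [SymZ] @ u @ [SymZ])))"
      unfolding e[OF W(2,3)] e[OF W(3,2)] c by (simp only: mult.commute)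
  qed
qed

text \<open>The columns are combinations of card K fixed vectors: coefficients annihilating the
  vectors g annihilate the columns too.\<close>

lemma matrix_rank_finite:
  fixes K :: "'k set"
  assumes K: "finite K" and M: "\<And>u v. u \<in> W \<Longrightarrow> v \<in> W \<Longrightarrow> M u v = (\<Sum>k\<in>K. f k u * g k v)"
  shows "matrix_rank W M < \<infinity>"
proof -
  have "matrix_rank W M \<le> enat (card K)"
    unfolding matrix_rank_def
  proof (rule Sup_least)
    fix x assume "x \<in> {enat (card V) | V. finite V \<and> V \<subseteq> W \<and>
     (\<forall>c. (\<forall>u\<in>W. (\<Sum>v\<in>V. c v * M u v) = 0) \<longrightarrow> (\<forall>v\<in>V. c v = 0))}"
    then obtain V where V: "x = enat (card V)" "finite V" "V \<subseteq> W"
      and ind: "\<And>c. \<forall>u\<in>W. (\<Sum>v\<in>V. c v * M u v) = 0 \<Longrightarrow> \<forall>v\<in>V. c v = 0" by blast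
    have "card V \<le> card K"
    proof (rule ccontr)
      assume "\<not> card V \<le> card K"
      then obtain c where c: "\<exists>v\<in>V. c v \<noteq> 0" "\<forall>k\<in>K. (\<Sum>v\<in>V. c v * g k v) = 0"
        using linear_dependence[OF K V(2), of g] by auto
      have "(\<Sum>v\<in>V. c v * M u v) = 0" if u: "u \<in> W" for u
      proof -
        have "(\<Sum>v\<in>V. c v * M u v) = (\<Sum>v\<in>V. \<Sum>k\<in>K. f k u * (c v * g k v))"
          by (rule sum.cong[OF refl]) (use V(3) u in \<open>simp add: M subset_iff sum_distrib_left mult.left_commute\<close>)
        also have "\<dots> = (\<Sum>k\<in>K. f k u * (\<Sum>v\<in>V. c v * g k v))"
          by (subst sum.swap) (simp add: sum_distrib_left)
        also have "\<dots> = 0" using c(2) by simp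
        finally show ?thesis .
      qed
      then show False using ind[of c] c(1) by blast
    qed
    then show "x \<le> enat (card K)" using V(1) by simp
  qed
  then show ?thesis using le_less_trans enat_ord_simps(4) by blast
qed

text \<open>For fixed nonnegative weights all conditions are affine in the functional and the
  correlation, or inequalities preserved by nonnegative combinations.\<close>

lemma word_feasible_convex:
  assumes F: "finite F" and l: "\<And>i. i \<in> F \<Longrightarrow> 0 \<le> l i" "(\<Sum>i\<in>F. l i) = 1"
    and wf: "\<And>i. i \<in> F \<Longrightarrow> word_feasible A B S T (Q i) (\<phi> i)"
    and P: "\<And>a b s t. a \<in> A \<Longrightarrow> b \<in> B \<Longrightarrow> s \<in> S \<Longrightarrow> t \<in> T \<Longrightarrow> P a b s t = (\<Sum>i\<in>F. l i * Q i a b s t)"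
  shows "word_feasible A B S T P (\<lambda>w. \<Sum>i\<in>F. l i * \<phi> i w)"
  unfolding word_feasible_def Let_def
proof (intro conjI ballI allI impI)
  let ?W = "nc_words A B S T"
  note w = word_feasibleD[OF wf]
  have eq: "(\<Sum>i\<in>F. l i * \<phi> i u) = (\<Sum>i\<in>F. l i * \<phi> i v)" if "\<And>i. i \<in> F \<Longrightarrow> \<phi> i u = \<phi> i v" for u v
    by (rule sum.cong[OF refl]) (simp add: that)
  fix w assume W: "w \<in> ?W"
  show "(\<Sum>i\<in>F. l i * \<phi> i w) = (\<Sum>i\<in>F. l i * \<phi> i (rev w))" by (rule eq) (use w(1) W in blast)
  show "(\<Sum>i\<in>F. l i * \<phi> i (w @ w')) = (\<Sum>i\<in>F. l i * \<phi> i (w' @ w))" if "w' \<in> ?W" for w'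
    by (rule eq) (use w(2) W that in blast)
  show "(\<Sum>i\<in>F. l i * \<phi> i (w @ [SymZ])) = (\<Sum>i\<in>F. l i * \<phi> i (w @ [SymZ, SymZ]))"
    by (rule eq) (use w(6) W in blast)
  show "(\<Sum>i\<in>F. l i * \<phi> i w) = (\<Sum>a\<in>A. \<Sum>i\<in>F. l i * \<phi> i (w @ [SymX a s]))" if "s \<in> S" for s
  proof -
    have "(\<Sum>a\<in>A. \<Sum>i\<in>F. l i * \<phi> i (w @ [SymX a s])) = (\<Sum>i\<in>F. l i * (\<Sum>a\<in>A. \<phi> i (w @ [SymX a s])))"
      by (subst sum.swap) (simp add: sum_distrib_left)
    also have "\<dots> = (\<Sum>i\<in>F. l i * \<phi> i w)"
      by (rule sum.cong[OF refl]) (use w(7) W that in simp)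
    finally show ?thesis by simp
  qed
  show "(\<Sum>i\<in>F. l i * \<phi> i w) = (\<Sum>b\<in>B. \<Sum>i\<in>F. l i * \<phi> i (w @ [SymY b t]))" if "t \<in> T" for t
  proof -
    have "(\<Sum>b\<in>B. \<Sum>i\<in>F. l i * \<phi> i (w @ [SymY b t])) = (\<Sum>i\<in>F. l i * (\<Sum>b\<in>B. \<phi> i (w @ [SymY b t])))"
      by (subst sum.swap) (simp add: sum_distrib_left)
    also have "\<dots> = (\<Sum>i\<in>F. l i * \<phi> i w)"
      by (rule sum.cong[OF refl]) (use w(8) W that in simp)
    finally show ?thesis by simp
  qed
  show "(\<Sum>i\<in>F. l i * \<phi> i (w @ [SymX a s, SymY b t])) = (\<Sum>i\<in>F. l i * \<phi> i (w @ [SymY b t, SymX a s]))"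
    if "a \<in> A" "b \<in> B" "s \<in> S" "t \<in> T" for a b s t
    by (rule eq) (use w(9) W that in blast)
  show "(\<Sum>i\<in>F. l i * \<phi> i (w @ [SymZ] @ u @ [SymZ] @ v @ [SymZ]))
    = (\<Sum>i\<in>F. l i * \<phi> i (w @ [SymZ] @ v @ [SymZ] @ u @ [SymZ]))" if "u \<in> ?W" "v \<in> ?W" for u v
    by (rule eq) (use w(10) W that in blast)
  show "0 \<le> (\<Sum>u\<in>U. \<Sum>v\<in>U. c u * c v * (\<Sum>i\<in>F. l i * \<phi> i (rev u @ w @ v)))"
    if "length w \<le> 1" "finite U" "U \<subseteq> ?W" for U and c :: "_ \<Rightarrow> real"
  proof -
    have "(\<Sum>u\<in>U. \<Sum>v\<in>U. c u * c v * (\<Sum>i\<in>F. l i * \<phi> i (rev u @ w @ v)))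
      = (\<Sum>u\<in>U. \<Sum>i\<in>F. \<Sum>v\<in>U. l i * (c u * c v * \<phi> i (rev u @ w @ v)))"
      unfolding sum_distrib_left sum.swap[of _ U F] by (simp add: mult_ac)
    also have "\<dots> = (\<Sum>i\<in>F. l i * (\<Sum>u\<in>U. \<Sum>v\<in>U. c u * c v * \<phi> i (rev u @ w @ v)))"
      by (subst sum.swap) (simp add: sum_distrib_left)
    also have "\<dots> \<ge> 0" using l(1) w(5) W that by (auto intro!: sum_nonneg[of F] mult_nonneg_nonneg[OF l(1)])
    finally show ?thesis .
  qed
next
  note w = word_feasibleD[OF wf]
  show "(\<Sum>i\<in>F. l i * \<phi> i [SymZ]) = 1" using l(2) w(3) by simp
  fix a b s t assume "a \<in> A" "b \<in> B" "s \<in> S" "t \<in> T"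
  then show "(\<Sum>i\<in>F. l i * \<phi> i [SymX a s, SymY b t, SymZ]) = P a b s t" using w(4) P by simp
qed

theorem A_qc_feasible:
  fixes A :: "'a set" and B :: "'b set" and S :: "'s set" and T :: "'t set"
  assumes fin: "finite A" "finite B" "finite S" "finite T" and P: "P \<in> C_q A B S T"
  shows "\<exists>L. xi_feasible A B S T P L \<and> ereal (L 1) = A_qc A B S T P"
proof -
  let ?W = "nc_words A B S T"
  obtain I l Q where d: "dec A B S T P {..<I::nat} l Q" and c: "A_qc A B S T P = ereal (cost A B S T {..<I} l Q)"
    using A_qc_attained[OF fin P] by blast
  have "\<exists>X Y \<psi>. qc_model A B S T (Dnat A B S T (Q i)) X Y \<psi> (Q i)" if "i < I" for i
    using C_q_D_qc(2)[of "Q i" A B S T] d that by (auto simp: dec_def C_qc_dim_iff)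
  then obtain X Y \<psi> where m: "\<And>i. i < I \<Longrightarrow> qc_model A B S T (Dnat A B S T (Q i)) (X i) (Y i) (\<psi> i) (Q i)"
    by metis
  define V where "V i = (letter_val (X i) (Y i) (\<psi> i * adj (\<psi> i)) :: ('a, 'b, 's, 't) symb \<Rightarrow> fmat)" for i
  define D where "D i = Dnat A B S T (Q i)" for i
  define E where "E i w = wev (D i) (V i) w" for i w
  define \<phi> where "\<phi> w = (\<Sum>i<I. l i * Re (Tr (E i w)))" for w
  note mw = qc_model_word_feasible[OF m, folded D_def V_def, folded E_def]
  have wf: "word_feasible A B S T P \<phi>"
    unfolding \<phi>_def by (rule word_feasible_convex[where Q = Q]) (use d mw(1) in \<open>auto simp: dec_def\<close>)
  \<comment> \<open>K lists the real and imaginary parts of all entries in all blocks. The real part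
    of \<open>Tr (adj M * N)\<close> is their Euclidean inner product, which exhibits the moment
    matrix as a factorisation through K.\<close>
  define K where "K = (SIGMA i:{..<I}. {..<D i} \<times> {..<D i} \<times> (UNIV :: bool set))"
  define pr :: "bool \<Rightarrow> complex \<Rightarrow> real" where "pr p = (if p then Re else Im)" for p
  have "matrix_rank ?W (\<lambda>u v. \<phi> (rev u @ v)) < \<infinity>"
  proof (rule matrix_rank_finite[of K])
    show "finite K" by (simp add: K_def)
    fix u v assume u: "u \<in> ?W" and v: "v \<in> ?W"
    have "Re (Tr (E i (rev u @ v)))
      = (\<Sum>(j, k, p)\<in>{..<D i} \<times> {..<D i} \<times> UNIV. pr p (ent (E i u) k j) * pr p (ent (E i v) k j))"
      if i: "i < I" for i
    proof -
      have "E i (rev u @ v) = adj (E i u) * E i v" using mw(2,3)[OF i] u v by simp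
      moreover have "dimle (D i) (E i u)" "dimle (D i) (E i v)" using mw(2)[OF i] u v by blast+
      ultimately have "Tr (E i (rev u @ v)) = (\<Sum>j<D i. \<Sum>k<D i. cnj (ent (E i u) k j) * ent (E i v) k j)"
        by (simp add: Tr_dimle[OF dimle_times] ent_times_dimle[of "D i"])
      then show ?thesis
        by (simp add: sum.cartesian_product[symmetric] UNIV_bool pr_def add.commute)
    qed
    then have "\<phi> (rev u @ v) = (\<Sum>i<I. \<Sum>(j, k, p)\<in>{..<D i} \<times> {..<D i} \<times> UNIV.
        l i * (pr p (ent (E i u) k j) * pr p (ent (E i v) k j)))"
      by (simp add: \<phi>_def sum_distrib_left case_prod_unfold)
    also have "\<dots> = (\<Sum>(i, j, k, p)\<in>K. (l i * pr p (ent (E i u) k j)) * pr p (ent (E i v) k j))"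
      unfolding K_def by (subst sum.Sigma) (auto simp: case_prod_unfold mult.assoc)
    finally show "\<phi> (rev u @ v) = (\<Sum>q\<in>K. (case q of (i, j, k, p) \<Rightarrow> l i * pr p (ent (E i u) k j))
        * (case q of (i, j, k, p) \<Rightarrow> pr p (ent (E i v) k j)))"
      by (simp add: case_prod_unfold)
  qed
  from word_feasible_imp_xi_feasible[OF wf this] have "xi_feasible A B S T P (extend \<phi>)" .
  moreover have "extend \<phi> 1 = cost A B S T {..<I} l Q"
  proof -
    have "Tr (idm k) = of_nat k" for k by (simp add: Tr_dimle[OF dimle_idm] ent_idm)
    then show ?thesis by (simp add: one_mon \<phi>_def E_def cost_def D_def)
  qed
  ultimately show ?thesis using c by auto
qed

section \<open>The GNS construction\<close>

text \<open>A positive kernel of finite rank is a Gram matrix. A maximal independent set V of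
  columns spans all columns, and a maximal family of coefficient vectors on V that is orthonormal
  for the kernel provides the coordinates \<open>\<Sum>x\<in>V. a k x * M x u\<close> of a word
  u.\<close>

lemma psd_kernel_factorization:
  fixes M :: "'w \<Rightarrow> 'w \<Rightarrow> real"
  assumes sym: "\<And>u v. u \<in> W \<Longrightarrow> v \<in> W \<Longrightarrow> M u v = M v u"
    and pos: "\<And>U c. finite U \<Longrightarrow> U \<subseteq> W \<Longrightarrow> 0 \<le> (\<Sum>u\<in>U. \<Sum>v\<in>U. c u * c v * M u v)"
    and rank: "matrix_rank W M < \<infinity>"
  shows "\<exists>V (n::nat) a. finite V \<and> V \<subseteq> W \<and>
    (\<forall>u\<in>W. \<forall>v\<in>W. M u v = (\<Sum>k<n. (\<Sum>x\<in>V. a k x * M x u) * (\<Sum>x\<in>V. a k x * M x v))) \<and>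
    (\<forall>k<n. \<forall>l<n. (\<Sum>x\<in>V. \<Sum>y\<in>V. a k x * a l y * M x y) = (if k = l then 1 else 0))"
proof -
  define Ind where "Ind V \<longleftrightarrow> finite V \<and> V \<subseteq> W \<and>
    (\<forall>c. (\<forall>u\<in>W. (\<Sum>v\<in>V. c v * M u v) = 0) \<longrightarrow> (\<forall>v\<in>V. c v = 0))" for V
  obtain r where r: "matrix_rank W M = enat r" using rank by auto
  have bound: "card V < Suc r" if "Ind V" for V
  proof -
    have "enat (card V) \<le> matrix_rank W M"
      unfolding matrix_rank_def by (rule Sup_upper) (use that in \<open>auto simp: Ind_def\<close>)
    then show ?thesis by (simp add: r)
  qed
  have "Ind {}" by (simp add: Ind_def)
  then obtain V where V: "Ind V" and Vmax: "\<And>U. Ind U \<Longrightarrow> card U \<le> card V"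
    using ex_has_greatest_nat[of Ind "{}" card "Suc r"] bound by blast
  have fV: "finite V" and VW: "V \<subseteq> W" using V by (auto simp: Ind_def)
  have "\<exists>\<alpha>. \<forall>x\<in>W. M x u = (\<Sum>w\<in>V. \<alpha> w * M x w)" if u: "u \<in> W" for u
  proof (cases "u \<in> V")
    case True
    have "M x u = (\<Sum>w\<in>V. (if w = u then 1 else 0) * M x w)" for x
    proof -
      have "(\<Sum>w\<in>V. (if w = u then 1 else 0) * M x w) = (\<Sum>w\<in>V. if w = u then M x u else 0)"
        by (rule sum.cong) auto
      then show ?thesis using fV True by simp
    qed
    then show ?thesis by (intro exI[of _ "\<lambda>w. if w = u then 1 else 0"]) simp
  next
    case False
    have "\<not> Ind (insert u V)" using Vmax[of "insert u V"] False fV by auto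
    then obtain c where c: "\<forall>x\<in>W. (\<Sum>v\<in>insert u V. c v * M x v) = 0" "\<exists>v\<in>insert u V. c v \<noteq> 0"
      using fV VW u unfolding Ind_def by auto
    have c1: "c u * M x u + (\<Sum>v\<in>V. c v * M x v) = 0" if "x \<in> W" for x
      using c(1) that fV False by simp
    have "c u \<noteq> 0"
    proof
      assume 0: "c u = 0"
      then have "\<forall>x\<in>W. (\<Sum>v\<in>V. c v * M x v) = 0" using c1 by simp
      then have "\<forall>v\<in>V. c v = 0" using V unfolding Ind_def by blast
      then show False using c(2) 0 by auto
    qed
    then have "M x u = (\<Sum>w\<in>V. (- c w / c u) * M x w)" if "x \<in> W" for x
    proof -
      have "(\<Sum>w\<in>V. (- c w / c u) * M x w) = - (\<Sum>w\<in>V. c w * M x w) / c u"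
        by (simp add: sum_negf sum_divide_distrib)
      also have "\<dots> = M x u" using c1[OF that] \<open>c u \<noteq> 0\<close> by (simp add: field_simps)
      finally show ?thesis by simp
    qed
    then show ?thesis by (intro exI[of _ "\<lambda>w. - c w / c u"]) simp
  qed
  then obtain \<alpha> where \<alpha>: "\<And>u x. u \<in> W \<Longrightarrow> x \<in> W \<Longrightarrow> M x u = (\<Sum>w\<in>V. \<alpha> u w * M x w)" by metis
  \<comment> \<open>\<open>Bf\<close> is the semi-inner product on coefficient vectors over V, and
    \<open>Cf q x\<close> the pairing of x with the combination q.\<close>
  define Bf where "Bf p q = (\<Sum>x\<in>V. \<Sum>y\<in>V. p x * q y * M x y)" for p q :: "'w \<Rightarrow> real"
  define Cf where "Cf q x = (\<Sum>y\<in>V. q y * M x y)" for q :: "'w \<Rightarrow> real" and x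
  have Bf_Cf: "Bf p q = (\<Sum>x\<in>V. p x * Cf q x)" for p q
    by (simp add: Bf_def Cf_def sum_distrib_left mult.assoc)
  have Bsym: "Bf p q = Bf q p" for p q
    unfolding Bf_def by (subst sum.swap) (use sym VW in \<open>auto intro!: sum.cong simp: mult.commute subset_iff\<close>)
  have Cf': "Cf q x = (\<Sum>y\<in>V. q y * M y x)" if "x \<in> W" for q x
    unfolding Cf_def using sym VW that by (auto intro!: sum.cong simp: subset_iff)
  define ON where "ON n a \<longleftrightarrow> (\<forall>k<n. \<forall>l<n. Bf (a k) (a l) = (if k = l then 1 else 0))"
    for n :: nat and a :: "nat \<Rightarrow> 'w \<Rightarrow> real"
  have nb: "n < Suc (card V)" if "ON n a" for n a
  proof (rule ccontr)
    assume "\<not> n < Suc (card V)"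
    then obtain c where c: "\<exists>k\<in>{..<n}. c k \<noteq> 0" "\<forall>x\<in>V. (\<Sum>k\<in>{..<n}. c k * a k x) = 0"
      using linear_dependence[OF fV, of "{..<n}" "\<lambda>x k. a k x"] by auto
    then obtain k where k: "k < n" "c k \<noteq> 0" by auto
    have "0 = Bf (\<lambda>x. \<Sum>k<n. c k * a k x) (a k)"
      unfolding Bf_def using c(2) by simp
    also have "\<dots> = (\<Sum>x\<in>V. \<Sum>j<n. c j * (a j x * Cf (a k) x))"
      by (simp add: Bf_Cf sum_distrib_right mult.assoc)
    also have "\<dots> = (\<Sum>j<n. c j * Bf (a j) (a k))"
      by (subst sum.swap) (simp add: Bf_Cf sum_distrib_left)
    also have "\<dots> = (\<Sum>j<n. if j = k then c k else 0)"
      by (rule sum.cong) (use that k in \<open>auto simp: ON_def\<close>)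
    also have "\<dots> = c k" using k by simp
    finally show False using k by simp
  qed
  have "\<exists>a. ON 0 a" by (simp add: ON_def)
  then obtain n where n: "\<exists>a. ON n a" and nmax: "\<And>m. \<exists>a. ON m a \<Longrightarrow> m \<le> n"
    using ex_has_greatest_nat[of "\<lambda>n. \<exists>a. ON n a" 0 "\<lambda>n. n" "Suc (card V)"] nb by blast
  obtain a where a: "ON n a" using n by blast
  define f where "f k u = (\<Sum>x\<in>V. a k x * M x u)" for k u
  have fC: "f k u = Cf (a k) u" if "u \<in> W" for k u using Cf'[OF that] by (simp add: f_def)
  have main: "M u v = (\<Sum>k<n. f k u * f k v)" if u: "u \<in> W" and v: "v \<in> W" for u v
  proof -
    \<comment> \<open>q is the residual of v after projection to the orthonormal family. Maximality
      of the family makes its norm zero; positivity then makes its pairing with every u zero, which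
      is the claimed expansion.\<close>
    define q where "q w = \<alpha> v w - (\<Sum>k<n. f k v * a k w)" for w
    have Cq: "Cf q x = M x v - (\<Sum>k<n. f k v * f k x)" if x: "x \<in> W" for x
    proof -
      have "Cf q x = (\<Sum>y\<in>V. \<alpha> v y * M x y) - (\<Sum>y\<in>V. \<Sum>k<n. f k v * (a k y * M x y))"
        by (simp add: Cf_def q_def left_diff_distrib sum_subtractf sum_distrib_right mult.assoc)
      also have "(\<Sum>y\<in>V. \<Sum>k<n. f k v * (a k y * M x y)) = (\<Sum>k<n. f k v * Cf (a k) x)"
        by (subst sum.swap) (simp add: Cf_def sum_distrib_left)
      finally show ?thesis using \<alpha>[OF v x] fC[OF x] by simp
    qed
    have o: "Bf (a l) q = 0" if l: "l < n" for l
    proof -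
      have "Bf (a l) q = (\<Sum>x\<in>V. a l x * (M x v - (\<Sum>k<n. f k v * f k x)))"
        unfolding Bf_Cf by (rule sum.cong) (use Cq VW in auto)
      also have "\<dots> = f l v - (\<Sum>x\<in>V. \<Sum>k<n. f k v * (a l x * f k x))"
        by (simp add: f_def right_diff_distrib sum_subtractf sum_distrib_left mult.left_commute)
      also have "(\<Sum>x\<in>V. \<Sum>k<n. f k v * (a l x * f k x)) = (\<Sum>k<n. f k v * Bf (a l) (a k))"
        by (subst sum.swap) (use fC VW in \<open>auto intro!: sum.cong simp: Bf_Cf sum_distrib_left subset_iff\<close>)
      also have "\<dots> = (\<Sum>k<n. if k = l then f l v else 0)"
        by (rule sum.cong) (use a l in \<open>auto simp: ON_def\<close>)
      also have "\<dots> = f l v" using l by simp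
      finally show ?thesis by simp
    qed
    have qq: "Bf q q = 0"
    proof (rule ccontr)
      assume "Bf q q \<noteq> 0"
      moreover have "0 \<le> Bf q q" unfolding Bf_def by (rule pos[OF fV VW])
      ultimately have q0: "0 < Bf q q" by simp
      define q' where "q' w = q w / sqrt (Bf q q)" for w
      have s: "Bf p q' = Bf p q / sqrt (Bf q q)" "Bf q' p = Bf q p / sqrt (Bf q q)" for p
        by (simp_all add: Bf_def q'_def sum_divide_distrib)
      have "Bf q' q' = 1" using q0 by (simp add: s)
      moreover have "Bf (a l) q' = 0" "Bf q' (a l) = 0" if "l < n" for l
        using o[OF that] Bsym[of q "a l"] by (simp_all add: s)
      ultimately have "ON (Suc n) (a(n := q'))"
        using a by (auto simp: ON_def less_Suc_eq)
      then show False using nmax[of "Suc n"] by auto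
    qed
    have "Cf q u = 0"
    proof (rule ccontr)
      assume c0: "Cf q u \<noteq> 0"
      \<comment> \<open>Positivity of the kernel at the combination q + t u, where q contributes
        nothing to the quadratic part.\<close>
      have b: "0 \<le> 2 * t * Cf q u + t\<^sup>2 * M u u" for t
      proof -
        \<comment> \<open>As u may itself belong to V, its two coefficients are added.\<close>
        define c where "c w = (if w \<in> V then q w else 0) + (if w = u then t else 0)" for w
        have e: "(\<Sum>w\<in>insert u V. c w * g w) = (\<Sum>w\<in>V. q w * g w) + t * g u" for g :: "'w \<Rightarrow> real"
        proof -
          have "(\<Sum>w\<in>insert u V. c w * g w)
              = (\<Sum>w\<in>insert u V. (if w \<in> V then q w else 0) * g w) + (\<Sum>w\<in>insert u V. if w = u then t * g u else 0)"
            unfolding c_def distrib_right sum.distrib by (rule arg_cong2[where f = "(+)"]) (auto intro: sum.cong)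
          also have "(\<Sum>w\<in>insert u V. (if w \<in> V then q w else 0) * g w) = (\<Sum>w\<in>V. q w * g w)"
            using fV by (intro sum.mono_neutral_cong_right) auto
          finally show ?thesis using fV by simp
        qed
        have "0 \<le> (\<Sum>w\<in>insert u V. \<Sum>x\<in>insert u V. c w * c x * M w x)"
          using fV VW u by (intro pos) auto
        also have "\<dots> = (\<Sum>w\<in>insert u V. c w * (\<Sum>x\<in>insert u V. c x * M w x))"
          by (simp only: sum_distrib_left mult.assoc)
        also have "\<dots> = (\<Sum>w\<in>V. q w * (Cf q w + t * M w u)) + t * (Cf q u + t * M u u)"
          unfolding e Cf_def ..
        also have "\<dots> = Bf q q + t * (\<Sum>w\<in>V. q w * M w u) + t * (Cf q u + t * M u u)"
          by (simp add: Bf_Cf distrib_left sum.distrib sum_distrib_left mult.left_commute)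
        also have "\<dots> = 2 * t * Cf q u + t\<^sup>2 * M u u"
          using Cf'[OF u, of q] qq by (simp add: algebra_simps power2_eq_square)
        finally show ?thesis .
      qed
      have M0: "0 \<le> M u u" using pos[of "{u}" "\<lambda>_. 1"] u by simp
      \<comment> \<open>The summand 1 covers M u u = 0; with this step length the linear term
        outweighs the quadratic one.\<close>
      define r where "r = 1 / (M u u + 1)"
      define t where "t = - Cf q u * r"
      have r: "0 < r" "r * M u u \<le> 1" using M0 by (simp_all add: r_def divide_le_eq)
      have "2 * t * Cf q u + t\<^sup>2 * M u u = - ((Cf q u)\<^sup>2 * r * (2 - r * M u u))"
        by (simp add: t_def power2_eq_square algebra_simps)
      also have "\<dots> < 0" using c0 r by simp
      finally show False using b[of t] by simp
    qed
    then show ?thesis using Cq[OF u] by (simp add: mult.commute)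
  qed
  show ?thesis
    using fV VW main a unfolding f_def ON_def Bf_def by blast
qed

theorem GNS:
  fixes A :: "'a set" and B :: "'b set" and S :: "'s set" and T :: "'t set"
  defines "W \<equiv> nc_words A B S T"
  assumes wf: "word_feasible A B S T P \<phi>"
    and rank: "matrix_rank W (\<lambda>u v. \<phi> (rev u @ v)) < \<infinity>"
  shows "\<exists>n (\<pi> :: ('a, 'b, 's, 't) symb list \<Rightarrow> fmat) \<omega>.
    (\<forall>u\<in>W. dimle n (\<pi> u) \<and> \<pi> (rev u) = adj (\<pi> u) \<and>
      Tr (adj \<omega> * \<pi> u * \<omega>) = complex_of_real (\<phi> u)) \<and>
    (\<forall>u\<in>W. \<forall>v\<in>W. \<pi> (u @ v) = \<pi> u * \<pi> v) \<and> \<pi> [] = idm n \<and>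
    (\<forall>g\<in>W. length g \<le> 1 \<longrightarrow> psd (\<pi> g)) \<and>
    (\<forall>r\<in>W. \<forall>R\<subseteq>W. (\<forall>u\<in>W. \<phi> (u @ r) = (\<Sum>x\<in>R. \<phi> (u @ x))) \<longrightarrow> \<pi> r = (\<Sum>x\<in>R. \<pi> x))"
proof -
  note w = word_feasibleD[OF wf, folded W_def]
  have Wr: "rev u \<in> W \<longleftrightarrow> u \<in> W" and Wa: "u @ v \<in> W \<longleftrightarrow> u \<in> W \<and> v \<in> W" and WN: "[] \<in> W" for u v
    by (simp_all add: W_def)
  define M where "M u v = \<phi> (rev u @ v)" for u v
  have sym: "M u v = M v u" if "u \<in> W" "v \<in> W" for u v
    using w(1)[rule_format, of "rev u @ v"] that by (simp add: M_def Wr Wa)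
  have pos: "0 \<le> (\<Sum>u\<in>U. \<Sum>v\<in>U. c u * c v * M u v)" if "finite U" "U \<subseteq> W" for U c
    using w(5)[rule_format, OF WN, of U c] that by (simp add: M_def)
  have "\<exists>V (n::nat) a. finite V \<and> V \<subseteq> W \<and>
    (\<forall>u\<in>W. \<forall>v\<in>W. M u v = (\<Sum>k<n. (\<Sum>x\<in>V. a k x * M x u) * (\<Sum>x\<in>V. a k x * M x v))) \<and>
    (\<forall>k<n. \<forall>l<n. (\<Sum>x\<in>V. \<Sum>y\<in>V. a k x * a l y * M x y) = (if k = l then 1 else 0))"
    by (rule psd_kernel_factorization[of W M])
      (use sym pos rank in \<open>simp_all add: M_def[abs_def]\<close>)
  then obtain V and n :: nat and a where V: "finite V" "V \<subseteq> W"
    and fac: "\<forall>u\<in>W. \<forall>v\<in>W. M u v = (\<Sum>k<n. (\<Sum>x\<in>V. a k x * M x u) * (\<Sum>x\<in>V. a k x * M x v))"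
    and on: "\<forall>k<n. \<forall>l<n. (\<Sum>x\<in>V. \<Sum>y\<in>V. a k x * a l y * M x y) = (if k = l then 1 else 0)"
    by (elim exE conjE) (rule that)
  have VW: "x \<in> W" if "x \<in> V" for x using V that by blast
  define f where "f k u = (\<Sum>x\<in>V. a k x * M x u)" for k u
  have fac': "M u v = (\<Sum>k<n. f k u * f k v)" if "u \<in> W" "v \<in> W" for u v
    using fac that by (simp add: f_def)
  \<comment> \<open>The matrix of left multiplication by u in the orthonormal family a.\<close>
  define p where "p u k l = (\<Sum>x\<in>V. \<Sum>y\<in>V. a k x * a l y * \<phi> (rev x @ u @ y))" for u k l
  define \<pi> where "\<pi> u = mk n (\<lambda>k l. complex_of_real (p u k l))" for u
  have p1: "p u k l = (\<Sum>x\<in>V. a k x * f l (rev u @ x))" if u: "u \<in> W" for u k l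
  proof -
    have "(\<Sum>y\<in>V. a k x * a l y * \<phi> (rev x @ u @ y)) = a k x * f l (rev u @ x)" if x: "x \<in> V" for x
    proof -
      have "a k x * a l y * \<phi> (rev x @ u @ y) = a k x * (a l y * M y (rev u @ x))" if "y \<in> V" for y
        using sym[of "rev u @ x" y] VW[OF x] VW[OF that] u by (simp add: M_def Wa Wr)
      then show ?thesis unfolding f_def sum_distrib_left by (intro sum.cong refl)
    qed
    then show ?thesis unfolding p_def by (intro sum.cong refl)
  qed
  have p2: "p u k l = (\<Sum>y\<in>V. a l y * f k (u @ y))" for u k l
    unfolding p_def by (subst sum.swap) (simp add: f_def M_def sum_distrib_left mult_ac)
  \<comment> \<open>The word u is moved to the left argument as its reverse, v stays on the right;
    the factorisation of the kernel then sums over the orthonormal family like a resolution of the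
    identity.\<close>
  have pmult: "(\<Sum>m<n. p u k m * p v m l) = p (u @ v) k l" if u: "u \<in> W" and v: "v \<in> W" for u v k l
  proof -
    have "(\<Sum>m<n. p u k m * p v m l)
        = (\<Sum>m<n. \<Sum>x\<in>V. \<Sum>y\<in>V. a k x * a l y * (f m (rev u @ x) * f m (v @ y)))"
      unfolding p1[OF u] p2[of v] sum_product by (simp add: mult_ac)
    also have "\<dots> = (\<Sum>x\<in>V. \<Sum>m<n. \<Sum>y\<in>V. a k x * a l y * (f m (rev u @ x) * f m (v @ y)))"
      by (rule sum.swap)
    also have "\<dots> = (\<Sum>x\<in>V. \<Sum>y\<in>V. a k x * a l y * (\<Sum>m<n. f m (rev u @ x) * f m (v @ y)))"
      by (rule sum.cong[OF refl], subst sum.swap) (simp add: sum_distrib_left)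
    also have "\<dots> = (\<Sum>x\<in>V. \<Sum>y\<in>V. a k x * a l y * M (rev u @ x) (v @ y))"
      by (intro sum.cong refl) (use fac' VW u v in \<open>simp add: Wa Wr\<close>)
    also have "\<dots> = p (u @ v) k l" by (simp add: p_def M_def)
    finally show ?thesis .
  qed
  have prev: "p (rev u) k l = p u l k" if u: "u \<in> W" for u k l
    unfolding p_def
  proof (subst sum.swap, intro sum.cong refl)
    fix x y assume "x \<in> V" "y \<in> V"
    then show "a k y * a l x * \<phi> (rev y @ rev u @ x) = a l x * a k y * \<phi> (rev x @ u @ y)"
      using w(1)[rule_format, of "rev y @ rev u @ x"] VW u by (simp add: Wa Wr)
  qed
  have dm: "dimle n (\<pi> u)" for u by (simp add: \<pi>_def)
  have rev: "\<pi> (rev u) = adj (\<pi> u)" if "u \<in> W" for u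
    by (rule fmat_eqI) (simp add: \<pi>_def prev[OF that])
  have mult: "\<pi> (u @ v) = \<pi> u * \<pi> v" if "u \<in> W" "v \<in> W" for u v
  proof (rule fmat_eqI)
    fix k l
    show "ent (\<pi> (u @ v)) k l = ent (\<pi> u * \<pi> v) k l"
      using pmult[OF that, of k l] unfolding ent_times_dimle[OF dm]
      by (auto simp: \<pi>_def of_real_mult[symmetric] of_real_sum[symmetric] simp del: of_real_mult of_real_sum)
  qed
  have one: "\<pi> [] = idm n"
  proof (rule fmat_eqI)
    fix k l
    have "p [] k l = (if k = l then 1 else 0)" if "k < n" "l < n"
      using on that by (simp add: p_def M_def)
    then show "ent (\<pi> []) k l = ent (idm n) k l"
      by (cases "k < n \<and> l < n") (auto simp: \<pi>_def ent_idm)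
  qed
  define \<omega> where "\<omega> = colm n (\<lambda>k. complex_of_real (f k []))"
  have val: "Tr (adj \<omega> * \<pi> u * \<omega>) = complex_of_real (\<phi> u)" if u: "u \<in> W" for u
  proof -
    have inner: "(\<Sum>l<n. p u k l * f l []) = f k u" for k
    proof -
      have "(\<Sum>l<n. p u k l * f l []) = (\<Sum>l<n. \<Sum>x\<in>V. a k x * (f l (rev u @ x) * f l []))"
        by (simp add: p1[OF u] sum_distrib_right mult.assoc)
      also have "\<dots> = (\<Sum>x\<in>V. a k x * (\<Sum>l<n. f l (rev u @ x) * f l []))"
        by (subst sum.swap) (simp add: sum_distrib_left)
      also have "\<dots> = (\<Sum>x\<in>V. a k x * M (rev u @ x) [])"
        by (rule sum.cong[OF refl]) (use fac' VW u WN in \<open>simp add: Wa Wr\<close>)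
      finally show ?thesis by (simp add: f_def M_def)
    qed
    have "Tr (adj \<omega> * \<pi> u * \<omega>) = (\<Sum>k<n. \<Sum>l<n. complex_of_real (f k [] * (p u k l * f l [])))"
      unfolding \<omega>_def Tr_colm[OF dm] by (simp add: mv_def \<pi>_def sum_distrib_left)
    also have "\<dots> = complex_of_real (\<Sum>k<n. f k [] * (\<Sum>l<n. p u k l * f l []))"
      by (simp add: sum_distrib_left)
    also have "\<dots> = complex_of_real (\<Sum>k<n. f k [] * f k u)" by (simp only: inner)
    also have "(\<Sum>k<n. f k [] * f k u) = \<phi> u" using fac'[OF WN u] by (simp add: M_def)
    finally show ?thesis .
  qed
  have psd: "psd (\<pi> g)" if g: "g \<in> W" "length g \<le> 1" for g
    unfolding psd_iff_sum[OF dm]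
  proof
    fix v :: "nat \<Rightarrow> complex"
    have "rev g = g" using g(2) by (cases g) auto
    then have ps: "p g k l = p g l k" for k l using prev[OF g(1), of k l] by simp
    have pr: "0 \<le> (\<Sum>k<n. \<Sum>l<n. r k * p g k l * r l)" for r :: "nat \<Rightarrow> real"
    proof -
      define c where "c x = (\<Sum>k<n. r k * a k x)" for x
      have "0 \<le> (\<Sum>x\<in>V. \<Sum>y\<in>V. c x * c y * \<phi> (rev x @ g @ y))"
        using w(5) g V by blast
      also have "\<dots> = (\<Sum>x\<in>V. \<Sum>y\<in>V. \<Sum>k<n. \<Sum>l<n. r k * (a k x * a l y * \<phi> (rev x @ g @ y)) * r l)"
        unfolding c_def sum_product unfolding sum_distrib_right
        by ((rule sum.cong[OF refl])+) (simp add: mult_ac)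
      also have "\<dots> = (\<Sum>x\<in>V. \<Sum>k<n. \<Sum>l<n. \<Sum>y\<in>V. r k * (a k x * a l y * \<phi> (rev x @ g @ y)) * r l)"
        by (rule sum.cong[OF refl], subst sum.swap, rule sum.cong[OF refl], rule sum.swap)
      also have "\<dots> = (\<Sum>k<n. \<Sum>l<n. \<Sum>x\<in>V. \<Sum>y\<in>V. r k * (a k x * a l y * \<phi> (rev x @ g @ y)) * r l)"
        by (subst sum.swap, rule sum.cong[OF refl], rule sum.swap)
      also have "\<dots> = (\<Sum>k<n. \<Sum>l<n. r k * p g k l * r l)"
        by (simp add: p_def sum_distrib_left sum_distrib_right)
      finally show ?thesis .
    qed
    let ?s = "\<Sum>k<n. \<Sum>l<n. cnj (v k) * ent (\<pi> g) k l * v l"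
    \<comment> \<open>The form is real and symmetric, so its value at a complex vector is the sum of
      its values at the real and imaginary parts, and the cross terms cancel.\<close>
    have "Re ?s = (\<Sum>k<n. \<Sum>l<n. Re (v k) * p g k l * Re (v l)) + (\<Sum>k<n. \<Sum>l<n. Im (v k) * p g k l * Im (v l))"
      unfolding sum.distrib[symmetric] by (simp add: \<pi>_def algebra_simps)
    then have "0 \<le> Re ?s" using pr[of "\<lambda>k. Re (v k)"] pr[of "\<lambda>k. Im (v k)"] by simp
    moreover have "Im ?s = (\<Sum>k<n. \<Sum>l<n. Re (v k) * p g k l * Im (v l)) - (\<Sum>k<n. \<Sum>l<n. Im (v k) * p g k l * Re (v l))"
      unfolding sum_subtractf[symmetric] by (simp add: \<pi>_def algebra_simps)
    moreover have "(\<Sum>k<n. \<Sum>l<n. Im (v k) * p g k l * Re (v l)) = (\<Sum>k<n. \<Sum>l<n. Re (v k) * p g k l * Im (v l))"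
      by (subst sum.swap) (simp add: ps mult_ac)
    ultimately show "0 \<le> ?s" by (simp add: less_eq_complex_def)
  qed
  have rel: "\<pi> r = (\<Sum>x\<in>R. \<pi> x)"
    if r: "r \<in> W" and R: "R \<subseteq> W" and eq: "\<And>u. u \<in> W \<Longrightarrow> \<phi> (u @ r) = (\<Sum>x\<in>R. \<phi> (u @ x))" for r R
  proof -
    have "\<phi> (rev x @ r @ y) = (\<Sum>q\<in>R. \<phi> (rev x @ q @ y))" if xy: "x \<in> V" "y \<in> V" for x y
    proof -
      \<comment> \<open>Traciality moves the right context y to the front, so relations assumed only
        for left multiples hold between arbitrary words on both sides.\<close>
      have t: "\<phi> (rev x @ q @ y) = \<phi> ((y @ rev x) @ q)" if "q \<in> W" for q
        using w(2)[rule_format, of "rev x @ q" y] VW xy that by (simp add: Wa Wr)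
      have "\<phi> (rev x @ r @ y) = (\<Sum>q\<in>R. \<phi> ((y @ rev x) @ q))"
        unfolding t[OF r] by (rule eq) (use VW xy in \<open>simp add: Wa Wr\<close>)
      also have "\<dots> = (\<Sum>q\<in>R. \<phi> (rev x @ q @ y))"
        by (rule sum.cong[OF refl]) (use t R in auto)
      finally show ?thesis .
    qed
    then have "p r k l = (\<Sum>x\<in>V. \<Sum>y\<in>V. \<Sum>q\<in>R. a k x * a l y * \<phi> (rev x @ q @ y))" for k l
      by (simp add: p_def sum_distrib_left)
    moreover have "(\<Sum>x\<in>V. \<Sum>y\<in>V. \<Sum>q\<in>R. a k x * a l y * \<phi> (rev x @ q @ y)) = (\<Sum>q\<in>R. p q k l)" for k l
    proof -
      have "(\<Sum>x\<in>V. \<Sum>y\<in>V. \<Sum>q\<in>R. a k x * a l y * \<phi> (rev x @ q @ y))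
          = (\<Sum>x\<in>V. \<Sum>q\<in>R. \<Sum>y\<in>V. a k x * a l y * \<phi> (rev x @ q @ y))"
        by (rule sum.cong[OF refl], rule sum.swap)
      also have "\<dots> = (\<Sum>q\<in>R. p q k l)" unfolding p_def by (rule sum.swap)
      finally show ?thesis .
    qed
    ultimately have pr: "p r k l = (\<Sum>q\<in>R. p q k l)" for k l by simp
    show ?thesis
    proof (rule fmat_eqI)
      fix k l
      show "ent (\<pi> r) k l = ent (\<Sum>x\<in>R. \<pi> x) k l"
        by (cases "k < n \<and> l < n") (auto simp: \<pi>_def pr)
    qed
  qed
  show ?thesis
    using dm rev mult one val psd rel by (intro exI[of _ n] exI[of _ \<pi>] exI[of _ \<omega>]) simp
qed

section \<open>Feasible functionals yield decompositions\<close>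

text \<open>The point is nonnegativity of the values. A product of commuting positive matrices is
  handled by passing to the tensor product, where \<open>psd_kr\<close> applies.\<close>

lemma qc_model_exists:
  assumes X: "\<And>s. s \<in> S \<Longrightarrow> povm d A (X s)" and Y: "\<And>t. t \<in> T \<Longrightarrow> povm d B (Y t)"
    and XY: "\<And>a b s t. a \<in> A \<Longrightarrow> b \<in> B \<Longrightarrow> s \<in> S \<Longrightarrow> t \<in> T \<Longrightarrow> X s a * Y t b = Y t b * X s a"
    and \<psi>: "idm d * \<psi> = \<psi>" "\<psi> * idm 1 = \<psi>" "Tr (adj \<psi> * \<psi>) = 1"
  defines "Q \<equiv> \<lambda>a b s t. Re (Tr (adj \<psi> * (X s a * Y t b) * \<psi>))"
  shows "qc_model A B S T d X Y \<psi> Q" "correlation A B S T Q"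
proof -
  define XX where "XX = {X s a | s a. s \<in> S \<and> a \<in> A}"
  define YY where "YY = {Y t b | t b. t \<in> T \<and> b \<in> B}"
  have dX: "dimle d (X s a) \<and> psd (X s a)" if "s \<in> S" "a \<in> A" for s a
    using X[OF that(1)] that by (simp add: povm_def)
  have dY: "dimle d (Y t b) \<and> psd (Y t b)" if "t \<in> T" "b \<in> B" for t b
    using Y[OF that(1)] that by (simp add: povm_def)
  obtain R where R: "dimle (d * d) R"
    "\<And>x y. x \<in> XX \<Longrightarrow> y \<in> YY \<Longrightarrow> Tr (adj R * kr d d x y * R) = Tr (adj \<psi> * (x * y) * \<psi>)"
  proof (rule commuting_to_tensor[of XX d YY \<psi>])
    show "dimle d x \<and> adj x = x" if "x \<in> XX" for x
      using that dX psd_adj_eq by (auto simp: XX_def)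
    show "dimle d y" if "y \<in> YY" for y using that dY by (auto simp: YY_def)
    show "x * y = y * x" if "x \<in> XX" "y \<in> YY" for x y
      using that XY by (auto simp: XX_def YY_def)
  qed (rule that; assumption)
  have nn: "0 \<le> Tr (adj \<psi> * (X s a * Y t b) * \<psi>)" if "a \<in> A" "b \<in> B" "s \<in> S" "t \<in> T" for a b s t
  proof -
    have "psd (kr d d (X s a) (Y t b))" using that dX dY by (intro psd_kr) auto
    then have "0 \<le> Tr (adj R * kr d d (X s a) (Y t b) * R)" by (simp add: psd_def)
    moreover have "X s a \<in> XX" "Y t b \<in> YY" using that unfolding XX_def YY_def by blast+
    ultimately show ?thesis using R(2) by simp
  qed
  show "qc_model A B S T d X Y \<psi> Q"
    unfolding qc_model_def
  proof (intro conjI ballI)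
    fix a b s t assume "a \<in> A" "b \<in> B" "s \<in> S" "t \<in> T"
    then show "complex_of_real (Q a b s t) = Tr (adj \<psi> * (X s a * Y t b) * \<psi>)"
      using complex_nonneg_real[OF nn] by (simp add: Q_def)
  qed (use assms in auto)
  show "correlation A B S T Q"
    unfolding correlation_def
  proof (intro conjI ballI)
    fix a b s t assume "a \<in> A" "b \<in> B" "s \<in> S" "t \<in> T"
    then show "0 \<le> Q a b s t" using nn by (simp add: Q_def less_eq_complex_def)
  next
    fix s t assume st: "s \<in> S" "t \<in> T"
    have "(\<Sum>a\<in>A. \<Sum>b\<in>B. Tr (adj \<psi> * (X s a * Y t b) * \<psi>))
        = Tr (adj \<psi> * ((\<Sum>a\<in>A. X s a) * (\<Sum>b\<in>B. Y t b)) * \<psi>)"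
      by (simp add: sum_product) (simp add: sum_distrib_left sum_distrib_right)
    also have "\<dots> = 1" using X[OF st(1)] Y[OF st(2)] \<psi> by (simp add: povm_def mult.assoc)
    finally have "Re (\<Sum>a\<in>A. \<Sum>b\<in>B. Tr (adj \<psi> * (X s a * Y t b) * \<psi>)) = 1" by simp
    then show "(\<Sum>a\<in>A. \<Sum>b\<in>B. Q a b s t) = 1" by (simp add: Q_def)
  qed
qed

section \<open>Left ideals of minimal projections\<close>

context star_alg
begin

text \<open>The b k are partial isometries with initial projection e, an orthonormal basis of the
  left ideal of e; the last clause says that the sum of their range projections fixes this ideal. A
  maximal family works, because the residual of an element not fixed could be normalised and
  added.\<close>

lemma matrix_units:
  assumes e: "e \<in> B" "adj e = e" "e * e = e" "e \<noteq> 0"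
    and min: "\<forall>x\<in>B. \<exists>c. e * x * e = c *\<^sub>C e"
  shows "\<exists>m b. (\<forall>k<m. b k \<in> B \<and> b k * e = b k) \<and>
    (\<forall>k<m. \<forall>l<m. adj (b k) * b l = (if k = l then e else 0)) \<and>
    (\<forall>x\<in>B. x * e = x \<longrightarrow> x = (\<Sum>k<(m::nat). b k * adj (b k)) * x)"
proof -
  define Q where "Q m b \<longleftrightarrow> (\<forall>k<m. b k \<in> B \<and> b k * e = b k) \<and>
    (\<forall>k<m. \<forall>l<m. adj (b k) * b l = (if k = l then e else 0))" for m :: nat and b :: "nat \<Rightarrow> fmat"
  have bd: "m < Suc (n * n)" if "Q m b" for m b
  proof -
    have "b k \<noteq> 0" if "k < m" for k using \<open>Q m b\<close> that e(4) unfolding Q_def by force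
    then have "card {..<m} \<le> n * n"
      using that dim by (intro orthogonal_family_card[of _ n b]) (auto simp: Q_def)
    then show ?thesis by simp
  qed
  have "\<exists>b. Q 0 b" by (simp add: Q_def)
  then obtain m where m: "\<exists>b. Q m b" and mmax: "\<And>k. \<exists>b. Q k b \<Longrightarrow> k \<le> m"
    using ex_has_greatest_nat[of "\<lambda>m. \<exists>b. Q m b" 0 "\<lambda>m. m" "Suc (n * n)"] bd by blast
  obtain b where b: "Q m b" using m by blast
  have "x = (\<Sum>k<m. b k * adj (b k)) * x" if x: "x \<in> B" "x * e = x" for x
  proof (rule ccontr)
    define r where "r = x - (\<Sum>k<m. b k * adj (b k)) * x"
    assume "x \<noteq> (\<Sum>k<m. b k * adj (b k)) * x"
    then have r0: "r \<noteq> 0" by (simp add: r_def)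
    have rB: "r \<in> B" unfolding r_def using b x by (intro diff mult sum adj) (auto simp: Q_def)
    have re: "r * e = r" by (simp add: r_def left_diff_distrib mult.assoc x(2))
    have er: "e * adj r = adj r" using arg_cong[OF re, of adj] e(2) by simp
    have br: "adj (b l) * r = 0" if l: "l < m" for l
    proof -
      have "adj (b l) * ((\<Sum>k<m. b k * adj (b k)) * x) = (\<Sum>k<m. (adj (b l) * b k) * (adj (b k) * x))"
        by (simp add: sum_distrib_left sum_distrib_right mult.assoc)
      also have "\<dots> = (\<Sum>k<m. if k = l then e * (adj (b l) * x) else 0)"
        by (rule sum.cong) (use b l in \<open>auto simp: Q_def\<close>)
      also have "\<dots> = (e * adj (b l)) * x" using l by (simp add: mult.assoc)
      also have "e * adj (b l) = adj (b l)"
        using b l e(2) unfolding Q_def by (metis adj_mult)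
      finally show ?thesis by (simp add: r_def right_diff_distrib)
    qed
    \<comment> \<open>Minimality of e makes \<open>adj r * r\<close> a multiple of e, with positive
      factor since r is nonzero. Scaling r therefore gives w with
      \<open>adj w * w = e\<close>.\<close>
    obtain c where c: "e * (adj r * r) * e = c *\<^sub>C e" using min mult[OF adj[OF rB] rB] by blast
    have rr: "adj r * r = c *\<^sub>C e"
      using c er re by (metis mult.assoc)
    have "0 < Tr (adj r * r)" "0 < Tr e" using Tr_adj_self_pos r0 e by metis+
    then have "0 < Re c * Re (Tr e)" "Im c * Re (Tr e) = 0" "0 < Re (Tr e)" 
      by (auto simp: rr less_complex_def)
    then have cp: "0 < Re c" "c = complex_of_real (Re c)"
      by (auto simp: zero_less_mult_iff complex_eq_iff)
    define t where "t = Re c"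
    have t: "0 < t" "adj r * r = complex_of_real t *\<^sub>C e" using cp rr by (simp_all add: t_def)
    define w where "w = complex_of_real (1 / sqrt t) *\<^sub>C r"
    have "complex_of_real (1 / sqrt t) * (complex_of_real (1 / sqrt t) * complex_of_real t)
      = complex_of_real (1 / sqrt t * (1 / sqrt t * t))" by (simp only: of_real_mult)
    also have "1 / sqrt t * (1 / sqrt t * t) = 1" using t(1) by (simp add: field_simps)
    finally have ww: "adj w * w = e" by (simp add: w_def t(2) del: of_real_divide)
    have bw: "adj (b l) * w = 0" "adj w * b l = 0" if "l < m" for l
    proof -
      show "adj (b l) * w = 0" using br[OF that] by (simp add: w_def)
      from arg_cong[OF this, of adj] show "adj w * b l = 0" by simp
    qed
    have wB: "w \<in> B" "w * e = w" using rB re by (simp_all add: w_def scale)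
    have "Q (Suc m) (b(m := w))"
      using b wB ww bw by (auto simp: Q_def less_Suc_eq)
    then show False using mmax[of "Suc m"] by auto
  qed
  with b show ?thesis unfolding Q_def by blast
qed

end

text \<open>The left ideal generated by a minimal projection \<open>e\<close> is a Hilbert space with orthonormal
  basis \<open>b k\<close>, on which the algebra acts by left multiplication; \<open>\<psi>\<close> represents \<open>e\<close> itself.\<close>

lemma minimal_projection_representation:
  assumes "star_alg n \<A>" and I: "idm n \<in> \<A>"
    and e: "e \<in> \<A>" "adj e = e" "e * e = e" "e \<noteq> 0"
    and minimal: "\<forall>x\<in>\<A>. \<exists>c. e * x * e = c *\<^sub>C e"
    and basis: "\<forall>k<m. b k \<in> \<A> \<and> b k * e = b k"
      "\<forall>k<m. \<forall>l<m. adj (b k) * b l = (if k = l then e else 0)"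
      "\<forall>x\<in>\<A>. x * e = x \<longrightarrow> x = (\<Sum>k<m. b k * adj (b k)) * x"
  defines "\<rho> \<equiv> \<lambda>x. mk m (\<lambda>k l. Tr (adj (b k) * x * b l) / Tr e)"
    and "\<psi> \<equiv> colm m (\<lambda>k. Tr (adj (b k) * e) / Tr e)"
  shows "dimle m (\<rho> x)" "\<rho> (idm n) = idm m"
    "x \<in> \<A> \<Longrightarrow> y \<in> \<A> \<Longrightarrow> \<rho> (x * y) = \<rho> x * \<rho> y"
    "\<rho> (\<Sum>i\<in>F. f i) = (\<Sum>i\<in>F. \<rho> (f i))"
    "x \<in> \<A> \<Longrightarrow> psd x \<Longrightarrow> psd (\<rho> x)"
    "x \<in> \<A> \<Longrightarrow> e * x * e = Tr (adj \<psi> * \<rho> x * \<psi>) *\<^sub>C e"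
    "Tr (adj \<psi> * \<psi>) = 1"
proof -
  interpret star_alg n \<A> by fact
  note min = minimal[rule_format] and b = basis(1)[rule_format] and on = basis(2)[rule_format]
    and span = basis(3)[rule_format]
  have te: "0 < Tr e" using Tr_adj_self_pos[OF e(4)] e by simp
  then have te0: "Tr e \<noteq> 0" by auto
  show dm: "dimle m (\<rho> x)" for x by (simp add: \<rho>_def)
  have eb: "e * adj (b k) = adj (b k)" if "k < m" for k
    using b[OF that] e(2) by (metis adj_mult)
  \<comment> \<open>Both outer factors absorb e, so the product is a compression by e and hence a
    multiple of e; the trace recovers the factor.\<close>
  have coeff: "adj (b k) * x * b l = (Tr (adj (b k) * x * b l) / Tr e) *\<^sub>C e"
    if "k < m" "l < m" "x \<in> \<A>" for k l x
  proof -
    have "adj (b k) * x * b l = e * (adj (b k) * x * b l) * e"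
      using eb[OF that(1)] b[OF that(2)] by (metis mult.assoc)
    moreover have "adj (b k) * x * b l \<in> \<A>" using b that by (intro mult adj) auto
    from min[OF this] obtain c where "e * (adj (b k) * x * b l) * e = c *\<^sub>C e" by blast
    ultimately have "adj (b k) * x * b l = c *\<^sub>C e" by simp
    then show ?thesis using te0 by simp
  qed
  have ce: "adj (b k) * x * b l = ent (\<rho> x) k l *\<^sub>C e" if "k < m" "l < m" "x \<in> \<A>" for k l x
    using coeff[OF that] that by (simp add: \<rho>_def)
  have tc: "Tr (adj (b k) * x * b l) = ent (\<rho> x) k l * Tr e" if "k < m" "l < m" "x \<in> \<A>" for k l x
    using ce[OF that] by simp
  show one: "\<rho> (idm n) = idm m"
  proof (rule fmat_eqI)
    fix k l
    show "ent (\<rho> (idm n)) k l = ent (idm m) k l"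
    proof (cases "k < m \<and> l < m")
      case True
      then have "adj (b k) * idm n * b l = (if k = l then e else 0)"
        using on b dim by (simp add: times_idm)
      then show ?thesis using True te0 by (simp add: \<rho>_def ent_idm)
    next
      case False
      then show ?thesis by (auto simp: \<rho>_def ent_idm)
    qed
  qed
  show "\<rho> (x * y) = \<rho> x * \<rho> y" if x: "x \<in> \<A>" and y: "y \<in> \<A>"
  proof (rule fmat_eqI)
    fix k l
    show "ent (\<rho> (x * y)) k l = ent (\<rho> x * \<rho> y) k l"
    proof (cases "k < m \<and> l < m")
      case True
      \<comment> \<open>As y * b l lies in the left ideal of e, the sum of the
        \<open>b j * adj (b j)\<close> acts on it as the identity and can be inserted between x and
        y.\<close>
      have "y * b l = (\<Sum>j<m. b j * adj (b j)) * (y * b l)"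
        by (rule span) (use True b y mult in \<open>auto simp: mult.assoc\<close>)
      then have "adj (b k) * (x * y) * b l = adj (b k) * x * ((\<Sum>j<m. b j * adj (b j)) * (y * b l))"
        by (simp add: mult.assoc)
      also have "\<dots> = (\<Sum>j<m. (adj (b k) * x * b j) * (adj (b j) * y * b l))"
        by (simp add: sum_distrib_left sum_distrib_right mult.assoc)
      also have "\<dots> = (\<Sum>j<m. (ent (\<rho> x) k j * ent (\<rho> y) j l) *\<^sub>C e)"
        by (rule sum.cong) (use True ce x y e(3) in auto)
      finally have "Tr (adj (b k) * (x * y) * b l) = (\<Sum>j<m. ent (\<rho> x) k j * ent (\<rho> y) j l) * Tr e"
        by (simp add: sum_distrib_right)
      then have "ent (\<rho> (x * y)) k l = (\<Sum>j<m. ent (\<rho> x) k j * ent (\<rho> y) j l)"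
        using True te0 by (simp add: \<rho>_def)
      then show ?thesis by (simp add: ent_times_dimle[OF dm])
    next
      case False
      then show ?thesis using dimle_times[OF dm dm, of x y] dm[of "x * y"] unfolding dimle_def by metis
    qed
  qed
  show "\<rho> (\<Sum>i\<in>F. f i) = (\<Sum>i\<in>F. \<rho> (f i))"
  proof (rule fmat_eqI)
    fix k l
    show "ent (\<rho> (\<Sum>i\<in>F. f i)) k l = ent (\<Sum>i\<in>F. \<rho> (f i)) k l"
      by (cases "k < m \<and> l < m")
        (auto simp: \<rho>_def sum_distrib_left sum_distrib_right sum_divide_distrib)
  qed
  have quad: "Tr (adj (\<Sum>k<m. v k *\<^sub>C b k) * x * (\<Sum>l<m. u l *\<^sub>C b l))
      = (\<Sum>k<m. \<Sum>l<m. cnj (v k) * ent (\<rho> x) k l * u l) * Tr e" if "x \<in> \<A>" for u v x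
  proof -
    have "Tr (adj (\<Sum>k<m. v k *\<^sub>C b k) * x * (\<Sum>l<m. u l *\<^sub>C b l))
        = (\<Sum>k<m. cnj (v k) * Tr (adj (b k) * x * (\<Sum>l<m. u l *\<^sub>C b l)))"
      by (simp add: sum_distrib_right)
    also have "\<dots> = (\<Sum>k<m. cnj (v k) * (\<Sum>l<m. u l * Tr (adj (b k) * x * b l)))"
      by (simp add: sum_distrib_left)
    also have "\<dots> = (\<Sum>k<m. \<Sum>l<m. cnj (v k) * ent (\<rho> x) k l * u l * Tr e)"
      unfolding sum_distrib_left by (intro sum.cong refl) (use tc that in \<open>auto simp: mult_ac\<close>)
    finally show ?thesis by (simp add: sum_distrib_right)
  qed
  show "psd (\<rho> x)" if x: "x \<in> \<A>" "psd x"
    unfolding psd_iff_sum[OF dm]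
  proof
    fix v :: "nat \<Rightarrow> complex"
    let ?s = "\<Sum>k<m. \<Sum>l<m. cnj (v k) * ent (\<rho> x) k l * v l"
    have "0 \<le> ?s * Tr e" using x(2) quad[OF x(1), of v v] unfolding psd_def by metis
    then show "0 \<le> ?s"
      using te by (auto simp: less_eq_complex_def less_complex_def zero_le_mult_iff)
  qed
  define v where "v k = Tr (adj (b k) * e) / Tr e" for k
  have \<psi>: "\<psi> = colm m v" by (simp add: \<psi>_def v_def[abs_def])
  have be: "adj (b k) * e = v k *\<^sub>C e" if "k < m" for k
  proof -
    have "adj (b k) * e = e * adj (b k) * e" using eb[OF that] by simp
    moreover have "adj (b k) \<in> \<A>" using b that by (intro adj) auto
    from min[OF this] obtain c where "e * adj (b k) * e = c *\<^sub>C e" by blast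
    ultimately have "adj (b k) * e = c *\<^sub>C e" by simp
    then show ?thesis using te0 by (simp add: v_def)
  qed
  \<comment> \<open>The coordinates of e in the basis b are those of \<psi>, so the quadratic form
    of the representation at \<psi> computes e x e.\<close>
  have es: "e = (\<Sum>k<m. v k *\<^sub>C b k)"
  proof -
    have "e = (\<Sum>k<m. b k * adj (b k)) * e" by (rule span) (use e in auto)
    also have "\<dots> = (\<Sum>k<m. b k * (adj (b k) * e))" by (simp add: sum_distrib_right mult.assoc)
    also have "\<dots> = (\<Sum>k<m. v k *\<^sub>C b k)" by (rule sum.cong) (use be b in auto)
    finally show ?thesis .
  qed
  show exe: "e * x * e = Tr (adj \<psi> * \<rho> x * \<psi>) *\<^sub>C e" if x: "x \<in> \<A>" for x
  proof -
    obtain c where c: "e * x * e = c *\<^sub>C e" using min[OF x] by blast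
    have "c * Tr e = Tr (adj e * x * e)" using c e(2) by simp
    also have "\<dots> = (\<Sum>k<m. \<Sum>l<m. cnj (v k) * ent (\<rho> x) k l * v l) * Tr e"
      using quad[OF x, of v v] by (simp only: es[symmetric])
    finally have "c = (\<Sum>k<m. \<Sum>l<m. cnj (v k) * ent (\<rho> x) k l * v l)" using te0 by simp
    also have "\<dots> = Tr (adj \<psi> * \<rho> x * \<psi>)"
      unfolding \<psi> Tr_colm[OF dm] by (simp add: mv_def sum_distrib_left mult.assoc)
    finally show ?thesis using c by simp
  qed
  have "1 *\<^sub>C e = Tr (adj \<psi> * \<psi>) *\<^sub>C e"
    using exe[OF I] e dim by (simp add: one times_idm \<psi> mult.assoc)
  then show "Tr (adj \<psi> * \<psi>) = 1" using e(4) by (metis fmat.scale_right_imp_eq)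
qed

theorem A_qc_le_feasible:
  fixes A :: "'a set" and B :: "'b set" and S :: "'s set" and T :: "'t set"
  assumes feas: "xi_feasible A B S T P L"
  shows "A_qc A B S T P \<le> ereal (L 1)"
proof -
  define W where "W = nc_words A B S T"
  define \<phi> where "\<phi> = (\<lambda>w. L (mon w))"
  have wf: "word_feasible A B S T P \<phi>"
    unfolding \<phi>_def by (rule xi_feasible_imp_word_feasible(1)[OF feas])
  have rank: "matrix_rank W (\<lambda>u v. \<phi> (rev u @ v)) < \<infinity>"
    unfolding \<phi>_def W_def by (rule xi_feasible_imp_word_feasible(2)[OF feas])
  note w = word_feasibleD[OF wf, folded W_def]
  from GNS[OF wf, folded W_def, OF rank]
  obtain n and \<pi> :: "('a, 'b, 's, 't) symb list \<Rightarrow> fmat" and \<omega> where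
    g1: "\<forall>u\<in>W. dimle n (\<pi> u) \<and> \<pi> (rev u) = adj (\<pi> u) \<and>
      Tr (adj \<omega> * \<pi> u * \<omega>) = complex_of_real (\<phi> u)" and
    g2: "\<forall>u\<in>W. \<forall>v\<in>W. \<pi> (u @ v) = \<pi> u * \<pi> v" and \<pi>1: "\<pi> [] = idm n" and
    g3: "\<forall>g\<in>W. length g \<le> 1 \<longrightarrow> psd (\<pi> g)" and
    rel: "\<forall>r\<in>W. \<forall>R\<subseteq>W. (\<forall>u\<in>W. \<phi> (u @ r) = (\<Sum>x\<in>R. \<phi> (u @ x))) \<longrightarrow> \<pi> r = (\<Sum>x\<in>R. \<pi> x)"
    by (elim exE conjE) (rule that)
  have Wa: "u @ v \<in> W \<longleftrightarrow> u \<in> W \<and> v \<in> W" and Wr: "rev u \<in> W \<longleftrightarrow> u \<in> W" and WN: "[] \<in> W" for u v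
    by (simp_all add: W_def)
  have WX: "[SymX a s] \<in> W" if "a \<in> A" "s \<in> S" for a s using that by (simp add: W_def nc_words_Cons)
  have WY: "[SymY b t] \<in> W" if "b \<in> B" "t \<in> T" for b t using that by (simp add: W_def nc_words_Cons)
  have WZ: "[SymZ] \<in> W" "[SymZ, SymZ] \<in> W" by (simp_all add: W_def nc_words_Cons)
  have WXY: "[SymX a s, SymY b t] \<in> W" "[SymY b t, SymX a s] \<in> W" "[SymX a s, SymY b t, SymZ] \<in> W"
    if "a \<in> A" "b \<in> B" "s \<in> S" "t \<in> T" for a b s t
    using that by (simp_all add: W_def nc_words_Cons)
  have \<pi>d: "dimle n (\<pi> u)" and \<pi>a: "\<pi> (rev u) = adj (\<pi> u)" and \<pi>v: "Tr (adj \<omega> * \<pi> u * \<omega>) = complex_of_real (\<phi> u)"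
    if "u \<in> W" for u using g1 that by auto
  have \<pi>m: "\<pi> (u @ v) = \<pi> u * \<pi> v" if "u \<in> W" "v \<in> W" for u v using g2 that by blast
  have eq: "\<pi> r = \<pi> r'" if "r \<in> W" "r' \<in> W" "\<And>u. u \<in> W \<Longrightarrow> \<phi> (u @ r) = \<phi> (u @ r')" for r r'
    using rel[rule_format, of r "{r'}"] that by simp

  define \<A> where "\<A> = fmat.span (\<pi> ` W)"
  have \<pi>A: "\<pi> u \<in> \<A>" if "u \<in> W" for u using that by (simp add: \<A>_def fmat.span_base)
  have A0: "0 \<in> \<A>" and Aadd: "x \<in> \<A> \<Longrightarrow> y \<in> \<A> \<Longrightarrow> x + y \<in> \<A>" and Asc: "x \<in> \<A> \<Longrightarrow> c *\<^sub>C x \<in> \<A>" for x y c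
    by (simp_all add: \<A>_def fmat.span_zero fmat.span_add fmat.span_scale)
  \<comment> \<open>Elements of the algebra are combinations of the matrices of words, so linear
    identities are checked on words.\<close>
  have Ind: "Q x" if "x \<in> \<A>" "Q 0" "\<And>c u y. u \<in> W \<Longrightarrow> y \<in> \<A> \<Longrightarrow> Q y \<Longrightarrow> Q (c *\<^sub>C \<pi> u + y)" for Q x
  proof -
    have "x \<in> \<A> \<and> Q x" using that(1) unfolding \<A>_def
    proof (induction rule: fmat.span_induct_alt)
      case base
      then show ?case using that(2) A0 by (simp add: \<A>_def)
    next
      case (step c x y)
      then obtain u where u: "u \<in> W" "x = \<pi> u" by blast
      then show ?case using that(3)[of u y c] step Aadd Asc \<pi>A by (simp add: \<A>_def)
    qed
    then show ?thesis by blast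
  qed
  have mult1: "\<pi> u * y \<in> \<A>" if u: "u \<in> W" and y: "y \<in> \<A>" for u y
    by (rule Ind[OF y]) (use u in \<open>auto simp: A0 distrib_left \<pi>m[symmetric] Wa intro!: Aadd Asc \<pi>A\<close>)
  have mult: "x * y \<in> \<A>" if x: "x \<in> \<A>" and y: "y \<in> \<A>" for x y
    by (rule Ind[OF x]) (use mult1 y in \<open>auto simp: A0 distrib_right intro!: Aadd Asc\<close>)
  have adjA: "adj x \<in> \<A>" if x: "x \<in> \<A>" for x
    by (rule Ind[OF x]) (auto simp: A0 \<pi>a[symmetric] Wr intro!: Aadd Asc \<pi>A)
  have dimA: "dimle n x" if x: "x \<in> \<A>" for x
    by (rule Ind[OF x]) (auto intro!: dimle_add dimle_scC \<pi>d)
  interpret \<A>: star_alg n \<A> by standard (use dimA A0 Aadd Asc mult adjA in auto)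
  have IA: "idm n \<in> \<A>" using \<pi>A[OF WN] \<pi>1 by simp

  \<comment> \<open>The trace of the argument is this vector state, not the matrix trace
    \<open>Tr\<close>: it reproduces \<phi> on words, and the traciality of \<phi> extends to
    it.\<close>
  define \<tau> where "\<tau> x = Tr (adj \<omega> * x * \<omega>)" for x
  have \<tau>add: "\<tau> (x + y) = \<tau> x + \<tau> y" and \<tau>sc: "\<tau> (c *\<^sub>C x) = c * \<tau> x" and \<tau>0: "\<tau> 0 = 0"
    and \<tau>diff: "\<tau> (x - y) = \<tau> x - \<tau> y" for x y c
    by (simp_all add: \<tau>_def distrib_left distrib_right left_diff_distrib right_diff_distrib)
  have \<tau>sum: "\<tau> (\<Sum>i\<in>I. f i) = (\<Sum>i\<in>I. \<tau> (f i))" for I :: "'z set" and f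
    by (induction I rule: infinite_finite_induct) (auto simp: \<tau>0 \<tau>add)
  have \<tau>\<pi>: "\<tau> (\<pi> u) = complex_of_real (\<phi> u)" if "u \<in> W" for u using \<pi>v[OF that] by (simp add: \<tau>_def)
  have \<tau>pos: "0 \<le> \<tau> (adj x * x)" for x
    using Tr_adj_self_nonneg[of "x * \<omega>"] by (simp add: \<tau>_def mult.assoc)
  have tr1: "\<tau> (\<pi> u * y) = \<tau> (y * \<pi> u)" if u: "u \<in> W" and y: "y \<in> \<A>" for u y
  proof (rule Ind[OF y])
    fix c v y assume v: "v \<in> W" and IH: "\<tau> (\<pi> u * y) = \<tau> (y * \<pi> u)"
    have "\<tau> (\<pi> u * \<pi> v) = \<tau> (\<pi> v * \<pi> u)"
      using w(2) u v by (simp add: \<pi>m[symmetric] \<tau>\<pi> Wa)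
    then show "\<tau> (\<pi> u * (c *\<^sub>C \<pi> v + y)) = \<tau> ((c *\<^sub>C \<pi> v + y) * \<pi> u)"
      using IH by (simp add: distrib_left distrib_right \<tau>add \<tau>sc)
  qed simp
  have trace: "\<tau> (x * y) = \<tau> (y * x)" if x: "x \<in> \<A>" and y: "y \<in> \<A>" for x y
    by (rule Ind[OF x]) (use tr1 y in \<open>auto simp: distrib_left distrib_right \<tau>add \<tau>sc\<close>)

  define z where "z = \<pi> [SymZ]"
  have zA: "z \<in> \<A>" by (simp add: z_def \<pi>A WZ)
  have za: "adj z = z" using \<pi>a[OF WZ(1)] by (simp add: z_def)
  have zz: "z * z = z"
  proof -
    have "\<pi> [SymZ] = \<pi> ([SymZ] @ [SymZ])"
      by (rule eq) (use w(6) WZ in auto)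
    then show ?thesis by (simp only: \<pi>m[OF WZ(1) WZ(1)] z_def)
  qed
  have zw: "z * \<pi> u * z * \<pi> v * z = z * \<pi> v * z * \<pi> u * z" if u: "u \<in> W" and v: "v \<in> W" for u v
  proof -
    have e: "z * \<pi> u * z * \<pi> v * z = \<pi> ([SymZ] @ u @ [SymZ] @ v @ [SymZ])" if "u \<in> W" "v \<in> W" for u v
      using that WZ by (simp add: \<pi>m Wa z_def mult.assoc del: append_Cons)
    show ?thesis unfolding e[OF u v] e[OF v u]
      by (rule eq) (use w(10) u v WZ in \<open>auto simp: Wa simp del: append_Cons\<close>)
  qed
  have zc1: "z * \<pi> u * z * y * z = z * y * z * \<pi> u * z" if u: "u \<in> W" and y: "y \<in> \<A>" for u y
    by (rule Ind[OF y]) (use zw u in \<open>auto simp: distrib_left distrib_right\<close>)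
  have zc: "z * x * z * y * z = z * y * z * x * z" if x: "x \<in> \<A>" and y: "y \<in> \<A>" for x y
    by (rule Ind[OF x]) (use zc1 y in \<open>auto simp: distrib_left distrib_right\<close>)

  \<comment> \<open>The corner has unit z, and the relations \<open>R_inf\<close> say that it is
    commutative.\<close>
  define \<B> where "\<B> = {z * x * z | x. x \<in> \<A>}"
  have BA: "x \<in> \<A>" if "x \<in> \<B>" for x using that zA mult by (auto simp: \<B>_def)
  have zxzB: "z * x * z \<in> \<B>" if "x \<in> \<A>" for x using that by (auto simp: \<B>_def)
  have Bz: "z * x = x" "x * z = x" if "x \<in> \<B>" for x
  proof -
    obtain y where y: "x = z * y * z" using \<open>x \<in> \<B>\<close> by (auto simp: \<B>_def)
    have "z * x = (z * z) * y * z" "x * z = z * y * (z * z)" by (simp_all only: y mult.assoc)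
    then show "z * x = x" "x * z = x" by (simp_all add: zz y)
  qed
  have Bcomm: "x * y = y * x" if "x \<in> \<B>" "y \<in> \<B>" for x y
  proof -
    have "x * y = z * x * z * y * z" "y * x = z * y * z * x * z" using Bz that by (simp_all add: mult.assoc)
    then show ?thesis using zc BA that by simp
  qed
  have zB: "z \<in> \<B>"
    using zxzB[OF IA] dimA[OF zA] zz by (simp add: times_idm)
  interpret \<B>: star_alg n \<B>
  proof
    fix x y c assume x: "x \<in> \<B>"
    show "dimle n x" using dimA BA x by blast
    obtain x' where x': "x = z * x' * z" "x' \<in> \<A>" using x unfolding \<B>_def by blast
    have "c *\<^sub>C x = z * (c *\<^sub>C x') * z" by (simp add: x')
    then show "c *\<^sub>C x \<in> \<B>" by (simp only: zxzB[OF Asc[OF x'(2)]])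
    have "adj x = z * adj x' * z" by (simp add: x' za mult.assoc)
    then show "adj x \<in> \<B>" by (simp only: zxzB[OF adjA[OF x'(2)]])
    assume y: "y \<in> \<B>"
    then obtain y' where y': "y = z * y' * z" "y' \<in> \<A>" unfolding \<B>_def by blast
    have "x + y = z * (x' + y') * z" by (simp add: x' y' distrib_left distrib_right)
    then show "x + y \<in> \<B>" by (simp only: zxzB[OF Aadd[OF x'(2) y'(2)]])
    have "z * (x * y) * z = (z * x) * (y * z)" by (simp only: mult.assoc)
    then show "x * y \<in> \<B>"
      using zxzB[OF mult[OF BA[OF x] BA[OF y]]] Bz(1)[OF x] Bz(2)[OF y] by simp
  next
    show "0 \<in> \<B>" using zxzB[OF A0] by simp
  qed
  have "\<exists>F. finite F \<and> F \<subseteq> \<B> \<and> (\<forall>e\<in>F. e \<noteq> 0 \<and> adj e = e \<and> e * e = e) \<and>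
    (\<forall>e\<in>F. \<forall>f\<in>F. e \<noteq> f \<longrightarrow> e * f = 0) \<and> \<Sum>F = z \<and> (\<forall>e\<in>F. \<forall>x\<in>\<B>. \<exists>c. x * e = c *\<^sub>C e)"
    by (rule \<B>.commutative_projections[OF _ zB]) (simp_all add: Bcomm Bz)
  then obtain F where F: "finite F" "F \<subseteq> \<B>" "\<forall>e\<in>F. e \<noteq> 0 \<and> adj e = e \<and> e * e = e"
    "\<forall>e\<in>F. \<forall>f\<in>F. e \<noteq> f \<longrightarrow> e * f = 0" "\<Sum>F = z" "\<forall>e\<in>F. \<forall>x\<in>\<B>. \<exists>c. x * e = c *\<^sub>C e"
    by (elim exE conjE) (rule that)
  have eB: "e \<in> \<B>" and eA: "e \<in> \<A>" and e0: "e \<noteq> 0" and ea: "adj e = e" and ee: "e * e = e" if "e \<in> F" for e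
    using F BA that by auto
  have ef: "e * f = 0" if "e \<in> F" "f \<in> F" "e \<noteq> f" for e f using F(4) that by blast
  \<comment> \<open>Since e and f are absorbed by z, x may be replaced by its compression, which
    commutes with e. For f = e this yields minimality of e, for f different from e it yields e x f =
    0.\<close>
  have swap: "e * x * f = (z * x * z) * (e * f)" if "e \<in> F" "f \<in> F" "x \<in> \<A>" for e f x
  proof -
    have "e * x * f = e * (z * x * z) * f"
      using Bz[OF eB[OF that(1)]] Bz[OF eB[OF that(2)]] by (metis mult.assoc)
    also have "\<dots> = (z * x * z) * e * f"
      using Bcomm[OF eB[OF that(1)] zxzB[OF that(3)]] by simp
    finally show ?thesis by (simp add: mult.assoc)
  qed
  have min: "\<forall>x\<in>\<A>. \<exists>c. e * x * e = c *\<^sub>C e" if e: "e \<in> F" for e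
    using swap[OF e e] ee[OF e] F(6) e zxzB by simp
  have exf: "e * x * f = 0" if "e \<in> F" "f \<in> F" "e \<noteq> f" "x \<in> \<A>" for e f x
    using swap[OF that(1,2,4)] ef[OF that(1-3)] by simp
  have "\<forall>e\<in>F. \<exists>m b. (\<forall>k<m. b k \<in> \<A> \<and> b k * e = b k) \<and>
    (\<forall>k<m. \<forall>l<m. adj (b k) * b l = (if k = l then e else 0)) \<and>
    (\<forall>x\<in>\<A>. x * e = x \<longrightarrow> x = (\<Sum>k<(m::nat). b k * adj (b k)) * x)"
    by (intro ballI \<A>.matrix_units eA ea ee e0 min) simp_all
  from bchoice[OF this] obtain m where "\<forall>e\<in>F. \<exists>b. (\<forall>k<m e. b k \<in> \<A> \<and> b k * e = b k) \<and>
    (\<forall>k<m e. \<forall>l<m e. adj (b k) * b l = (if k = l then e else 0)) \<and>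
    (\<forall>x\<in>\<A>. x * e = x \<longrightarrow> x = (\<Sum>k<(m e::nat). b k * adj (b k)) * x)"
    by (elim exE) (rule that)
  from bchoice[OF this] obtain b where mb: "\<forall>e\<in>F. (\<forall>k<m e. b e k \<in> \<A> \<and> b e k * e = b e k) \<and>
    (\<forall>k<m e. \<forall>l<m e. adj (b e k) * b e l = (if k = l then e else 0)) \<and>
    (\<forall>x\<in>\<A>. x * e = x \<longrightarrow> x = (\<Sum>k<(m e::nat). b e k * adj (b e k)) * x)"
    by (elim exE) (rule that)
  have b1: "b e k \<in> \<A> \<and> b e k * e = b e k" if "e \<in> F" "k < m e" for e k using mb that by blast
  have b2: "adj (b e k) * b e l = (if k = l then e else 0)" if "e \<in> F" "k < m e" "l < m e" for e k l
    using mb that by blast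
  have mb': "\<forall>k<m e. b e k \<in> \<A> \<and> b e k * e = b e k"
    "\<forall>k<m e. \<forall>l<m e. adj (b e k) * b e l = (if k = l then e else 0)"
    "\<forall>x\<in>\<A>. x * e = x \<longrightarrow> x = (\<Sum>k<m e. b e k * adj (b e k)) * x" if "e \<in> F" for e
    using bspec[OF mb that] by - ((elim conjE, assumption)+)

  define \<rho> where "\<rho> e x = mk (m e) (\<lambda>k l. Tr (adj (b e k) * x * b e l) / Tr e)" for e x
  define \<psi> where "\<psi> e = colm (m e) (\<lambda>k. Tr (adj (b e k) * e) / Tr e)" for e
  define Q where "Q e a b s t = Re (Tr (adj (\<psi> e) * (\<rho> e (\<pi> [SymX a s]) * \<rho> e (\<pi> [SymY b t])) * \<psi> e))"
    for e a b s t
  have pX: "(\<Sum>a\<in>A. \<pi> [SymX a s]) = idm n" if "s \<in> S" for s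
  proof -
    have "\<pi> [] = (\<Sum>x\<in>(\<lambda>a. [SymX a s]) ` A. \<pi> x)"
      by (rule rel[rule_format]) (use w(7) WX that WN in \<open>auto simp: sum.reindex inj_on_def\<close>)
    then show ?thesis by (simp add: \<pi>1 sum.reindex inj_on_def)
  qed
  have pY: "(\<Sum>b\<in>B. \<pi> [SymY b t]) = idm n" if "t \<in> T" for t
  proof -
    have "\<pi> [] = (\<Sum>x\<in>(\<lambda>b. [SymY b t]) ` B. \<pi> x)"
      by (rule rel[rule_format]) (use w(8) WY that WN in \<open>auto simp: sum.reindex inj_on_def\<close>)
    then show ?thesis by (simp add: \<pi>1 sum.reindex inj_on_def)
  qed
  have pXY: "\<pi> [SymX a s] * \<pi> [SymY b t] = \<pi> [SymY b t] * \<pi> [SymX a s]"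
    if "a \<in> A" "b \<in> B" "s \<in> S" "t \<in> T" for a b s t
  proof -
    have X: "[SymX a s] \<in> W" and Y: "[SymY b t] \<in> W" using that WX WY by auto
    have "\<pi> ([SymX a s] @ [SymY b t]) = \<pi> ([SymY b t] @ [SymX a s])"
      by (rule eq) (use w(9) WXY that in auto)
    then show ?thesis by (simp only: \<pi>m[OF X Y] \<pi>m[OF Y X])
  qed
  have model: "Q e \<in> C_q A B S T \<and> Dnat A B S T (Q e) \<le> m e \<and>
    (\<forall>a\<in>A. \<forall>b\<in>B. \<forall>s\<in>S. \<forall>t\<in>T.
      e * (\<pi> [SymX a s] * \<pi> [SymY b t]) * e = complex_of_real (Q e a b s t) *\<^sub>C e)" if e: "e \<in> F" for e
  proof -
    note rep = minimal_projection_representation[OF \<A>.star_alg_axioms IA eA[OF e] ea[OF e] ee[OF e]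
        e0[OF e] min[OF e] mb'[OF e], folded \<rho>_def \<psi>_def]
    have pX': "povm (m e) A (\<lambda>a. \<rho> e (\<pi> [SymX a s]))" if "s \<in> S" for s
      unfolding povm_def
    proof (intro conjI ballI)
      fix a assume "a \<in> A"
      then show "psd (\<rho> e (\<pi> [SymX a s]))"
        using rep(5)[OF \<pi>A] g3 WX that by simp
    qed (simp_all add: rep(1) rep(4)[symmetric] rep(2) pX that)
    have pY': "povm (m e) B (\<lambda>b. \<rho> e (\<pi> [SymY b t]))" if "t \<in> T" for t
      unfolding povm_def
    proof (intro conjI ballI)
      fix b assume "b \<in> B"
      then show "psd (\<rho> e (\<pi> [SymY b t]))"
        using rep(5)[OF \<pi>A] g3 WY that by simp
    qed (simp_all add: rep(1) rep(4)[symmetric] rep(2) pY that)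
    have XY: "\<rho> e (\<pi> [SymX a s]) * \<rho> e (\<pi> [SymY b t]) = \<rho> e (\<pi> [SymX a s] * \<pi> [SymY b t])"
      "\<rho> e (\<pi> [SymY b t]) * \<rho> e (\<pi> [SymX a s]) = \<rho> e (\<pi> [SymX a s] * \<pi> [SymY b t])"
      if "a \<in> A" "b \<in> B" "s \<in> S" "t \<in> T" for a b s t
    proof -
      have X: "\<pi> [SymX a s] \<in> \<A>" and Y: "\<pi> [SymY b t] \<in> \<A>" using \<pi>A WX WY that by auto
      show "\<rho> e (\<pi> [SymX a s]) * \<rho> e (\<pi> [SymY b t]) = \<rho> e (\<pi> [SymX a s] * \<pi> [SymY b t])"
        by (rule rep(3)[OF X Y, symmetric])
      show "\<rho> e (\<pi> [SymY b t]) * \<rho> e (\<pi> [SymX a s]) = \<rho> e (\<pi> [SymX a s] * \<pi> [SymY b t])"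
        unfolding pXY[OF that] by (rule rep(3)[OF Y X, symmetric])
    qed
    have u: "idm (m e) * \<psi> e = \<psi> e" "\<psi> e * idm 1 = \<psi> e" by (simp_all add: \<psi>_def)
    have q: "qc_model A B S T (m e) (\<lambda>s a. \<rho> e (\<pi> [SymX a s])) (\<lambda>t b. \<rho> e (\<pi> [SymY b t])) (\<psi> e) (Q e)"
      unfolding Q_def by (rule qc_model_exists(1)[OF pX' pY' _ u rep(7)]) (simp_all add: XY)
    have c: "correlation A B S T (Q e)"
      unfolding Q_def by (rule qc_model_exists(2)[OF pX' pY' _ u rep(7)]) (simp_all add: XY)
    have "e * (\<pi> [SymX a s] * \<pi> [SymY b t]) * e = complex_of_real (Q e a b s t) *\<^sub>C e"
      if "a \<in> A" "b \<in> B" "s \<in> S" "t \<in> T" for a b s t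
    proof -
      have "complex_of_real (Q e a b s t) = Tr (adj (\<psi> e) * (\<rho> e (\<pi> [SymX a s]) * \<rho> e (\<pi> [SymY b t])) * \<psi> e)"
        using q that unfolding qc_model_def by blast
      then show ?thesis
        unfolding XY(1)[OF that] using rep(6)[OF mult[OF \<pi>A[OF WX] \<pi>A[OF WY]]] that by simp
    qed
    moreover have "Q e \<in> C_qc_dim A B S T (enat (m e))" using q c by (auto simp: C_qc_dim_iff)
    ultimately show ?thesis using qc_model_imp_C_q[OF c q] Dnat_le by blast
  qed
  \<comment> \<open>The weights are the traces of the minimal projections; they sum to the trace of
    z, which is 1.\<close>
  define l where "l e = Re (\<tau> e)" for e
  have \<tau>e: "\<tau> e = complex_of_real (l e)" "0 \<le> l e" if "e \<in> F" for e
    using \<tau>pos[of e] ea[OF that] ee[OF that] by (auto simp: l_def less_eq_complex_def complex_eq_iff)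
  have "(\<Sum>e\<in>F. complex_of_real (l e)) = \<tau> z"
    unfolding F(5)[symmetric] \<tau>sum using \<tau>e by simp
  also have "\<dots> = 1" using \<tau>\<pi>[OF WZ(1)] w(3) by (simp add: z_def)
  finally have l1: "(\<Sum>e\<in>F. l e) = 1" by (simp only: of_real_sum[symmetric] of_real_eq_1_iff)
  have "dec A B S T P F l Q"
    unfolding dec_def
  proof (intro conjI ballI)
    fix a b s t assume ab: "a \<in> A" "b \<in> B" "s \<in> S" "t \<in> T"
    define g where "g = \<pi> [SymX a s] * \<pi> [SymY b t]"
    have gA: "g \<in> \<A>" unfolding g_def using mult[OF \<pi>A \<pi>A] WX WY ab by simp
    have "complex_of_real (P a b s t) = \<tau> (\<pi> ([SymX a s] @ [SymY b t] @ [SymZ]))"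
      using \<tau>\<pi>[OF WXY(3)[OF ab]] w(4) ab by simp
    also have "\<dots> = \<tau> (g * z)"
      using WX WY WZ ab by (simp only: \<pi>m Wa g_def z_def mult.assoc)
    also have "\<dots> = (\<Sum>e\<in>F. \<tau> (g * e))" unfolding F(5)[symmetric] sum_distrib_left \<tau>sum ..
    also have "\<dots> = (\<Sum>e\<in>F. complex_of_real (l e * Q e a b s t))"
    proof (rule sum.cong[OF refl])
      fix e assume e: "e \<in> F"
      \<comment> \<open>Doubling e and cycling it to the front gives the compression e g e, whose
        scalar factor is the value of the correlation attached to e.\<close>
      have "\<tau> (g * e) = \<tau> ((g * e) * e)" by (simp add: mult.assoc ee[OF e])
      also have "\<dots> = \<tau> (e * (g * e))" by (rule trace[OF mult[OF gA eA[OF e]] eA[OF e]])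
      also have "\<dots> = complex_of_real (l e * Q e a b s t)"
        using model[OF e] ab by (simp add: mult.assoc[symmetric] g_def \<tau>sc \<tau>e(1)[OF e])
      finally show "\<tau> (g * e) = complex_of_real (l e * Q e a b s t)" .
    qed
    finally show "P a b s t = (\<Sum>e\<in>F. l e * Q e a b s t)"
      by (simp only: of_real_sum[symmetric] of_real_eq_iff)
  qed (use F(1) \<tau>e(2) model l1 in auto)
  then have "A_qc A B S T P \<le> ereal (cost A B S T F l Q)" by (rule A_qc_le)
  moreover have "cost A B S T F l Q \<le> L 1"
  proof -
    define J where "J = (SIGMA e:F. {..<m e})"
    define h where "h p = b (fst p) (snd p) * adj (b (fst p) (snd p))" for p
    have fJ: "finite J" using F(1) by (simp add: J_def)
    have hA: "h p \<in> \<A>" if "p \<in> J" for p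
      using that b1 mult adjA by (auto simp: J_def h_def)
    have hh: "h p * h p' = (if p = p' then h p else 0)" if p: "p \<in> J" and p': "p' \<in> J" for p p'
    proof -
      obtain e k e' k' where q: "p = (e, k)" "p' = (e', k')" "e \<in> F" "k < m e" "e' \<in> F" "k' < m e'"
        using p p' by (auto simp: J_def)
      have 1: "h p * h p' = b e k * (adj (b e k) * b e' k') * adj (b e' k')"
        by (simp add: h_def q mult.assoc)
      show ?thesis
      proof (cases "e = e'")
        case True
        then have "h p * h p' = b e k * (if k = k' then e else 0) * adj (b e' k')"
          unfolding 1 using b2[OF q(3,4), of k'] q(6) by (simp only:)
        then show ?thesis
          using q(1,2) b1[OF q(3,4)] True by (cases "k = k'") (simp_all add: h_def)
      next
        case False
        \<comment> \<open>For different projections the middle product lies between e and e', where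
          the compression vanishes.\<close>
        have "e * adj (b e k) = adj (b e k)" using b1[OF q(3,4)] ea[OF q(3)] by (metis adj_mult)
        then have "adj (b e k) * b e' k' = e * (adj (b e k) * b e' k') * e'"
          using b1[OF q(5,6)] by (metis mult.assoc)
        also have "\<dots> = 0"
          by (rule exf) (use q False b1 mult adjA in auto)
        finally show ?thesis using 1 q False by simp
      qed
    qed
    define q where "q = (\<Sum>p\<in>J. h p)"
    have qA: "q \<in> \<A>" unfolding q_def by (rule \<A>.sum) (rule hA)
    have "q * q = (\<Sum>p\<in>J. \<Sum>p'\<in>J. if p' = p then h p else 0)"
      unfolding q_def sum_product by (intro sum.cong refl) (simp add: hh)
    also have "\<dots> = q" using fJ by (simp add: q_def)
    finally have qq: "q * q = q" .
    have qa: "adj q = q" by (simp add: q_def h_def)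
    \<comment> \<open>The sum q of the orthogonal projections is a projection, so its complement has
      nonnegative trace and q has trace at most that of the unit.\<close>
    have "adj (idm n - q) * (idm n - q) = idm n - q"
      using dimA[OF qA] by (simp add: qa algebra_simps qq idm_times times_idm)
    then have "0 \<le> \<tau> (idm n - q)" using \<tau>pos[of "idm n - q"] by simp
    moreover have "\<tau> (idm n) = complex_of_real (L 1)"
      using \<tau>\<pi>[OF WN] \<pi>1 by (simp add: \<phi>_def one_mon)
    moreover have "\<tau> q = complex_of_real (\<Sum>e\<in>F. l e * real (m e))"
    proof -
      have "\<tau> q = (\<Sum>p\<in>J. complex_of_real (l (fst p)))"
        unfolding q_def \<tau>sum
      proof (rule sum.cong[OF refl])
        fix p assume "p \<in> J"
        then obtain e k where p: "p = (e, k)" "e \<in> F" "k < m e" by (auto simp: J_def)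
        \<comment> \<open>Traciality exchanges the range projection with the initial projection e,
          so each of the m e projections contributes the weight of e.\<close>
        have "\<tau> (h p) = \<tau> (adj (b e k) * b e k)"
          using trace[of "b e k" "adj (b e k)"] b1[OF p(2,3)] adjA by (simp add: h_def p)
        then show "\<tau> (h p) = complex_of_real (l (fst p))" using b2[OF p(2,3,3)] \<tau>e(1)[OF p(2)] by (simp add: p)
      qed
      also have "\<dots> = (\<Sum>e\<in>F. \<Sum>k<m e. complex_of_real (l e))"
        unfolding J_def by (subst sum.Sigma) (auto simp: F(1) case_prod_unfold)
      also have "\<dots> = complex_of_real (\<Sum>e\<in>F. l e * real (m e))" by (simp add: mult.commute)
      finally show ?thesis .
    qed
    ultimately have "(\<Sum>e\<in>F. l e * real (m e)) \<le> L 1"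
      by (simp add: \<tau>diff less_eq_complex_def)
    moreover have "cost A B S T F l Q \<le> (\<Sum>e\<in>F. l e * real (m e))"
      unfolding cost_def by (intro sum_mono mult_left_mono) (use model \<tau>e(2) in auto)
    ultimately show ?thesis by linarith
  qed
  ultimately show ?thesis by (metis ereal_less_eq(3) order_trans)
qed

theorem proposition2p8:
  fixes A :: "'a set" and B :: "'b set" and S :: "'s set" and T :: "'t set"
    and P :: "'a \<Rightarrow> 'b \<Rightarrow> 's \<Rightarrow> 't \<Rightarrow> real"
  assumes "finite A" and "finite B" and "finite S" and "finite T"
    and "P \<in> C_q A B S T"
  shows "xi_star_q A B S T P = A_qc A B S T P"
  unfolding xi_star_q_def
proof (rule Least_equality)
  show "\<exists>L. xi_feasible A B S T P L \<and> A_qc A B S T P = ereal (L 1)"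
    using A_qc_feasible[OF assms] by metis
  show "A_qc A B S T P \<le> v" if "\<exists>L. xi_feasible A B S T P L \<and> v = ereal (L 1)" for v
    using that A_qc_le_feasible by blast
qed

end
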